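(* Let $G^\circ=(G,\gamma)$, $H^\circ=(H,\eta)$ be unimodular second-countable locally compact groups with fixed Haar measures and let $R^\circ\in\operatorname{Polh}(G^\circ,H^\circ)$ be nonzero. Then the operator $$\widetilde\Pi(R^\circ):=\bigl(\alpha(R^\circ)\,\beta(R^\circ)\bigr)^{-1/2}\,\Pi(R^\circ):\ L^2(H)\to L^2(G)$$ is a partial isometry. The initial subspace of $\widetilde\Pi(R^\circ)$ is $L^2(\operatorname{im}R)^{\operatorname{indef}R}$, and the final subspace is $L^2(\operatorname{dom}R)^{\ker R}$.
   Context: All locally compact groups are second countable. A nonzero polyhomomorphism $R^\circ=(R,\rho)\in\operatorname{Polh}(G^\circ,H^\circ)$ is a closed subgroup $R\subset G\times H$ with a fixed Haar measure $\rho$ on $R$ such that the image of $\rho$ under the projection to $G$ is dominated by $\gamma$ (i.e. $\rho(R\cap(A\times H))\le\gamma(A)$ for all Borel $A\subset G$) and the image under the projection to $H$ is dominated by $\eta$. For a subgroup $R\subset G\times H$: $\operatorname{dom}R$, $\operatorname{im}R$ are its projections to $G$ and $H$; $\ker R=\{g:(g,1)\in R\}$ (a normal subgroup of $\operatorname{dom}R$); $\operatorname{indef}R=\{h:(1,h)\in R\}$ (a normal subgroup of $\operatorname{im}R$). For nonzero $R^\circ$, the subgroups $\operatorname{dom}R,\operatorname{im}R$ are open, $\ker R$, $\operatorname{indef}R$ are compact, the image of $\rho$ in $G$ equals $\alpha(R^\circ)\gamma|_{\operatorname{dom}R}$ and the image in $H$ equals $\beta(R^\circ)\eta|_{\operatorname{im}R}$,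 with constants $0<\alpha(R^\circ),\beta(R^\circ)\le1$. The operator $\Pi(R^\circ):L^2(H,\eta)\to L^2(G,\gamma)$ is the bounded operator determined by $$\langle\varphi,\Pi(R^\circ)\psi\rangle_{L^2(G)}=\int_{R}\varphi(g)\,\overline{\psi(h)}\,d\rho(g,h)\qquad\text{for all }\varphi\in L^2(G),\ \psi\in L^2(H).$$ For an open subgroup $\Phi\subset G$ and a compact normal subgroup $\Delta$ of $\Phi$, $L^2(\Phi)^\Delta\subset L^2(G)$ is the subspace of functions supported by $\Phi$ and invariant with respect to $\Delta$. A bounded operator $A:V\to W$ of Hilbert spaces is a partial isometry with initial subspace $L\subset V$ and final subspace $M\subset W$ if $A|_L$ is a unitary operator $L\to M$ and $A|_{L^\perp}=0$. *)

theory Defs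
  imports "HOL-Analysis.Analysis"
begin

text \<open>
  Groups are types of class \<open>topological_group_add\<close>. That class does not assume commutativity, so a
  general locally compact group is written additively here: \<open>x + y\<close>, \<open>- x\<close> and \<open>0\<close> stand for
  \<open>xy\<close>, \<open>x\<inverse>\<close> and \<open>1\<close>. The product group is \<open>'g \<times> 'h\<close> with componentwise operations.
\<close>

section \<open>Haar measures and polyhomomorphisms\<close>

definition add_subgroup :: "'a::group_add set \<Rightarrow> bool" where
  "add_subgroup S \<longleftrightarrow> 0 \<in> S \<and> (\<forall>x\<in>S. \<forall>y\<in>S. x + y \<in> S) \<and> (\<forall>x\<in>S. - x \<in> S)"

text \<open>
  Left Haar measures on a closed subgroup \<open>S\<close>. In the second countable locally compact setting every
  Borel measure that is finite on compact sets is regular, so regularity is not required separately.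
\<close>

definition haar_measure_on ::
    "'a::{group_add, topological_space} set \<Rightarrow> 'a measure \<Rightarrow> bool" where
  "haar_measure_on S \<mu> \<longleftrightarrow>
     space \<mu> = S \<and> sets \<mu> = sets (restrict_space borel S) \<and>
     emeasure \<mu> S \<noteq> 0 \<and>
     (\<forall>K. compact K \<and> K \<subseteq> S \<longrightarrow> emeasure \<mu> K < \<infinity>) \<and>
     (\<forall>x\<in>S. \<forall>A\<in>sets \<mu>. emeasure \<mu> ((\<lambda>y. x + y) ` A) = emeasure \<mu> A)"

text \<open>
  \<open>\<mu>\<close> is a Haar measure on the whole group and the group is unimodular: by uniqueness of Haar measures,
  the modular function is trivial iff one (equivalently, every) left Haar measure is right invariant.
\<close>

definition unimodular_lc_group ::
    "'a::{topological_group_add, t2_space, second_countable_topology} measure \<Rightarrow> bool" where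
  "unimodular_lc_group \<mu> \<longleftrightarrow>
     locally compact (UNIV :: 'a set) \<and> haar_measure_on UNIV \<mu> \<and>
     (\<forall>x. \<forall>A\<in>sets \<mu>. emeasure \<mu> ((\<lambda>y. y + x) ` A) = emeasure \<mu> A)"

definition nonzero_polyhom ::
    "'g::{topological_group_add, t2_space, second_countable_topology} measure \<Rightarrow>
     'h::{topological_group_add, t2_space, second_countable_topology} measure \<Rightarrow>
     ('g \<times> 'h) set \<Rightarrow> ('g \<times> 'h) measure \<Rightarrow> bool" where
  "nonzero_polyhom \<gamma> \<eta> R \<rho> \<longleftrightarrow>
     add_subgroup R \<and> closed R \<and> haar_measure_on R \<rho> \<and>
     (\<forall>A\<in>sets borel. emeasure \<rho> (R \<inter> (A \<times> UNIV)) \<le> emeasure \<gamma> A) \<and>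
     (\<forall>B\<in>sets borel. emeasure \<rho> (R \<inter> (UNIV \<times> B)) \<le> emeasure \<eta> B)"

text \<open>The projections of \<open>R\<close> to the two factors are the library's \<open>Domain R\<close> and \<open>Range R\<close>.\<close>

definition ker_rel :: "('g::zero \<times> 'h::zero) set \<Rightarrow> 'g set" where
  "ker_rel R = {g. (g, 0) \<in> R}"

definition indef_rel :: "('g::zero \<times> 'h::zero) set \<Rightarrow> 'h set" where
  "indef_rel R = {h. (0, h) \<in> R}"

definition alpha_const ::
    "'g::topological_space measure \<Rightarrow> ('g \<times> 'h) set \<Rightarrow> ('g \<times> 'h) measure \<Rightarrow> real" where
  "alpha_const \<gamma> R \<rho> =
     (THE a. 0 < a \<and> (\<forall>A\<in>sets borel.
        emeasure \<rho> (R \<inter> (A \<times> UNIV)) = ennreal a * emeasure \<gamma> (A \<inter> Domain R)))"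

definition beta_const ::
    "'h::topological_space measure \<Rightarrow> ('g \<times> 'h) set \<Rightarrow> ('g \<times> 'h) measure \<Rightarrow> real" where
  "beta_const \<eta> R \<rho> =
     (THE b. 0 < b \<and> (\<forall>B\<in>sets borel.
        emeasure \<rho> (R \<inter> (UNIV \<times> B)) = ennreal b * emeasure \<eta> (B \<inter> Range R)))"

section \<open>Hilbert spaces and partial isometries\<close>

text \<open>
  The data of a complex Hilbert space on an explicit carrier. Operators between two such spaces are
  extensional functions (\<open>undefined\<close> off the carrier), so that an operator is determined by its
  values on the carrier.
\<close>

record 'v hilbert_data =
  hcarrier :: "'v set"
  hzero :: 'v
  hadd :: "'v \<Rightarrow> 'v \<Rightarrow> 'v"
  hscale :: "complex \<Rightarrow> 'v \<Rightarrow> 'v"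
  hinner :: "'v \<Rightarrow> 'v \<Rightarrow> complex"

definition hnorm :: "'v hilbert_data \<Rightarrow> 'v \<Rightarrow> real" where
  "hnorm V x = sqrt (Re (hinner V x x))"

definition hdiff :: "'v hilbert_data \<Rightarrow> 'v \<Rightarrow> 'v \<Rightarrow> 'v" where
  "hdiff V x y = hadd V x (hscale V (-1) y)"

definition closed_subspace :: "'v hilbert_data \<Rightarrow> 'v set \<Rightarrow> bool" where
  "closed_subspace V L \<longleftrightarrow>
     L \<subseteq> hcarrier V \<and> hzero V \<in> L \<and>
     (\<forall>x\<in>L. \<forall>y\<in>L. hadd V x y \<in> L) \<and> (\<forall>c. \<forall>x\<in>L. hscale V c x \<in> L) \<and>
     (\<forall>s x. (\<forall>n. s n \<in> L) \<and> x \<in> hcarrier V \<and> (\<lambda>n. hnorm V (hdiff V (s n) x)) \<longlonglongrightarrow> 0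
        \<longrightarrow> x \<in> L)"

definition ortho_complement :: "'v hilbert_data \<Rightarrow> 'v set \<Rightarrow> 'v set" where
  "ortho_complement V L = {x \<in> hcarrier V. \<forall>y\<in>L. hinner V x y = 0}"

definition bounded_operator ::
    "'v hilbert_data \<Rightarrow> 'w hilbert_data \<Rightarrow> ('v \<Rightarrow> 'w) \<Rightarrow> bool" where
  "bounded_operator V W T \<longleftrightarrow>
     T \<in> hcarrier V \<rightarrow>\<^sub>E hcarrier W \<and>
     (\<forall>x\<in>hcarrier V. \<forall>y\<in>hcarrier V. T (hadd V x y) = hadd W (T x) (T y)) \<and>
     (\<forall>c. \<forall>x\<in>hcarrier V. T (hscale V c x) = hscale W c (T x)) \<and>
     (\<exists>C. \<forall>x\<in>hcarrier V. hnorm W (T x) \<le> C * hnorm V x)"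

definition scale_operator ::
    "'v hilbert_data \<Rightarrow> 'w hilbert_data \<Rightarrow> complex \<Rightarrow> ('v \<Rightarrow> 'w) \<Rightarrow> 'v \<Rightarrow> 'w" where
  "scale_operator V W c T = (\<lambda>x\<in>hcarrier V. hscale W c (T x))"

text \<open>Linearity of the restriction is part of \<open>bounded_operator\<close> in \<open>partial_isometry\<close> below.\<close>

definition unitary_on ::
    "'v hilbert_data \<Rightarrow> 'w hilbert_data \<Rightarrow> 'v set \<Rightarrow> 'w set \<Rightarrow> ('v \<Rightarrow> 'w) \<Rightarrow> bool" where
  "unitary_on V W L M T \<longleftrightarrow>
     bij_betw T L M \<and> (\<forall>x\<in>L. \<forall>y\<in>L. hinner W (T x) (T y) = hinner V x y)"

definition partial_isometry ::
    "'v hilbert_data \<Rightarrow> 'w hilbert_data \<Rightarrow> 'v set \<Rightarrow> 'w set \<Rightarrow> ('v \<Rightarrow> 'w) \<Rightarrow> bool" where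
  "partial_isometry V W L M T \<longleftrightarrow>
     bounded_operator V W T \<and> closed_subspace V L \<and> closed_subspace W M \<and>
     unitary_on V W L M T \<and> (\<forall>x\<in>ortho_complement V L. T x = hzero W)"

section \<open>The spaces \<open>L\<^sup>2\<close>\<close>

definition square_integrable :: "'a measure \<Rightarrow> ('a \<Rightarrow> complex) set" where
  "square_integrable \<mu> = {f \<in> borel_measurable \<mu>. integrable \<mu> (\<lambda>x. (cmod (f x))\<^sup>2)}"

text \<open>Elements of \<open>L\<^sup>2\<close> are classes of square integrable functions modulo a.e. equality.\<close>

definition l2_class :: "'a measure \<Rightarrow> ('a \<Rightarrow> complex) \<Rightarrow> ('a \<Rightarrow> complex) set" where
  "l2_class \<mu> f = {g \<in> square_integrable \<mu>. AE x in \<mu>. g x = f x}"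

definition l2_rep :: "('a \<Rightarrow> complex) set \<Rightarrow> 'a \<Rightarrow> complex" where
  "l2_rep X = (SOME f. f \<in> X)"

definition L2 :: "'a measure \<Rightarrow> ('a \<Rightarrow> complex) set hilbert_data" where
  "L2 \<mu> = \<lparr> hcarrier = l2_class \<mu> ` square_integrable \<mu>,
            hzero = l2_class \<mu> (\<lambda>x. 0),
            hadd = (\<lambda>X Y. l2_class \<mu> (\<lambda>x. l2_rep X x + l2_rep Y x)),
            hscale = (\<lambda>c X. l2_class \<mu> (\<lambda>x. c * l2_rep X x)),
            hinner = (\<lambda>X Y. LINT x|\<mu>. l2_rep X x * cnj (l2_rep Y x)) \<rparr>"

text \<open>
  \<open>L\<^sup>2(\<Phi>)\<^sup>\<Delta>\<close> inside \<open>L\<^sup>2\<close> of the ambient group: invariance means that every translation by an element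
  of \<open>\<Delta>\<close> fixes the class. Left translations are used; as \<open>\<Delta>\<close> is normal in \<open>\<Phi>\<close> and the functions are
  supported by \<open>\<Phi>\<close>, right translations give the same subspace.
\<close>

definition L2_supp_inv ::
    "'a::plus measure \<Rightarrow> 'a set \<Rightarrow> 'a set \<Rightarrow> ('a \<Rightarrow> complex) set set" where
  "L2_supp_inv \<mu> \<Phi> \<Delta> = {X \<in> hcarrier (L2 \<mu>). \<forall>f\<in>X.
     (AE x in \<mu>. x \<notin> \<Phi> \<longrightarrow> f x = 0) \<and> (\<forall>d\<in>\<Delta>. AE x in \<mu>. f (d + x) = f x)}"

definition Pi_op ::
    "'g measure \<Rightarrow> 'h measure \<Rightarrow> ('g \<times> 'h) measure \<Rightarrow>
     ('h \<Rightarrow> complex) set \<Rightarrow> ('g \<Rightarrow> complex) set" where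
  "Pi_op \<gamma> \<eta> \<rho> = (THE T. bounded_operator (L2 \<eta>) (L2 \<gamma>) T \<and>
     (\<forall>\<phi>\<in>square_integrable \<gamma>. \<forall>\<psi>\<in>square_integrable \<eta>.
        hinner (L2 \<gamma>) (l2_class \<gamma> \<phi>) (T (l2_class \<eta> \<psi>)) =
          (LINT p|\<rho>. \<phi> (fst p) * cnj (\<psi> (snd p)))))"

definition Pi_tilde ::
    "'g::topological_space measure \<Rightarrow> 'h::topological_space measure \<Rightarrow>
     ('g \<times> 'h) set \<Rightarrow> ('g \<times> 'h) measure \<Rightarrow> ('h \<Rightarrow> complex) set \<Rightarrow> ('g \<Rightarrow> complex) set" where
  "Pi_tilde \<gamma> \<eta> R \<rho> =
     scale_operator (L2 \<eta>) (L2 \<gamma>)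
       (complex_of_real ((alpha_const \<gamma> R \<rho> * beta_const \<eta> R \<rho>) powr (-1/2)))
       (Pi_op \<gamma> \<eta> \<rho>)"

text \<open>The operations of \<open>L2\<close> do not depend on the chosen representatives.\<close>

lemma square_integrable_add:
  assumes "f \<in> square_integrable \<mu>" "g \<in> square_integrable \<mu>"
  shows "(\<lambda>x. f x + g x) \<in> square_integrable \<mu>"
proof -
  have m: "f \<in> borel_measurable \<mu>" "g \<in> borel_measurable \<mu>"
    and i: "integrable \<mu> (\<lambda>x. (cmod (f x))\<^sup>2)" "integrable \<mu> (\<lambda>x. (cmod (g x))\<^sup>2)"
    using assms by (auto simp: square_integrable_def)
  have b: "(cmod (f x + g x))\<^sup>2 \<le> 2 * (cmod (f x))\<^sup>2 + 2 * (cmod (g x))\<^sup>2" for x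
  proof -
    have "(cmod (f x + g x))\<^sup>2 \<le> (cmod (f x) + cmod (g x))\<^sup>2"
      by (intro power_mono norm_triangle_ineq norm_ge_zero)
    also have "\<dots> \<le> 2 * (cmod (f x))\<^sup>2 + 2 * (cmod (g x))\<^sup>2"
      using zero_le_power2[of "cmod (f x) - cmod (g x)"]
      by (simp add: power2_eq_square algebra_simps)
    finally show ?thesis .
  qed
  have "integrable \<mu> (\<lambda>x. (cmod (f x + g x))\<^sup>2)"
    by (rule Bochner_Integration.integrable_bound
          [where f = "\<lambda>x. 2 * (cmod (f x))\<^sup>2 + 2 * (cmod (g x))\<^sup>2"])
      (use m i b in auto)
  then show ?thesis
    using m by (simp add: square_integrable_def)
qed

lemma square_integrable_scale:
  "f \<in> square_integrable \<mu> \<Longrightarrow> (\<lambda>x. c * f x) \<in> square_integrable \<mu>"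
  by (auto simp: square_integrable_def norm_mult power_mult_distrib)

lemma l2_rep_class:
  assumes "f \<in> square_integrable \<mu>"
  shows "l2_rep (l2_class \<mu> f) \<in> square_integrable \<mu>"
    and "AE x in \<mu>. l2_rep (l2_class \<mu> f) x = f x"
proof -
  have "f \<in> l2_class \<mu> f"
    using assms by (simp add: l2_class_def)
  then have "l2_rep (l2_class \<mu> f) \<in> l2_class \<mu> f"
    unfolding l2_rep_def by (rule someI[of "\<lambda>h. h \<in> l2_class \<mu> f"])
  then show "l2_rep (l2_class \<mu> f) \<in> square_integrable \<mu>"
    and "AE x in \<mu>. l2_rep (l2_class \<mu> f) x = f x"
    by (auto simp: l2_class_def)
qed

lemma l2_class_cong:
  assumes "AE x in \<mu>. f x = g x"
  shows "l2_class \<mu> f = l2_class \<mu> g"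
proof -
  have "(AE x in \<mu>. h x = f x) \<longleftrightarrow> (AE x in \<mu>. h x = g x)" for h
  proof
    assume "AE x in \<mu>. h x = f x"
    then show "AE x in \<mu>. h x = g x" using assms by eventually_elim simp
  next
    assume "AE x in \<mu>. h x = g x"
    then show "AE x in \<mu>. h x = f x" using assms by eventually_elim simp
  qed
  then show ?thesis by (auto simp: l2_class_def)
qed

lemma hadd_L2_class:
  assumes "f \<in> square_integrable \<mu>" "g \<in> square_integrable \<mu>"
  shows "hadd (L2 \<mu>) (l2_class \<mu> f) (l2_class \<mu> g) = l2_class \<mu> (\<lambda>x. f x + g x)"
proof -
  have "AE x in \<mu>. l2_rep (l2_class \<mu> f) x + l2_rep (l2_class \<mu> g) x = f x + g x"
    using l2_rep_class(2)[OF assms(1)] l2_rep_class(2)[OF assms(2)] by eventually_elim simp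
  then show ?thesis
    by (simp add: L2_def l2_class_cong)
qed

lemma hscale_L2_class:
  assumes "f \<in> square_integrable \<mu>"
  shows "hscale (L2 \<mu>) c (l2_class \<mu> f) = l2_class \<mu> (\<lambda>x. c * f x)"
proof -
  have "AE x in \<mu>. c * l2_rep (l2_class \<mu> f) x = c * f x"
    using l2_rep_class(2)[OF assms] by eventually_elim simp
  then show ?thesis
    by (simp add: L2_def l2_class_cong)
qed

lemma hinner_L2_class:
  assumes "f \<in> square_integrable \<mu>" "g \<in> square_integrable \<mu>"
  shows "hinner (L2 \<mu>) (l2_class \<mu> f) (l2_class \<mu> g) = (LINT x|\<mu>. f x * cnj (g x))"
proof -
  have cnj: "(\<lambda>x. cnj (h x)) \<in> borel_measurable \<mu>"
    if "h \<in> borel_measurable \<mu>" for h :: "'a \<Rightarrow> complex"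
    by (rule borel_measurable_continuous_on[OF _ that]) (intro continuous_intros)
  have m: "f \<in> borel_measurable \<mu>" "g \<in> borel_measurable \<mu>"
    "l2_rep (l2_class \<mu> f) \<in> borel_measurable \<mu>" "l2_rep (l2_class \<mu> g) \<in> borel_measurable \<mu>"
    using assms l2_rep_class(1)[OF assms(1)] l2_rep_class(1)[OF assms(2)]
    by (auto simp: square_integrable_def)
  have "AE x in \<mu>. l2_rep (l2_class \<mu> f) x * cnj (l2_rep (l2_class \<mu> g) x) = f x * cnj (g x)"
    using l2_rep_class(2)[OF assms(1)] l2_rep_class(2)[OF assms(2)] by eventually_elim simp
  then show ?thesis
    using integral_cong_AE[OF borel_measurable_times[OF m(3) cnj[OF m(4)]]
        borel_measurable_times[OF m(1) cnj[OF m(2)]]]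
    by (simp add: L2_def)
qed

end

theory Submission
  imports Defs
begin

text \<open>
  Pull \<open>L\<^sup>2(G)\<close> and \<open>L\<^sup>2(H)\<close> back to functions on \<open>R\<close>. Up to the constants \<open>\<alpha>\<close> and \<open>\<beta>\<close> both pullbacks are
  isometric on functions supported by \<open>dom R\<close> and \<open>im R\<close>, and \<open>\<Pi>\<close> is one of them followed by the
  adjoint of the other. If \<open>\<phi>\<close> on \<open>G\<close> and \<open>\<psi>\<close> on \<open>H\<close> have the same pullback, then \<open>\<Pi> \<psi> = \<alpha> \<phi>\<close> and
  \<open>\<Pi>\<^sup>* \<phi> = \<beta> \<psi>\<close>, hence \<open>\<Pi>\<^sup>* \<Pi> \<psi> = \<alpha> \<beta> \<psi>\<close>. Left invariance of \<open>\<rho>\<close> under \<open>ker R\<close> and \<open>indef R\<close>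
  puts the ranges of \<open>\<Pi>\<close> and \<open>\<Pi>\<^sup>*\<close> into the two subspaces, so everything reduces to showing that such
  \<open>\<psi>\<close> span a dense part of \<open>L\<^sup>2(im R)\<close> invariant under \<open>indef R\<close>. Let \<open>f\<close> in this space be orthogonal to
  all of them. Averages of \<open>f\<close> over translates \<open>h + C\<close> of an open set are exactly invariant, and smearing
  such an average once more gives a lower semicontinuous function, which descends to a Borel function
  on \<open>G\<close> because \<open>R\<close> is \<open>\<sigma>\<close>-compact. Testing \<open>f\<close> against it shows that all averages vanish, so \<open>f = 0\<close>.
\<close>

section \<open>Hilbert spaces and adjoint pairs\<close>

text \<open>Functions in the initial space are invariant only almost everywhere, with a null set
  that depends on the translation, so they cannot be carried along \<open>R\<close> point by point.
  One smearing repairs the invariance. The natural test function, the positive part of a difference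
  of two averages, is then invariant but need not be semicontinuous; the second smearing restores
  semicontinuity, and moving it back across the integral turns the test into the integral of a
  square. Pairs with equal pullbacks (\<open>compatible\<close>) take the place of functions on the
  common quotient of dom R by ker R and of im R by indef R. \<open>Pi_op\<close> is a definite
  description, so the operator must be constructed as well. On nonnegative functions its values are
  Radon-Nikodym densities; they are square integrable by Cauchy-Schwarz on \<open>R\<close>, because
  both marginals are dominated by the Haar measures. The identity for Pi* Pi says that Pi multiplies
  norms on the initial space by the square root of alpha beta, whence the normalising
  factor.\<close>

locale inner_space =
  fixes V :: "'v hilbert_data"
  assumes zero_closed [simp]: "hzero V \<in> hcarrier V"
    and add_closed [simp]: "x \<in> hcarrier V \<Longrightarrow> y \<in> hcarrier V \<Longrightarrow> hadd V x y \<in> hcarrier V"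
    and scale_closed [simp]: "x \<in> hcarrier V \<Longrightarrow> hscale V c x \<in> hcarrier V"
    and inner_zero_left: "z \<in> hcarrier V \<Longrightarrow> hinner V (hzero V) z = 0"
    and inner_add_left: "x \<in> hcarrier V \<Longrightarrow> y \<in> hcarrier V \<Longrightarrow> z \<in> hcarrier V \<Longrightarrow>
      hinner V (hadd V x y) z = hinner V x z + hinner V y z"
    and inner_scale_left: "x \<in> hcarrier V \<Longrightarrow> z \<in> hcarrier V \<Longrightarrow>
      hinner V (hscale V c x) z = c * hinner V x z"
    and inner_cnj: "x \<in> hcarrier V \<Longrightarrow> y \<in> hcarrier V \<Longrightarrow> hinner V x y = cnj (hinner V y x)"
    and inner_nonneg: "x \<in> hcarrier V \<Longrightarrow> 0 \<le> Re (hinner V x x)"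
    and inner_eqI: "x \<in> hcarrier V \<Longrightarrow> y \<in> hcarrier V \<Longrightarrow>
      (\<And>z. z \<in> hcarrier V \<Longrightarrow> hinner V z x = hinner V z y) \<Longrightarrow> x = y"
begin

lemma inner_zero_right: "z \<in> hcarrier V \<Longrightarrow> hinner V z (hzero V) = 0"
  using inner_cnj[of z "hzero V"] by (simp add: inner_zero_left)

lemma inner_add_right: "x \<in> hcarrier V \<Longrightarrow> y \<in> hcarrier V \<Longrightarrow> z \<in> hcarrier V \<Longrightarrow>
    hinner V z (hadd V x y) = hinner V z x + hinner V z y"
  using inner_cnj[of z "hadd V x y"] inner_cnj[of z x] inner_cnj[of z y] by (simp add: inner_add_left)

lemma inner_scale_right: "x \<in> hcarrier V \<Longrightarrow> z \<in> hcarrier V \<Longrightarrow>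
    hinner V z (hscale V c x) = cnj c * hinner V z x"
  using inner_cnj[of z "hscale V c x"] inner_cnj[of z x] by (simp add: inner_scale_left)

lemmas inner_simps = inner_zero_left inner_zero_right inner_add_left inner_add_right
  inner_scale_left inner_scale_right

lemma inner_self: "x \<in> hcarrier V \<Longrightarrow> hinner V x x = complex_of_real ((hnorm V x)\<^sup>2)"
  using inner_cnj[of x x] inner_nonneg[of x]
  by (simp add: hnorm_def complex_eq_iff)

lemma hnorm_nonneg: "x \<in> hcarrier V \<Longrightarrow> 0 \<le> hnorm V x"
  by (simp add: hnorm_def inner_nonneg)

lemma diff_closed [simp]: "x \<in> hcarrier V \<Longrightarrow> y \<in> hcarrier V \<Longrightarrow> hdiff V x y \<in> hcarrier V"
  by (simp add: hdiff_def)

lemma inner_diff_right: "x \<in> hcarrier V \<Longrightarrow> y \<in> hcarrier V \<Longrightarrow> z \<in> hcarrier V \<Longrightarrow>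
    hinner V z (hdiff V x y) = hinner V z x - hinner V z y"
  by (simp add: hdiff_def inner_simps)

text \<open>Vector space laws are not among the axioms of \<open>inner_space\<close>. Each one
  follows from \<open>inner_eqI\<close> by pairing both sides with an arbitrary vector.\<close>

lemma scale_scale: "x \<in> hcarrier V \<Longrightarrow> hscale V a (hscale V b x) = hscale V (a * b) x"
  by (rule inner_eqI) (simp_all add: inner_simps)

lemma scale_one: "x \<in> hcarrier V \<Longrightarrow> hscale V 1 x = x"
  by (rule inner_eqI) (simp_all add: inner_simps)

lemma scale_add: "x \<in> hcarrier V \<Longrightarrow> y \<in> hcarrier V \<Longrightarrow>
    hscale V a (hadd V x y) = hadd V (hscale V a x) (hscale V a y)"
  by (rule inner_eqI) (simp_all add: inner_simps algebra_simps)

lemma scale_zero: "hscale V a (hzero V) = hzero V"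
  by (rule inner_eqI) (simp_all add: inner_simps)

lemma scale_cancel:
  assumes "x \<in> hcarrier V" "y \<in> hcarrier V" "a \<noteq> 0" "hscale V a x = hscale V a y"
  shows "x = y"
proof -
  have "hscale V (1 / a) (hscale V a x) = hscale V (1 / a) (hscale V a y)"
    using assms(4) by simp
  then show ?thesis
    using assms(1-3) by (simp add: scale_scale scale_one)
qed

lemma Cauchy_Schwarz:
  assumes x: "x \<in> hcarrier V" and y: "y \<in> hcarrier V"
  shows "cmod (hinner V x y) \<le> hnorm V x * hnorm V y"
proof -
  define a d b where "a = (hnorm V x)\<^sup>2" and "d = (hnorm V y)\<^sup>2" and "b = hinner V x y"
  \<comment> \<open>The squared norm of \<open>x + c y\<close> for \<open>c = - t b\<close>: the
    factor \<open>b\<close> makes the cross terms real, so a real parameter \<open>t\<close> is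
    enough.\<close>
  have quad: "0 \<le> a - 2 * t * (cmod b)\<^sup>2 + t\<^sup>2 * (cmod b)\<^sup>2 * d" for t :: real
  proof -
    define c where "c = - complex_of_real t * b"
    have yx: "hinner V y x = cnj b"
      using inner_cnj[OF y x] by (simp add: b_def)
    have xx: "hinner V x x = complex_of_real a" and yy: "hinner V y y = complex_of_real d"
      and xy: "hinner V x y = b"
      using x y by (simp_all add: inner_self a_def d_def b_def)
    have "hinner V (hadd V x (hscale V c y)) (hadd V x (hscale V c y))
        = complex_of_real a + (cnj c * b + c * cnj b) + c * cnj c * complex_of_real d"
      using x y by (simp add: inner_simps xx yy xy yx algebra_simps)
    also have "\<dots> = complex_of_real (a - 2 * t * (cmod b)\<^sup>2 + t\<^sup>2 * (cmod b)\<^sup>2 * d)"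
    proof -
      have "b * cnj b = complex_of_real ((cmod b)\<^sup>2)"
        using complex_norm_square[of b] by simp
      moreover have "cnj c * b + c * cnj b = - 2 * complex_of_real t * (b * cnj b)"
        and "c * cnj c = (complex_of_real t)\<^sup>2 * (b * cnj b)"
        by (simp_all add: c_def power2_eq_square algebra_simps)
      ultimately show ?thesis by simp
    qed
    finally show ?thesis
      using inner_nonneg[of "hadd V x (hscale V c y)"] x y by simp
  qed
  have "(cmod b)\<^sup>2 \<le> a * d"
  proof (cases "d = 0")
    case True
    have "(cmod b)\<^sup>2 = 0"
    proof (rule ccontr)
      assume "(cmod b)\<^sup>2 \<noteq> 0"
      then have "0 < (cmod b)\<^sup>2" by simp
      \<comment> \<open>For \<open>d = 0\<close> the quadratic is affine in \<open>t\<close>, and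
        this \<open>t\<close> gives it the value -1.\<close>
      then show False
        using quad[of "(a + 1) / (2 * (cmod b)\<^sup>2)"] True by (simp add: field_simps)
    qed
    then show ?thesis by (simp add: True)
  next
    case False
    then have "0 < d" by (simp add: d_def)
    \<comment> \<open>\<open>t = 1 / d\<close> minimises the quadratic.\<close>
    then show ?thesis
      using quad[of "1 / d"] by (simp add: field_simps power2_eq_square)
  qed
  then have "(cmod b)\<^sup>2 \<le> (hnorm V x * hnorm V y)\<^sup>2"
    by (simp add: a_def d_def power_mult_distrib)
  then show ?thesis
    unfolding b_def by (rule power2_le_imp_le) (use hnorm_nonneg x y in simp)
qed

lemma inner_tendsto:
  assumes "\<And>n. s n \<in> hcarrier V" "x \<in> hcarrier V" "z \<in> hcarrier V"
    and "(\<lambda>n. hnorm V (hdiff V (s n) x)) \<longlonglongrightarrow> 0"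
  shows "(\<lambda>n. hinner V z (s n)) \<longlonglongrightarrow> hinner V z x"
proof -
  have "(\<lambda>n. hnorm V z * hnorm V (hdiff V (s n) x)) \<longlonglongrightarrow> 0"
    using tendsto_mult_right_zero[OF assms(4)] by simp
  then have "(\<lambda>n. hinner V z (s n) - hinner V z x) \<longlonglongrightarrow> 0"
    by (rule Lim_null_comparison[rotated])
      (use assms(1-3) Cauchy_Schwarz in \<open>auto simp: inner_diff_right[symmetric]\<close>)
  then show ?thesis
    by (simp add: LIM_zero_iff)
qed

end

locale adjoint_pair = V: inner_space V + W: inner_space W
  for V :: "'v hilbert_data" and W :: "'w hilbert_data" +
  fixes T :: "'v \<Rightarrow> 'w" and T' :: "'w \<Rightarrow> 'v"
  assumes T_closed [simp]: "x \<in> hcarrier V \<Longrightarrow> T x \<in> hcarrier W"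
    and T'_closed [simp]: "w \<in> hcarrier W \<Longrightarrow> T' w \<in> hcarrier V"
    and adjoint: "x \<in> hcarrier V \<Longrightarrow> w \<in> hcarrier W \<Longrightarrow> hinner W w (T x) = hinner V (T' w) x"
begin

lemma adjoint': "x \<in> hcarrier V \<Longrightarrow> w \<in> hcarrier W \<Longrightarrow> hinner V x (T' w) = hinner W (T x) w"
  using V.inner_cnj[of x "T' w"] W.inner_cnj[of "T x" w] adjoint[of x w] by simp

text \<open>Having an adjoint forces linearity: paired with a test vector \<open>w\<close>, both
  sides become pairings with \<open>T' w\<close>.\<close>

lemma T_add: "x \<in> hcarrier V \<Longrightarrow> y \<in> hcarrier V \<Longrightarrow> T (hadd V x y) = hadd W (T x) (T y)"
  by (rule W.inner_eqI) (simp_all add: adjoint V.inner_simps W.inner_simps)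

lemma T_scale: "x \<in> hcarrier V \<Longrightarrow> T (hscale V c x) = hscale W c (T x)"
  by (rule W.inner_eqI) (simp_all add: adjoint V.inner_simps W.inner_simps)

lemma T_zero: "T (hzero V) = hzero W"
  by (rule W.inner_eqI) (simp_all add: adjoint V.inner_simps W.inner_simps)

lemma swap: "adjoint_pair W V T' T"
  by unfold_locales (simp_all add: adjoint')

end

text \<open>\<open>T\<close> divided by the square root of \<open>k\<close> is going to be the
  partial isometry; the axioms express this by identities that are symmetric in \<open>T\<close> and
  \<open>T'\<close>, so every fact about \<open>L\<close> has a mirror image for \<open>M\<close>.
  In the application \<open>k\<close> is alpha times beta.\<close>

locale scaled_partial_isometry = adjoint_pair V W T T'
  for V :: "'v hilbert_data" and W :: "'w hilbert_data" and T T' +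
  fixes L M k
  assumes L_sub: "L \<subseteq> hcarrier V" and M_sub: "M \<subseteq> hcarrier W"
    and T_M: "x \<in> hcarrier V \<Longrightarrow> T x \<in> M" and T'_L: "w \<in> hcarrier W \<Longrightarrow> T' w \<in> L"
    and k_pos: "0 < k"
    and T'_T: "x \<in> L \<Longrightarrow> T' (T x) = hscale V (complex_of_real k) x"
    and T_T': "w \<in> M \<Longrightarrow> T (T' w) = hscale W (complex_of_real k) w"
begin

lemma swap_scaled: "scaled_partial_isometry W V T' T M L k"
  by (intro scaled_partial_isometry.intro swap scaled_partial_isometry_axioms.intro)
    (use L_sub M_sub T_M T'_L k_pos T'_T T_T' in auto)

text \<open>\<open>L\<close> is the eigenspace of \<open>T' T\<close> for \<open>k\<close>: such an
  \<open>x\<close> equals \<open>T' (T x / k)\<close>, and the range of \<open>T'\<close> lies in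
  \<open>L\<close>. The subspace properties of \<open>L\<close> thereby reduce to linearity and
  continuity.\<close>

lemma L_iff: "x \<in> L \<longleftrightarrow> x \<in> hcarrier V \<and> T' (T x) = hscale V (complex_of_real k) x"
proof
  assume R: "x \<in> hcarrier V \<and> T' (T x) = hscale V (complex_of_real k) x"
  have "T' (hscale W (1 / complex_of_real k) (T x)) = hscale V (1 / complex_of_real k) (T' (T x))"
    using adjoint_pair.T_scale[OF swap] R by simp
  also have "\<dots> = x"
    using R k_pos by (simp add: V.scale_scale V.scale_one)
  finally show "x \<in> L"
    using T'_L[of "hscale W (1 / complex_of_real k) (T x)"] R by simp
qed (use L_sub T'_T in auto)

lemma closed_subspace_L: "closed_subspace V L"
  unfolding closed_subspace_def
proof (intro conjI ballI allI impI)
  show "L \<subseteq> hcarrier V" by (rule L_sub)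
  note T'_lin = adjoint_pair.T_add[OF swap] adjoint_pair.T_scale[OF swap] adjoint_pair.T_zero[OF swap]
  show "hzero V \<in> L"
    by (simp add: L_iff T_zero T'_lin V.scale_zero)
  show "hadd V x y \<in> L" if "x \<in> L" "y \<in> L" for x y
    using that by (auto simp: L_iff T_add T'_lin V.scale_add)
  show "hscale V c x \<in> L" if "x \<in> L" for c x
    using that by (auto simp: L_iff T_scale T'_lin V.scale_scale mult.commute)
  fix s x
  assume "(\<forall>n. s n \<in> L) \<and> x \<in> hcarrier V \<and> (\<lambda>n. hnorm V (hdiff V (s n) x)) \<longlonglongrightarrow> 0"
  then have s: "\<And>n. s n \<in> L" and x: "x \<in> hcarrier V"
    and lim: "(\<lambda>n. hnorm V (hdiff V (s n) x)) \<longlonglongrightarrow> 0"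
    by auto
  have sV: "s n \<in> hcarrier V" for n
    using s L_sub by blast
  \<comment> \<open>\<open>T' T\<close> is moved onto the fixed vector \<open>z\<close>, so that
    continuity of the pairing suffices.\<close>
  have "hinner V z (T' (T x)) = hinner V z (hscale V (complex_of_real k) x)" if z: "z \<in> hcarrier V" for z
  proof -
    have "(\<lambda>n. hinner V (T' (T z)) (s n)) \<longlonglongrightarrow> hinner V (T' (T z)) x"
      using V.inner_tendsto[OF sV x _ lim] z by simp
    moreover have "hinner V (T' (T z)) (s n) = hinner V (hscale V (complex_of_real k) z) (s n)" for n
    proof -
      have "hinner V (T' (T z)) (s n) = hinner V z (T' (T (s n)))"
        using z sV by (simp add: adjoint' adjoint)
      then show ?thesis
        using s z sV by (simp add: T'_T V.inner_simps)
    qed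
    moreover have "(\<lambda>n. hinner V (hscale V (complex_of_real k) z) (s n))
        \<longlonglongrightarrow> hinner V (hscale V (complex_of_real k) z) x"
      using V.inner_tendsto[OF sV x _ lim] z by simp
    ultimately have "hinner V (T' (T z)) x = hinner V (hscale V (complex_of_real k) z) x"
      using LIMSEQ_unique by simp
    then show ?thesis
      using z x by (simp add: adjoint' adjoint V.inner_simps)
  qed
  then have "T' (T x) = hscale V (complex_of_real k) x"
    using x by (intro V.inner_eqI) auto
  then show "x \<in> L"
    using x by (simp add: L_iff)
qed

lemma inner_T: "x \<in> L \<Longrightarrow> y \<in> hcarrier V \<Longrightarrow> hinner W (T x) (T y) = complex_of_real k * hinner V x y"
  using L_sub by (auto simp: adjoint T'_T V.inner_simps)

text \<open>The vector \<open>y = T' (T x)\<close> lies in \<open>L\<close> even if \<open>x\<close>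
  does not. By \<open>inner_T\<close>, \<open>|y|^2 = k <y, x>\<close>, hence
  \<open>|y| <= k |x|\<close>, and then \<open>|T x|^2 = <y, x> <= k |x|^2\<close>.\<close>

lemma T_bound:
  assumes x: "x \<in> hcarrier V"
  shows "hnorm W (T x) \<le> sqrt k * hnorm V x"
proof -
  define y where "y = T' (T x)"
  have y: "y \<in> L" "y \<in> hcarrier V"
    using x T'_L by (auto simp: y_def)
  have nx: "0 \<le> hnorm V x" and ny: "0 \<le> hnorm V y"
    using x y V.hnorm_nonneg by auto
  have "complex_of_real ((hnorm V y)\<^sup>2) = hinner V y y"
    using y by (simp add: V.inner_self)
  also have "\<dots> = hinner W (T y) (T x)"
    using x y by (simp add: y_def adjoint')
  also have "\<dots> = complex_of_real k * hinner V y x"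
    using x y by (simp add: inner_T)
  finally have "(hnorm V y)\<^sup>2 = cmod (complex_of_real k * hinner V y x)"
    by (metis norm_of_real abs_of_nonneg zero_le_power2)
  also have "\<dots> \<le> k * (hnorm V y * hnorm V x)"
    using V.Cauchy_Schwarz[OF y(2) x] k_pos by (simp add: norm_mult)
  finally have "hnorm V y \<le> k * hnorm V x"
    using ny nx k_pos by (cases "hnorm V y = 0") (auto simp: power2_eq_square)
  have "complex_of_real ((hnorm W (T x))\<^sup>2) = hinner V y x"
    using x adjoint[of x "T x"] W.inner_self[of "T x"] by (simp add: y_def)
  then have "(hnorm W (T x))\<^sup>2 = cmod (hinner V y x)"
    by (metis norm_of_real abs_of_nonneg zero_le_power2)
  also have "\<dots> \<le> hnorm V y * hnorm V x"
    by (rule V.Cauchy_Schwarz[OF y(2) x])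
  also have "\<dots> \<le> k * hnorm V x * hnorm V x"
    using \<open>hnorm V y \<le> k * hnorm V x\<close> nx by (rule mult_right_mono)
  also have "\<dots> = (sqrt k * hnorm V x)\<^sup>2"
    using k_pos by (simp add: power_mult_distrib power2_eq_square)
  finally show ?thesis
    by (rule power2_le_imp_le) (use k_pos nx in simp)
qed

lemma bounded_operator_T:
  assumes "T \<in> extensional (hcarrier V)"
  shows "bounded_operator V W T"
  unfolding bounded_operator_def using assms T_bound by (auto simp: T_add T_scale PiE_def)

lemma partial_isometry_scaled:
  "partial_isometry V W L M (scale_operator V W (complex_of_real (k powr (-1/2))) T)"
proof -
  define c where "c = k powr (-1/2)"
  define S where "S = scale_operator V W (complex_of_real c) T"
  have c: "0 < c" and ck: "c * c * k = 1"
    using k_pos by (simp_all add: c_def powr_add[symmetric] powr_minus_divide)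
  have S: "S x = hscale W (complex_of_real c) (T x)" if "x \<in> hcarrier V" for x
    using that by (simp add: S_def scale_operator_def)
  interpret M: scaled_partial_isometry W V T' T M L k by (rule swap_scaled)
  have "hnorm W (S x) \<le> (c * sqrt k) * hnorm V x" if x: "x \<in> hcarrier V" for x
  proof -
    have "hnorm W (S x) = c * hnorm W (T x)"
      using c x by (simp add: S hnorm_def W.inner_simps real_sqrt_mult)
    then show ?thesis
      using T_bound[OF x] c by simp
  qed
  then have "bounded_operator V W S"
    unfolding bounded_operator_def
    by (intro conjI exI[of _ "c * sqrt k"])
      (auto simp: S T_add T_scale W.scale_scale W.scale_add mult.commute
        simp: S_def scale_operator_def)
  moreover have "bij_betw S L M"
    unfolding bij_betw_def
  proof
    show "inj_on S L"
    proof (rule inj_onI)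
      fix x y assume xy: "x \<in> L" "y \<in> L" "S x = S y"
      then have V: "x \<in> hcarrier V" "y \<in> hcarrier V"
        using L_sub by auto
      then have "T x = T y"
        using xy c W.scale_cancel[of "T x" "T y" "complex_of_real c"] by (simp add: S)
      then have "hscale V (complex_of_real k) x = hscale V (complex_of_real k) y"
        using xy T'_T by metis
      then show "x = y"
        using V.scale_cancel[of x y "complex_of_real k"] V k_pos by simp
    qed
    have "S x \<in> M" if "x \<in> L" for x
    proof -
      have x: "x \<in> hcarrier V" using that L_sub by blast
      then have "T (hscale V (complex_of_real c) x) \<in> M"
        by (intro T_M) simp
      then show ?thesis using x by (simp add: S T_scale)
    qed
    moreover have "y \<in> S ` L" if y: "y \<in> M" for y
    proof (rule image_eqI)
      have yW: "y \<in> hcarrier W" using y M_sub by blast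
      have "T' (hscale W (complex_of_real c) y) \<in> L"
        using yW by (intro T'_L) simp
      then show "hscale V (complex_of_real c) (T' y) \<in> L"
        using yW by (simp add: M.T_scale)
      \<comment> \<open>The preimage of \<open>y\<close> is \<open>c T' y\<close>: one factor
        \<open>c\<close> comes from \<open>S\<close>, one from the preimage, and \<open>k\<close>
        from \<open>T T'\<close>.\<close>
      have "S (hscale V (complex_of_real c) (T' y)) = hscale W (complex_of_real (c * c * k)) y"
        using yW y by (simp add: S T_scale T_T' W.scale_scale mult.assoc)
      then show "y = S (hscale V (complex_of_real c) (T' y))"
        using ck yW by (simp add: W.scale_one)
    qed
    ultimately show "S ` L = M" by blast
  qed
  moreover have "hinner W (S x) (S y) = hinner V x y" if "x \<in> L" "y \<in> L" for x y
  proof -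
    have xy: "x \<in> hcarrier V" "y \<in> hcarrier V" using that L_sub by auto
    then have "hinner W (S x) (S y) = complex_of_real (c * c * k) * hinner V x y"
      using that by (simp add: S W.inner_simps inner_T)
    then show ?thesis using ck by simp
  qed
  moreover have "S x = hzero W" if "x \<in> ortho_complement V L" for x
  proof -
    have x: "x \<in> hcarrier V" and orth: "\<And>y. y \<in> L \<Longrightarrow> hinner V x y = 0"
      using that by (auto simp: ortho_complement_def)
    \<comment> \<open>The range of \<open>T'\<close> lies in \<open>L\<close>, so \<open>T x\<close>
      pairs to zero with every \<open>w\<close>.\<close>
    have "T x = hzero W"
    proof (rule W.inner_eqI)
      fix w assume w: "w \<in> hcarrier W"
      have "hinner V (T' w) x = cnj (hinner V x (T' w))"
        using w x by (intro V.inner_cnj) auto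
      then show "hinner W w (T x) = hinner W w (hzero W)"
        using w x orth[OF T'_L[OF w]] by (simp add: adjoint W.inner_simps)
    qed (use x in auto)
    then show ?thesis using x by (simp add: S W.scale_zero)
  qed
  ultimately show ?thesis
    unfolding partial_isometry_def unitary_on_def S_def[symmetric] c_def[symmetric]
    using closed_subspace_L M.closed_subspace_L by auto
qed

end

lemma (in inner_space) bounded_operator_eqI:
  assumes "bounded_operator U V S" "bounded_operator U V T"
    and "\<And>x z. x \<in> hcarrier U \<Longrightarrow> z \<in> hcarrier V \<Longrightarrow> hinner V z (S x) = hinner V z (T x)"
  shows "S = T"
proof (rule extensionalityI)
  show "S \<in> extensional (hcarrier U)" "T \<in> extensional (hcarrier U)"
    using assms by (auto simp: bounded_operator_def PiE_def)
  fix x assume "x \<in> hcarrier U"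
  then show "S x = T x"
    using assms by (intro inner_eqI) (auto simp: bounded_operator_def)
qed

section \<open>Square integrable functions modulo null sets as an inner product space\<close>

lemma square_integrable_measurable: "f \<in> square_integrable \<mu> \<Longrightarrow> f \<in> borel_measurable \<mu>"
  by (simp add: square_integrable_def)

lemma borel_measurable_cnj [measurable (raw)]:
  "f \<in> borel_measurable M \<Longrightarrow> (\<lambda>x. cnj (f x)) \<in> borel_measurable M"
  by (rule borel_measurable_continuous_on) (intro continuous_intros)

lemma square_integrable_iff:
  assumes [measurable]: "f \<in> borel_measurable \<mu>"
  shows "f \<in> square_integrable \<mu> \<longleftrightarrow> (\<integral>\<^sup>+x. ennreal ((cmod (f x))\<^sup>2) \<partial>\<mu>) < \<infinity>"
  by (simp add: square_integrable_def integrable_iff_bounded assms)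

lemma square_integrable_mult:
  assumes "f \<in> square_integrable \<mu>" "g \<in> square_integrable \<mu>"
  shows "integrable \<mu> (\<lambda>x. f x * g x)"
proof (rule Bochner_Integration.integrable_bound)
  have [measurable]: "f \<in> borel_measurable \<mu>" "g \<in> borel_measurable \<mu>"
    using assms by (auto simp: square_integrable_def)
  show "(\<lambda>x. f x * g x) \<in> borel_measurable \<mu>" by measurable
  show "integrable \<mu> (\<lambda>x. (cmod (f x))\<^sup>2 + (cmod (g x))\<^sup>2)"
    using assms by (auto simp: square_integrable_def)
  have "cmod (f x) * cmod (g x) \<le> (cmod (f x))\<^sup>2 + (cmod (g x))\<^sup>2" for x
    using sum_squares_bound[of "cmod (f x)" "cmod (g x)"]
      mult_nonneg_nonneg[OF norm_ge_zero[of "f x"] norm_ge_zero[of "g x"]]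
    by linarith
  then show "AE x in \<mu>. norm (f x * g x) \<le> norm ((cmod (f x))\<^sup>2 + (cmod (g x))\<^sup>2)"
    by (simp add: norm_mult)
qed

lemma square_integrable_cnj: "f \<in> square_integrable \<mu> \<Longrightarrow> (\<lambda>x. cnj (f x)) \<in> square_integrable \<mu>"
  by (auto simp: square_integrable_def borel_measurable_cnj)

lemma square_integrable_diff:
  assumes "f \<in> square_integrable \<mu>" "g \<in> square_integrable \<mu>"
  shows "(\<lambda>x. f x - g x) \<in> square_integrable \<mu>"
  using square_integrable_add[OF assms(1) square_integrable_scale[OF assms(2), of "-1"]] by simp

lemma square_integrable_AE_eq:
  assumes f: "f \<in> square_integrable \<mu>" and g: "g \<in> square_integrable \<mu>"
    and eq: "\<And>\<phi>. \<phi> \<in> square_integrable \<mu> \<Longrightarrow> (LINT x|\<mu>. \<phi> x * cnj (f x)) = (LINT x|\<mu>. \<phi> x * cnj (g x))"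
  shows "AE x in \<mu>. f x = g x"
proof -
  define h where "h = (\<lambda>x. f x - g x)"
  have h: "h \<in> square_integrable \<mu>"
    unfolding h_def by (intro square_integrable_diff f g)
  have i: "integrable \<mu> (\<lambda>x. (cmod (h x))\<^sup>2)"
    using h by (simp add: square_integrable_def)
  \<comment> \<open>The test function is the difference \<open>h\<close> itself.\<close>
  have "(LINT x|\<mu>. h x * cnj (h x)) = (LINT x|\<mu>. h x * cnj (f x) - h x * cnj (g x))"
    by (simp add: h_def algebra_simps)
  also have "\<dots> = 0"
    using eq[OF h] square_integrable_mult[OF h square_integrable_cnj] f g
    by (subst Bochner_Integration.integral_diff) auto
  finally have "complex_of_real (LINT x|\<mu>. (cmod (h x))\<^sup>2) = 0"
    by (simp add: complex_norm_square[symmetric] flip: integral_complex_of_real)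
  then have "AE x in \<mu>. (cmod (h x))\<^sup>2 = 0"
    using integral_nonneg_eq_0_iff_AE[OF i] by simp
  then show ?thesis
    by eventually_elim (simp add: h_def)
qed

lemma zero_square_integrable: "(\<lambda>x. 0) \<in> square_integrable \<mu>"
  by (simp add: square_integrable_def)

lemma hcarrier_L2: "hcarrier (L2 \<mu>) = l2_class \<mu> ` square_integrable \<mu>"
  by (simp add: L2_def)

lemma inner_space_L2: "inner_space (L2 \<mu>)"
proof
  show "hzero (L2 \<mu>) \<in> hcarrier (L2 \<mu>)"
    using zero_square_integrable by (auto simp: L2_def)
  fix x y z and c assume "x \<in> hcarrier (L2 \<mu>)"
  then obtain f where f: "f \<in> square_integrable \<mu>" "x = l2_class \<mu> f"
    by (auto simp: hcarrier_L2)
  then show "hscale (L2 \<mu>) c x \<in> hcarrier (L2 \<mu>)"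
    by (auto simp: hscale_L2_class hcarrier_L2 square_integrable_scale)
  show "hinner (L2 \<mu>) (hzero (L2 \<mu>)) x = 0"
    using f hinner_L2_class[OF zero_square_integrable f(1)] by (simp add: L2_def)
  show "0 \<le> Re (hinner (L2 \<mu>) x x)"
    using f by (simp add: hinner_L2_class complex_norm_square[symmetric] del: of_real_power)
  assume "y \<in> hcarrier (L2 \<mu>)"
  then obtain g where g: "g \<in> square_integrable \<mu>" "y = l2_class \<mu> g"
    by (auto simp: hcarrier_L2)
  show "hadd (L2 \<mu>) x y \<in> hcarrier (L2 \<mu>)"
    using f g by (auto simp: hadd_L2_class hcarrier_L2 square_integrable_add)
  have "(LINT x|\<mu>. cnj (g x * cnj (f x))) = cnj (LINT x|\<mu>. g x * cnj (f x))"
    by (rule Bochner_Integration.integral_cnj)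
  then show "hinner (L2 \<mu>) x y = cnj (hinner (L2 \<mu>) y x)"
    using f g by (simp add: hinner_L2_class mult.commute)
  show "hinner (L2 \<mu>) (hscale (L2 \<mu>) c x) y = c * hinner (L2 \<mu>) x y"
    using f g by (simp add: hscale_L2_class hinner_L2_class square_integrable_scale mult.assoc)
  show "x = y" if eq: "\<And>z. z \<in> hcarrier (L2 \<mu>) \<Longrightarrow> hinner (L2 \<mu>) z x = hinner (L2 \<mu>) z y"
  proof -
    have "AE x in \<mu>. f x = g x"
    proof (rule square_integrable_AE_eq[OF f(1) g(1)])
      fix \<phi> assume "\<phi> \<in> square_integrable \<mu>"
      then show "(LINT x|\<mu>. \<phi> x * cnj (f x)) = (LINT x|\<mu>. \<phi> x * cnj (g x))"
        using eq[of "l2_class \<mu> \<phi>"] f g by (simp add: hinner_L2_class hcarrier_L2)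
    qed
    then show ?thesis using f g by (simp add: l2_class_cong)
  qed
  assume "z \<in> hcarrier (L2 \<mu>)"
  then obtain h where h: "h \<in> square_integrable \<mu>" "z = l2_class \<mu> h"
    by (auto simp: hcarrier_L2)
  show "hinner (L2 \<mu>) (hadd (L2 \<mu>) x y) z = hinner (L2 \<mu>) x z + hinner (L2 \<mu>) y z"
    using f g h by (simp add: hadd_L2_class hinner_L2_class square_integrable_add distrib_right
        square_integrable_mult square_integrable_cnj)
qed

section \<open>Haar measures on locally compact groups\<close>

lemma lc_compact_nhd:
  assumes "locally compact (UNIV :: 'a::topological_space set)"
    and "open (W :: 'a::topological_space set)" "x \<in> W"
  shows "\<exists>u v. open u \<and> compact v \<and> x \<in> u \<and> u \<subseteq> v \<and> v \<subseteq> W"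
proof -
  have "openin (top_of_set UNIV) W"
    using assms(2) by simp
  then show ?thesis
    using assms(1,3) unfolding locally_def by (simp add: Ball_def)
qed

text \<open>A countable basis that is closed under intersections is a generating pi-system, and
  relative compactness gives its members finite Haar measure; two measures can then be compared on
  \<open>B\<close> alone.\<close>

lemma lc_countable_basis:
  assumes "locally compact (UNIV :: 'a::{t2_space, second_countable_topology} set)"
  obtains B :: "'a::{t2_space, second_countable_topology} set set" where "countable B" "topological_basis B" "Int_stable B"
    "\<And>U. U \<in> B \<Longrightarrow> \<exists>K. compact K \<and> U \<subseteq> K"
proof -
  obtain B0 :: "'a set set" where B0: "countable B0" "topological_basis B0"
    using ex_countable_basis by blast
  define B1 where "B1 = Inter ` {F. finite F \<and> F \<subseteq> B0}"
  have "countable B1"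
    unfolding B1_def using countable_Collect_finite_subset[OF B0(1)] by blast
  define B where "B = {U \<in> B1. \<exists>K. compact K \<and> U \<subseteq> K}"
  have opB1: "open U" if "U \<in> B1" for U
    using that topological_basis_open[OF B0(2)] by (auto simp: B1_def intro!: open_Inter)
  have "Int_stable B"
    unfolding Int_stable_def
  proof safe
    fix U V assume "U \<in> B" "V \<in> B"
    then obtain F F' K where "U = \<Inter>F" "V = \<Inter>F'" "finite F" "finite F'" "F \<subseteq> B0" "F' \<subseteq> B0"
      "compact K" "U \<subseteq> K"
      by (auto simp: B_def B1_def)
    then have "U \<inter> V = \<Inter>(F \<union> F')" "finite (F \<union> F')" "F \<union> F' \<subseteq> B0" "U \<inter> V \<subseteq> K"
      by auto
    then show "U \<inter> V \<in> B"
      using \<open>compact K\<close> unfolding B_def B1_def by blast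
  qed
  moreover have "topological_basis B"
  proof (rule topological_basisI)
    show "open U" if "U \<in> B" for U
      using that opB1 by (auto simp: B_def)
    fix O' and x :: 'a assume O': "open O'" "x \<in> O'"
    obtain u v where uv: "open u" "compact v" "x \<in> u" "u \<subseteq> v" "v \<subseteq> O'"
      using lc_compact_nhd[OF assms O'] by blast
    then obtain U where U: "U \<in> B0" "x \<in> U" "U \<subseteq> u"
      using topological_basisE[OF B0(2) uv(1,3)] by blast
    have "U \<in> B1"
      unfolding B1_def using U by (intro image_eqI[of _ _ "{U}"]) auto
    then show "\<exists>B'\<in>B. x \<in> B' \<and> B' \<subseteq> O'"
      using U uv by (intro bexI[of _ U]) (auto simp: B_def)
  qed
  moreover have "B \<subseteq> B1" "\<And>U. U \<in> B \<Longrightarrow> \<exists>K. compact K \<and> U \<subseteq> K"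
    by (auto simp: B_def)
  moreover from \<open>B \<subseteq> B1\<close> have "countable B"
    using \<open>countable B1\<close> by (rule countable_subset)
  ultimately show ?thesis
    by (intro that[of B])
qed

lemma lc_open_sigma_compact:
  assumes "locally compact (UNIV :: 'a::{t2_space, second_countable_topology} set)"
    and "open (U :: 'a::{t2_space, second_countable_topology} set)"
  obtains \<K> where "countable \<K>" "\<And>K. K \<in> \<K> \<Longrightarrow> compact K" "\<Union>\<K> = U"
proof -
  obtain B :: "'a set set" where B: "countable B" "topological_basis B"
    using ex_countable_basis by blast
  define B' where "B' = {V \<in> B. \<exists>K. compact K \<and> V \<subseteq> K \<and> K \<subseteq> U}"
  have "\<forall>V\<in>B'. \<exists>K. compact K \<and> V \<subseteq> K \<and> K \<subseteq> U"
    by (auto simp: B'_def)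
  then obtain K where K: "\<And>V. V \<in> B' \<Longrightarrow> compact (K V) \<and> V \<subseteq> K V \<and> K V \<subseteq> U"
    by metis
  have "\<exists>V\<in>B'. x \<in> V" if x: "x \<in> U" for x
  proof -
    obtain u v where uv: "open u" "compact v" "x \<in> u" "u \<subseteq> v" "v \<subseteq> U"
      using lc_compact_nhd[OF assms x] by blast
    then obtain V where V: "V \<in> B" "x \<in> V" "V \<subseteq> u"
      using topological_basisE[OF B(2) uv(1,3)] by blast
    then show ?thesis
      using uv by (intro bexI[of _ V]) (auto simp: B'_def)
  qed
  then have "U \<subseteq> \<Union>(K ` B')"
    using K by fastforce
  moreover have "\<Union>(K ` B') \<subseteq> U"
    using K by (intro UN_least) simp
  moreover have "countable (K ` B')"
    using B(1) by (auto simp: B'_def)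
  ultimately show ?thesis
    using K that[of "K ` B'"] by auto
qed

text \<open>Projections of Borel sets need not be Borel. Here \<open>UNIV\<close> and
  \<open>N\<close> are countable unions of compact sets, and the projection of each compact piece of
  \<open>R\<close> is compact.\<close>

lemma fst_image_borel:
  fixes R :: "('a::{t2_space, second_countable_topology} \<times> 'b::{t2_space, second_countable_topology}) set"
  assumes "locally compact (UNIV :: 'a set)" "locally compact (UNIV :: 'b set)"
    and "closed R" "open N"
  shows "fst ` (R \<inter> UNIV \<times> N) \<in> sets borel"
proof -
  obtain \<K> where \<K>: "countable \<K>" "\<And>K. K \<in> \<K> \<Longrightarrow> compact K" "\<Union>\<K> = (UNIV :: 'a set)"
    using lc_open_sigma_compact[OF assms(1) open_UNIV] by blast
  obtain \<L> where \<L>: "countable \<L>" "\<And>K. K \<in> \<L> \<Longrightarrow> compact K" "\<Union>\<L> = N"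
    using lc_open_sigma_compact[OF assms(2,4)] by blast
  have "fst ` (R \<inter> UNIV \<times> N) = (\<Union>K\<in>\<K>. \<Union>L\<in>\<L>. fst ` (R \<inter> K \<times> L))"
  proof -
    have "R \<inter> UNIV \<times> N = (\<Union>K\<in>\<K>. \<Union>L\<in>\<L>. R \<inter> K \<times> L)"
      unfolding \<K>(3)[symmetric] \<L>(3)[symmetric] by blast
    then show ?thesis by (simp only: image_UN)
  qed
  also have "\<dots> \<in> sets borel"
  proof (intro sets.countable_UN'' \<K> \<L>)
    fix K L assume "K \<in> \<K>" "L \<in> \<L>"
    then have "compact (fst ` (R \<inter> K \<times> L))"
      using \<K>(2) \<L>(2) \<open>closed R\<close>
      by (intro compact_continuous_image continuous_intros closed_Int_compact compact_Times) auto
    then show "fst ` (R \<inter> K \<times> L) \<in> sets borel"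
      by (simp add: compact_imp_closed)
  qed
  finally show ?thesis .
qed

lemma borel_measurable_uminus_group [measurable (raw)]:
  fixes f :: "'a \<Rightarrow> 'b::{second_countable_topology, topological_group_add}"
  assumes "f \<in> borel_measurable M"
  shows "(\<lambda>x. - f x) \<in> borel_measurable M"
  by (rule borel_measurable_continuous_on[OF _ assms]) (intro continuous_intros)

locale unimodular_haar =
  fixes \<mu> :: "'a::{topological_group_add, t2_space, second_countable_topology} measure"
  assumes haar: "unimodular_lc_group \<mu>"
begin

lemma lc: "locally compact (UNIV :: 'a set)"
  using haar by (simp add: unimodular_lc_group_def)

lemma sets_eq [simp, measurable_cong]: "sets \<mu> = sets borel"
  using haar by (simp add: unimodular_lc_group_def haar_measure_on_def sets_restrict_space)

lemma space_eq [simp]: "space \<mu> = UNIV"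
  using haar by (simp add: unimodular_lc_group_def haar_measure_on_def)

lemma compact_finite: "compact K \<Longrightarrow> emeasure \<mu> K < \<infinity>"
  using haar by (simp add: unimodular_lc_group_def haar_measure_on_def)

lemma rel_compact_finite:
  assumes "compact K" "C \<subseteq> K"
  shows "emeasure \<mu> C < \<infinity>"
  using emeasure_mono[OF assms(2), of \<mu>] compact_finite[OF assms(1)] assms(1)
  by (auto simp: compact_imp_closed intro: order.strict_trans1)

lemma distr_left: "distr \<mu> borel (\<lambda>y. x + y) = \<mu>"
proof (rule measure_eqI)
  fix A assume "A \<in> sets (distr \<mu> borel (\<lambda>y. x + y))"
  then have A: "A \<in> sets borel" by simp
  have "(\<lambda>y. x + y) -` A = (\<lambda>y. - x + y) ` A"
    by (auto intro: rev_image_eqI simp: add.assoc[symmetric])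
  then show "emeasure (distr \<mu> borel (\<lambda>y. x + y)) A = emeasure \<mu> A"
    using A haar by (simp add: emeasure_distr unimodular_lc_group_def haar_measure_on_def)
qed simp

lemma distr_right: "distr \<mu> borel (\<lambda>y. y + x) = \<mu>"
proof (rule measure_eqI)
  fix A assume "A \<in> sets (distr \<mu> borel (\<lambda>y. y + x))"
  then have A: "A \<in> sets borel" by simp
  have "(\<lambda>y. y + x) -` A = (\<lambda>y. y + - x) ` A"
    by (auto intro: rev_image_eqI simp: add.assoc simp del: add_uminus_conv_diff)
  then show "emeasure (distr \<mu> borel (\<lambda>y. y + x)) A = emeasure \<mu> A"
    using A haar
    by (simp add: emeasure_distr unimodular_lc_group_def haar_measure_on_def del: add_uminus_conv_diff)
qed simp

lemma nn_integral_left: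
  "f \<in> borel_measurable borel \<Longrightarrow> (\<integral>\<^sup>+y. f (x + y) \<partial>\<mu>) = (\<integral>\<^sup>+y. f y \<partial>\<mu>)"
  using nn_integral_distr[of "\<lambda>y. x + y" \<mu> borel f] by (simp add: distr_left)

lemma AE_left:
  assumes "AE y in \<mu>. P y"
  shows "AE y in \<mu>. P (x + y)"
proof -
  obtain N where N: "{y. \<not> P y} \<subseteq> N" "emeasure \<mu> N = 0" "N \<in> sets borel"
    using assms by (auto elim!: AE_E)
  have "emeasure \<mu> ((\<lambda>y. x + y) -` N) = 0"
    using N emeasure_distr[of "\<lambda>y. x + y" \<mu> borel N] by (simp add: distr_left)
  moreover have "(\<lambda>y. x + y) -` N \<in> sets borel"
    using measurable_sets[of "\<lambda>y. x + y" borel borel N] N by simp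
  ultimately show ?thesis
    using N by (intro AE_I[of _ _ "(\<lambda>y. x + y) -` N"]) auto
qed

lemma AE_right:
  assumes "AE y in \<mu>. P y"
  shows "AE y in \<mu>. P (y + x)"
proof -
  obtain N where N: "{y. \<not> P y} \<subseteq> N" "emeasure \<mu> N = 0" "N \<in> sets borel"
    using assms by (auto elim!: AE_E)
  have "emeasure \<mu> ((\<lambda>y. y + x) -` N) = 0"
    using N emeasure_distr[of "\<lambda>y. y + x" \<mu> borel N] by (simp add: distr_right)
  moreover have "(\<lambda>y. y + x) -` N \<in> sets borel"
    using measurable_sets[of "\<lambda>y. y + x" borel borel N] N by simp
  ultimately show ?thesis
    using N by (intro AE_I[of _ _ "(\<lambda>y. y + x) -` N"]) auto
qed

sublocale sigma_finite_measure \<mu>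
proof
  obtain \<K> where \<K>: "countable \<K>" "\<And>K. K \<in> \<K> \<Longrightarrow> compact K" "\<Union>\<K> = (UNIV :: 'a set)"
    using lc_open_sigma_compact[OF lc open_UNIV] by blast
  then show "\<exists>A. countable A \<and> A \<subseteq> sets \<mu> \<and> \<Union>A = space \<mu> \<and> (\<forall>a\<in>A. emeasure \<mu> a \<noteq> \<infinity>)"
    using compact_finite by (intro exI[of _ \<K>]) (auto simp: compact_imp_closed less_top[symmetric])
qed

text \<open>Constants in \<open>ennreal\<close> are cancelled against a finite positive measure,
  while \<open>S\<close> itself may have infinite measure.\<close>

lemma exists_finite_pos:
  assumes S: "S \<in> sets borel" "emeasure \<mu> S \<noteq> 0"
  shows "\<exists>A\<in>sets borel. A \<subseteq> S \<and> emeasure \<mu> A \<noteq> 0 \<and> emeasure \<mu> A < \<infinity>"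
proof (rule ccontr)
  assume *: "\<not> ?thesis"
  obtain F :: "nat \<Rightarrow> 'a set" where F: "range F \<subseteq> sets \<mu>" "(\<Union>i. F i) = space \<mu>"
    "\<And>i. emeasure \<mu> (F i) \<noteq> \<infinity>"
    using sigma_finite by blast
  have "emeasure \<mu> (S \<inter> F i) = 0" for i
  proof -
    have "emeasure \<mu> (S \<inter> F i) \<le> emeasure \<mu> (F i)"
      using F(1) by (intro emeasure_mono) auto
    then have "emeasure \<mu> (S \<inter> F i) < \<infinity>"
      using F(3)[of i] by (simp add: less_top order.strict_trans1)
    moreover have "S \<inter> F i \<in> sets borel"
      using S F(1) by auto
    ultimately show ?thesis using * by blast
  qed
  then have "emeasure \<mu> (\<Union>i. S \<inter> F i) = 0"
    using S F(1) by (intro emeasure_UN_eq_0) auto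
  moreover have "(\<Union>i. S \<inter> F i) = S"
    using F(2) by auto
  ultimately show False using S by simp
qed

end

section \<open>The marginals of a polyhomomorphism\<close>

text \<open>
  The measure \<open>\<nu>\<close> is the Haar measure of \<open>R\<close> pushed forward to the whole product; unlike a measure with
  space \<open>R\<close>, it makes the setting symmetric under exchanging the factors without changing measurable
  structures.
\<close>

locale polyhom = G: unimodular_haar \<gamma> + H: unimodular_haar \<eta>
  for \<gamma> :: "'g::{topological_group_add, t2_space, second_countable_topology} measure"
    and \<eta> :: "'h::{topological_group_add, t2_space, second_countable_topology} measure" +
  fixes R :: "('g \<times> 'h) set" and \<nu> :: "('g \<times> 'h) measure"
  assumes subgroup: "add_subgroup R" and closed_R: "closed R"
    and sets_nu [simp, measurable_cong]: "sets \<nu> = sets borel"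
    and AE_R: "AE p in \<nu>. p \<in> R"
    and nu_nz: "emeasure \<nu> UNIV \<noteq> 0"
    and nu_left: "x \<in> R \<Longrightarrow> distr \<nu> borel (\<lambda>p. (fst x + fst p, snd x + snd p)) = \<nu>"
    and nu_fst_le: "A \<in> sets borel \<Longrightarrow> emeasure \<nu> (A \<times> UNIV) \<le> emeasure \<gamma> A"
    and nu_snd_le: "B \<in> sets borel \<Longrightarrow> emeasure \<nu> (UNIV \<times> B) \<le> emeasure \<eta> B"
begin

lemma space_nu [simp]: "space \<nu> = UNIV"
  using sets_eq_imp_space_eq[OF sets_nu] by simp

lemma measurable_fst_nu [measurable]: "fst \<in> \<nu> \<rightarrow>\<^sub>M borel"
  and measurable_snd_nu [measurable]: "snd \<in> \<nu> \<rightarrow>\<^sub>M borel"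
  by (simp_all add: measurable_cong_sets[OF sets_nu refl] borel_measurable_continuous_onI continuous_on_fst
      continuous_on_snd continuous_on_id)

lemma add_R: "(g, h) \<in> R \<Longrightarrow> (g', h') \<in> R \<Longrightarrow> (g + g', h + h') \<in> R"
  using subgroup by (force simp: add_subgroup_def)

lemma uminus_R: "(g, h) \<in> R \<Longrightarrow> (- g, - h) \<in> R"
  using subgroup by (force simp: add_subgroup_def)

lemma zero_R: "(0, 0) \<in> R"
  using subgroup by (simp add: add_subgroup_def zero_prod_def)

lemma Domain_borel [measurable]: "Domain R \<in> sets borel"
  using fst_image_borel[OF G.lc H.lc closed_R open_UNIV] by (simp add: Domain_fst)

lemma Domain_add_iff:
  assumes "x \<in> Domain R"
  shows "x + y \<in> Domain R \<longleftrightarrow> y \<in> Domain R" "y + x \<in> Domain R \<longleftrightarrow> y \<in> Domain R"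
proof -
  obtain h where h: "(x, h) \<in> R" using assms by blast
  show "x + y \<in> Domain R \<longleftrightarrow> y \<in> Domain R"
    using add_R[OF h] add_R[OF uminus_R[OF h], of "x + y"] by (force simp: add.assoc[symmetric])
  show "y + x \<in> Domain R \<longleftrightarrow> y \<in> Domain R"
    using add_R[OF _ h] add_R[OF _ uminus_R[OF h], of "y + x"] by (force simp: add.assoc)
qed

lemma swap: "polyhom \<eta> \<gamma> (R\<inverse>) (distr \<nu> borel prod.swap)"
proof
  have [measurable]: "prod.swap \<in> \<nu> \<rightarrow>\<^sub>M borel"
    by (simp add: measurable_cong_sets[OF sets_nu refl] borel_measurable_continuous_onI continuous_on_swap)
  show "add_subgroup (R\<inverse>)"
    using zero_R add_R uminus_R by (auto simp: add_subgroup_def zero_prod_def)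
  have "R\<inverse> = prod.swap -` R" by auto
  then show "closed (R\<inverse>)"
    using closed_vimage[OF closed_R continuous_on_swap] by simp
  show "AE p in distr \<nu> borel prod.swap. p \<in> R\<inverse>"
    using AE_R closed_R \<open>closed (R\<inverse>)\<close> by (subst AE_distr_iff) (auto simp: prod.swap_def)
  show "emeasure (distr \<nu> borel prod.swap) UNIV \<noteq> 0"
    using nu_nz by (simp add: emeasure_distr)
  show "distr (distr \<nu> borel prod.swap) borel (\<lambda>p. (fst x + fst p, snd x + snd p))
      = distr \<nu> borel prod.swap" if "x \<in> R\<inverse>" for x
  proof -
    have "prod.swap x \<in> R" using that by auto
    have [measurable]: "(\<lambda>p. (fst x + fst p, snd x + snd p)) \<in> borel \<rightarrow>\<^sub>M borel"
      by (intro borel_measurable_continuous_onI continuous_intros)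
    have [measurable]: "(\<lambda>p. (snd x + fst p, fst x + snd p)) \<in> \<nu> \<rightarrow>\<^sub>M borel"
      by (simp add: measurable_cong_sets[OF sets_nu refl])
    have [measurable]: "prod.swap \<in> (borel :: ('g \<times> 'h) measure) \<rightarrow>\<^sub>M borel"
      by (intro borel_measurable_continuous_onI continuous_on_swap)
    have "distr (distr \<nu> borel prod.swap) borel (\<lambda>p. (fst x + fst p, snd x + snd p))
        = distr (distr \<nu> borel (\<lambda>p. (snd x + fst p, fst x + snd p))) borel prod.swap"
      by (simp add: distr_distr comp_def prod.swap_def)
    then show ?thesis
      using nu_left[OF \<open>prod.swap x \<in> R\<close>] by simp
  qed
  show "emeasure (distr \<nu> borel prod.swap) (A \<times> UNIV) \<le> emeasure \<eta> A" if "A \<in> sets borel" for A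
  proof -
    have "prod.swap -` (A \<times> (UNIV :: 'g set)) = UNIV \<times> A" by auto
    moreover have "A \<times> UNIV \<in> sets (borel :: ('h \<times> 'g) measure)"
      using that by (simp add: borel_prod[symmetric])
    ultimately show ?thesis
      using nu_snd_le[OF that] by (simp add: emeasure_distr)
  qed
  show "emeasure (distr \<nu> borel prod.swap) (UNIV \<times> A) \<le> emeasure \<gamma> A" if "A \<in> sets borel" for A
  proof -
    have "prod.swap -` ((UNIV :: 'h set) \<times> A) = A \<times> UNIV" by auto
    moreover have "UNIV \<times> A \<in> sets (borel :: ('h \<times> 'g) measure)"
      using that by (simp add: borel_prod[symmetric])
    ultimately show ?thesis
      using nu_fst_le[OF that] by (simp add: emeasure_distr)
  qed
qed simp

lemma emeasure_fst: "A \<in> sets borel \<Longrightarrow> emeasure (distr \<nu> borel fst) A = emeasure \<nu> (A \<times> UNIV)"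
  by (simp add: emeasure_distr vimage_fst)

lemma nn_integral_fst_le:
  assumes [measurable]: "F \<in> borel_measurable borel"
  shows "(\<integral>\<^sup>+p. F (fst p) \<partial>\<nu>) \<le> (\<integral>\<^sup>+g. F g \<partial>\<gamma>)"
proof -
  have "(\<integral>\<^sup>+p. F (fst p) \<partial>\<nu>) = (\<integral>\<^sup>+g. F g \<partial>(distr \<nu> borel fst))"
    by (simp add: nn_integral_distr)
  also have "\<dots> \<le> (\<integral>\<^sup>+g. F g \<partial>\<gamma>)"
    by (rule nn_integral_mono_measure)
      (auto simp: le_measure emeasure_fst nu_fst_le)
  finally show ?thesis .
qed

lemma AE_fst_Domain: "AE g in distr \<nu> borel fst. g \<in> Domain R"
proof -
  have "AE p in \<nu>. fst p \<in> Domain R"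
    using AE_R by eventually_elim force
  then show ?thesis
    by (subst AE_distr_iff) auto
qed

lemma fst_left:
  assumes "x \<in> Domain R"
  shows "distr (distr \<nu> borel fst) borel (\<lambda>g. x + g) = distr \<nu> borel fst"
proof -
  obtain h where h: "(x, h) \<in> R" using assms by blast
  have [measurable]: "(\<lambda>p. (x + fst p, h + snd p)) \<in> \<nu> \<rightarrow>\<^sub>M borel"
    by (simp add: measurable_cong_sets[OF sets_nu refl])
  have [measurable]: "fst \<in> (borel :: ('g \<times> 'h) measure) \<rightarrow>\<^sub>M borel"
    by (simp add: measurable_cong_sets[OF sets_nu refl, symmetric])
  have "distr (distr \<nu> borel fst) borel (\<lambda>g. x + g)
      = distr (distr \<nu> borel (\<lambda>p. (x + fst p, h + snd p))) borel fst"
    by (simp add: distr_distr comp_def)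
  then show ?thesis
    using nu_left[OF h] by simp
qed

text \<open>
  Since the marginal is dominated by \<open>\<gamma>\<close>, no uniqueness theorem for Haar measures is needed: its density
  is invariant under each translation from \<open>dom R\<close>, hence constant on \<open>dom R\<close> by Fubini.
\<close>

lemma fst_marginal:
  obtains a :: real where "0 < a" "a \<le> 1"
    "distr \<nu> borel fst = density \<gamma> (\<lambda>g. ennreal a * indicator (Domain R) g)"
proof -
  define M where "M = distr \<nu> borel fst"
  have sets_M: "sets M = sets borel" by (simp add: M_def)
  have M_le: "emeasure M A \<le> emeasure \<gamma> A" if "A \<in> sets borel" for A
    using that by (simp add: M_def emeasure_fst nu_fst_le)
  have "absolutely_continuous \<gamma> M"
    unfolding absolutely_continuous_def using M_le sets_M by (force simp: null_sets_def)
  then obtain f where f [measurable]: "f \<in> borel_measurable borel" and fM: "density \<gamma> f = M"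
    using G.Radon_Nikodym[of M] sets_M by (auto simp: measurable_cong_sets[OF G.sets_eq refl])
  have inv: "AE y in \<gamma>. f (x + y) = f y" if x: "x \<in> Domain R" for x
  proof -
    have "- x \<in> Domain R" using x uminus_R by blast
    \<comment> \<open>Translating \<open>M\<close> by \<open>- x\<close> replaces the density
      \<open>f\<close> by \<open>f (x + y)\<close>. As \<open>M\<close> is invariant, uniqueness of
      densities compares the two.\<close>
    have "M = density (distr \<gamma> borel (\<lambda>y. x + y)) f"
      by (simp add: G.distr_left fM)
    also have "\<dots> = distr (density \<gamma> (\<lambda>y. f (x + y))) borel (\<lambda>y. x + y)"
      by (subst density_distr) auto
    finally have "distr M borel (\<lambda>y. - x + y)
        = distr (distr (density \<gamma> (\<lambda>y. f (x + y))) borel (\<lambda>y. x + y)) borel (\<lambda>y. - x + y)"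
      by simp
    also have "\<dots> = distr (density \<gamma> (\<lambda>y. f (x + y))) borel (\<lambda>y. y)"
      by (subst distr_distr) (auto simp: comp_def add.assoc[symmetric])
    also have "\<dots> = density \<gamma> (\<lambda>y. f (x + y))"
      by (rule distr_id2) simp
    finally have "density \<gamma> (\<lambda>y. f (x + y)) = density \<gamma> f"
      using fst_left[OF \<open>- x \<in> Domain R\<close>] fM by (simp add: M_def)
    then show ?thesis
      by (subst (asm) G.density_unique_iff) auto
  qed
  have nz: "\<not> (AE y in \<gamma>. y \<notin> Domain R)"
  proof
    assume "AE y in \<gamma>. y \<notin> Domain R"
    then have "AE y in M. y \<notin> Domain R"
      unfolding fM[symmetric] by (subst AE_density) auto
    then have "AE y in M. False"
      using AE_fst_Domain unfolding M_def by eventually_elim simp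
    then have "emeasure M UNIV = 0"
      by (auto simp: AE_iff_measurable[OF _ refl] M_def)
    then show False
      using nu_nz by (simp add: M_def emeasure_fst)
  qed
  interpret GG: pair_sigma_finite \<gamma> \<gamma> ..
  \<comment> \<open>The null set of \<open>y\<close> depends on \<open>x\<close>. Exchanging the
    quantifiers yields one \<open>y\<close> in \<open>Domain R\<close> that works for almost every
    \<open>x\<close>.\<close>
  have "AE x in \<gamma>. AE y in \<gamma>. x \<in> Domain R \<longrightarrow> f (x + y) = f y"
    using inv by auto
  then have "AE y in \<gamma>. AE x in \<gamma>. x \<in> Domain R \<longrightarrow> f (x + y) = f y"
    by (subst (asm) GG.AE_commute) measurable
  then obtain y where y: "y \<in> Domain R" and "AE x in \<gamma>. x \<in> Domain R \<longrightarrow> f (x + y) = f y"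
    using nz by (metis (mono_tags, lifting) AE_E2 eventually_mono)
  \<comment> \<open>Right translation by \<open>- y\<close> preserves null sets because the group is
    unimodular. It turns \<open>f (x + y)\<close> into \<open>f x\<close>, so the constant value of
    the density is \<open>f y\<close>.\<close>
  then have "AE x in \<gamma>. x + - y \<in> Domain R \<longrightarrow> f (x + - y + y) = f y"
    using G.AE_right[of "\<lambda>x. x \<in> Domain R \<longrightarrow> f (x + y) = f y" "- y"] by simp
  moreover have "x + - y \<in> Domain R \<longleftrightarrow> x \<in> Domain R" for x
    using y uminus_R by (intro Domain_add_iff) blast
  ultimately have f1: "AE x in \<gamma>. x \<in> Domain R \<longrightarrow> f x = f y"
    by (simp add: add.assoc)
  have f0: "AE x in \<gamma>. x \<notin> Domain R \<longrightarrow> f x = 0"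
    using AE_fst_Domain unfolding M_def[symmetric] fM[symmetric]
    by (subst (asm) AE_density) (auto simp: less_le)
  define c where "c = f y"
  have M_eq: "M = density \<gamma> (\<lambda>g. c * indicator (Domain R) g)"
    unfolding fM[symmetric]
    by (rule density_cong) (use f0 f1 in \<open>auto simp: c_def indicator_def\<close>)
  have "emeasure \<gamma> (Domain R) \<noteq> 0"
    using nz by (subst (asm) AE_iff_measurable[OF _ refl]) auto
  then obtain A where A: "A \<in> sets borel" "A \<subseteq> Domain R" "emeasure \<gamma> A \<noteq> 0" "emeasure \<gamma> A < \<infinity>"
    using G.exists_finite_pos[of "Domain R"] by auto
  have "emeasure M A = (\<integral>\<^sup>+g. c * indicator A g \<partial>\<gamma>)"
    unfolding M_eq using A by (subst emeasure_density) (auto intro!: nn_integral_cong simp: indicator_def)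
  also have "\<dots> = c * emeasure \<gamma> A"
    using A by (simp add: nn_integral_cmult_indicator)
  finally have "emeasure \<gamma> A * c \<le> emeasure \<gamma> A * 1"
    using M_le[OF A(1)] by (simp add: mult.commute)
  then have "c \<le> 1"
    using A by (subst (asm) ennreal_mult_le_mult_iff) auto
  moreover have "c \<noteq> 0"
  proof
    assume "c = 0"
    then have "emeasure M UNIV = 0"
      unfolding M_eq by (simp add: emeasure_density)
    then show False
      using nu_nz by (simp add: M_def emeasure_fst)
  qed
  ultimately obtain a where "c = ennreal a" "0 < a" "a \<le> 1"
    by (cases c) (auto simp: less_le top_unique)
  then show ?thesis
    using that[of a] M_eq by (simp add: M_def)
qed

end

section \<open>Averages over translates\<close>

context unimodular_haar
begin

text \<open>
  For open \<open>C\<close> the average \<open>conv p C\<close> is lower semicontinuous, and a translation invariance of \<open>p\<close> that only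
  holds almost everywhere becomes an invariance at every point.
\<close>

definition conv :: "('a \<Rightarrow> ennreal) \<Rightarrow> 'a set \<Rightarrow> 'a \<Rightarrow> ennreal" where
  "conv p C t = (\<integral>\<^sup>+h. p h * indicator C (- h + t) \<partial>\<mu>)"

lemma indicator_uminus: "indicator (C :: 'a set) (- h + t) = (indicator (uminus ` C) (- t + h) :: ennreal)"
proof -
  have "uminus ` C = uminus -` C" by (force simp: image_iff)
  then show ?thesis by (simp add: indicator_def minus_add)
qed

lemma open_uminus_image: "open C \<Longrightarrow> open (uminus ` C :: 'a set)"
proof -
  assume "open C"
  have "uminus ` C = uminus -` C" by (force simp: image_iff)
  also have "open \<dots>"
    by (rule open_vimage[OF \<open>open C\<close>]) (intro continuous_intros)
  finally show ?thesis .
qed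

lemma emeasure_uminus_finite:
  assumes "compact K" "C \<subseteq> K"
  shows "emeasure \<mu> (uminus ` C) < \<infinity>"
proof (rule rel_compact_finite)
  show "compact (uminus ` K)"
    by (intro compact_continuous_image continuous_intros assms)
qed (use assms in auto)

lemma kernel_measurable [measurable]:
  assumes [measurable]: "(C :: 'a set) \<in> sets borel"
  shows "(\<lambda>h. indicator C (- h + t) :: ennreal) \<in> borel_measurable borel"
    and "(\<lambda>t. indicator C (- h + t) :: ennreal) \<in> borel_measurable borel"
  by measurable

lemma nn_integral_kernel_right:
  assumes [measurable]: "C \<in> sets borel"
  shows "(\<integral>\<^sup>+t. indicator C (- h + t) \<partial>\<mu>) = emeasure \<mu> C"
  using nn_integral_left[of "indicator C" "- h"] by simp

lemma nn_integral_kernel_left: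
  assumes "open C"
  shows "(\<integral>\<^sup>+h. indicator C (- h + t) \<partial>\<mu>) = emeasure \<mu> (uminus ` C)"
  using nn_integral_kernel_right[of "uminus ` C" t] open_uminus_image[OF assms]
  by (simp add: indicator_uminus[of C])

text \<open>Fatou's lemma: the indicator of an open set is lower semicontinuous along
  \<open>x n\<close>. Sequences detect closed sets because the space is second countable.\<close>

lemma open_conv_greater:
  assumes "open C" and [measurable]: "p \<in> borel_measurable borel"
  shows "open {t. c < conv p C t}"
proof -
  have [measurable]: "C \<in> sets borel" using assms by simp
  have "closed {t. conv p C t \<le> c}"
    unfolding closed_sequential_limits
  proof (intro allI impI, elim conjE)
    fix x l assume x: "\<forall>n. x n \<in> {t. conv p C t \<le> c}" and lim: "x \<longlonglongrightarrow> l"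
    have "conv p C l \<le> (\<integral>\<^sup>+h. liminf (\<lambda>n. p h * indicator C (- h + x n)) \<partial>\<mu>)"
      unfolding conv_def
    proof (rule nn_integral_mono)
      fix h
      have "(\<lambda>n. - h + x n) \<longlonglongrightarrow> - h + l"
        by (intro tendsto_intros lim)
      then have "\<forall>\<^sub>F n in sequentially. - h + x n \<in> C" if "- h + l \<in> C"
        using topological_tendstoD assms(1) that by blast
      then have "\<forall>\<^sub>F n in sequentially. p h * indicator C (- h + l) \<le> p h * indicator C (- h + x n)"
        by (cases "- h + l \<in> C") (auto elim: eventually_mono)
      then show "p h * indicator C (- h + l) \<le> liminf (\<lambda>n. p h * indicator C (- h + x n))"
        by (rule Liminf_bounded)
    qed
    also have "\<dots> \<le> liminf (\<lambda>n. conv p C (x n))"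
      unfolding conv_def by (rule nn_integral_liminf) measurable
    also have "\<dots> \<le> c"
      using x by (intro Liminf_le) auto
    finally show "l \<in> {t. conv p C t \<le> c}" by simp
  qed
  then have "open (- {t. conv p C t \<le> c})" by (rule open_Compl)
  moreover have "- {t. conv p C t \<le> c} = {t. c < conv p C t}" by auto
  ultimately show ?thesis by simp
qed

lemma conv_measurable:
  assumes "open C" "p \<in> borel_measurable borel"
  shows "conv p C \<in> borel_measurable borel"
  using open_conv_greater[OF assms] by (intro borel_measurableI_greater) simp

text \<open>The kernel \<open>- h + t\<close> does not change when \<open>h\<close> and
  \<open>t\<close> are both translated on the left by \<open>d\<close>. The hypothesis therefore
  enters only under the integral, which is why the conclusion holds for every
  \<open>t\<close>.\<close>

lemma conv_invariant:
  assumes "open C" and [measurable]: "p \<in> borel_measurable borel" and inv: "AE h in \<mu>. p (d + h) = p h"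
  shows "conv p C (d + t) = conv p C t"
proof -
  have [measurable]: "C \<in> sets borel" using assms by simp
  have "conv p C (d + t) = (\<integral>\<^sup>+h. p (d + h) * indicator C (- (d + h) + (d + t)) \<partial>\<mu>)"
    unfolding conv_def by (rule nn_integral_left[symmetric]) measurable
  also have "\<dots> = (\<integral>\<^sup>+h. p (d + h) * indicator C (- h + t) \<partial>\<mu>)"
    by (simp add: minus_add add.assoc[symmetric] del: add_uminus_conv_diff)
      (simp add: add.assoc)
  also have "\<dots> = conv p C t"
    unfolding conv_def by (rule nn_integral_cong_AE) (use inv in auto)
  finally show ?thesis .
qed

text \<open>Tonelli: read in the other variable, the kernel of \<open>C\<close> is the kernel of the
  set of inverses of \<open>C\<close>.\<close>

lemma conv_adjoint:
  assumes "open C" and [measurable]: "p \<in> borel_measurable borel" "f \<in> borel_measurable borel"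
  shows "(\<integral>\<^sup>+t. f t * conv p C t \<partial>\<mu>) = (\<integral>\<^sup>+h. p h * conv f (uminus ` C) h \<partial>\<mu>)"
proof -
  interpret MM: pair_sigma_finite \<mu> \<mu> ..
  have [measurable]: "C \<in> sets borel" using assms by simp
  have "(\<integral>\<^sup>+t. f t * conv p C t \<partial>\<mu>) = (\<integral>\<^sup>+t. (\<integral>\<^sup>+h. f t * (p h * indicator C (- h + t)) \<partial>\<mu>) \<partial>\<mu>)"
    unfolding conv_def by (intro nn_integral_cong nn_integral_cmult[symmetric]) measurable
  also have "\<dots> = (\<integral>\<^sup>+h. (\<integral>\<^sup>+t. f t * (p h * indicator C (- h + t)) \<partial>\<mu>) \<partial>\<mu>)"
    by (rule MM.Fubini') measurable
  also have "\<dots> = (\<integral>\<^sup>+h. (\<integral>\<^sup>+t. p h * (f t * indicator (uminus ` C) (- t + h)) \<partial>\<mu>) \<partial>\<mu>)"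
    by (simp add: indicator_uminus[of C] mult.left_commute)
  also have "\<dots> = (\<integral>\<^sup>+h. p h * conv f (uminus ` C) h \<partial>\<mu>)"
    unfolding conv_def using open_uminus_image[OF assms(1)]
    by (intro nn_integral_cong nn_integral_cmult) auto
  finally show ?thesis .
qed

lemma conv_power2_le:
  assumes "open C" and [measurable]: "p \<in> borel_measurable borel"
  shows "(conv p C t)\<^sup>2 \<le> emeasure \<mu> (uminus ` C) * (\<integral>\<^sup>+h. (p h)\<^sup>2 * indicator C (- h + t) \<partial>\<mu>)"
proof -
  have [measurable]: "C \<in> sets borel" using assms by simp
  \<comment> \<open>The indicator equals its square; one copy stays with \<open>p\<close>, the other
    produces the measure.\<close>
  have "(conv p C t)\<^sup>2 = (\<integral>\<^sup>+h. (p h * indicator C (- h + t)) * indicator C (- h + t) \<partial>\<mu>)\<^sup>2"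
    unfolding conv_def
    by (intro arg_cong[where f="\<lambda>x. x\<^sup>2"] nn_integral_cong) (simp add: indicator_def)
  also have "\<dots> \<le> (\<integral>\<^sup>+h. (p h * indicator C (- h + t))\<^sup>2 \<partial>\<mu>) * (\<integral>\<^sup>+h. (indicator C (- h + t))\<^sup>2 \<partial>\<mu>)"
    by (rule Cauchy_Schwarz_nn_integral) measurable
  also have "(\<integral>\<^sup>+h. (indicator C (- h + t))\<^sup>2 \<partial>\<mu>) = emeasure \<mu> (uminus ` C)"
    unfolding nn_integral_kernel_left[OF assms(1), symmetric, of t]
    by (intro nn_integral_cong) (simp add: indicator_def)
  also have "(\<integral>\<^sup>+h. (p h * indicator C (- h + t))\<^sup>2 \<partial>\<mu>) = (\<integral>\<^sup>+h. (p h)\<^sup>2 * indicator C (- h + t) \<partial>\<mu>)"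
    by (intro nn_integral_cong) (simp add: indicator_def)
  finally show ?thesis by (simp add: mult.commute)
qed

lemma conv_finite:
  assumes "open C" "compact K" "C \<subseteq> K" and [measurable]: "p \<in> borel_measurable borel"
    and "(\<integral>\<^sup>+h. (p h)\<^sup>2 \<partial>\<mu>) < \<infinity>"
  shows "conv p C t < \<infinity>"
proof -
  have "(\<integral>\<^sup>+h. (p h)\<^sup>2 * indicator C (- h + t) \<partial>\<mu>) \<le> (\<integral>\<^sup>+h. (p h)\<^sup>2 \<partial>\<mu>)"
    by (intro nn_integral_mono) (simp add: indicator_def)
  then have "emeasure \<mu> (uminus ` C) * (\<integral>\<^sup>+h. (p h)\<^sup>2 * indicator C (- h + t) \<partial>\<mu>) < \<infinity>"
    using assms emeasure_uminus_finite[OF assms(2,3)] by (simp add: ennreal_mult_less_top order.strict_trans1)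
  then have "(conv p C t)\<^sup>2 < \<infinity>"
    using conv_power2_le[OF assms(1,4)] by (rule order.strict_trans1[rotated])
  then show ?thesis
    by (simp add: power_less_top_ennreal)
qed

text \<open>A form of Young's inequality: the operator norm on square integrable functions is at
  most the geometric mean of the measures of \<open>C\<close> and of its set of inverses.\<close>

lemma conv_square_finite:
  assumes "open C" "compact K" "C \<subseteq> K" and [measurable]: "p \<in> borel_measurable borel"
    and fin: "(\<integral>\<^sup>+h. (p h)\<^sup>2 \<partial>\<mu>) < \<infinity>"
  shows "(\<integral>\<^sup>+t. (conv p C t)\<^sup>2 \<partial>\<mu>) < \<infinity>"
proof -
  interpret MM: pair_sigma_finite \<mu> \<mu> ..
  have C [measurable]: "C \<in> sets borel" using assms by simp
  have "(\<integral>\<^sup>+t. (conv p C t)\<^sup>2 \<partial>\<mu>)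
      \<le> (\<integral>\<^sup>+t. emeasure \<mu> (uminus ` C) * (\<integral>\<^sup>+h. (p h)\<^sup>2 * indicator C (- h + t) \<partial>\<mu>) \<partial>\<mu>)"
    by (intro nn_integral_mono conv_power2_le assms)
  also have "\<dots> = emeasure \<mu> (uminus ` C) * (\<integral>\<^sup>+t. (\<integral>\<^sup>+h. (p h)\<^sup>2 * indicator C (- h + t) \<partial>\<mu>) \<partial>\<mu>)"
    by (rule nn_integral_cmult) measurable
  also have "(\<integral>\<^sup>+t. (\<integral>\<^sup>+h. (p h)\<^sup>2 * indicator C (- h + t) \<partial>\<mu>) \<partial>\<mu>)
      = (\<integral>\<^sup>+h. (\<integral>\<^sup>+t. (p h)\<^sup>2 * indicator C (- h + t) \<partial>\<mu>) \<partial>\<mu>)"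
    by (rule MM.Fubini') measurable
  also have "\<dots> = (\<integral>\<^sup>+h. (p h)\<^sup>2 * emeasure \<mu> C \<partial>\<mu>)"
    by (subst nn_integral_cmult) (auto simp: nn_integral_kernel_right[OF C])
  also have "\<dots> = (\<integral>\<^sup>+h. (p h)\<^sup>2 \<partial>\<mu>) * emeasure \<mu> C"
    by (rule nn_integral_multc) measurable
  also have "emeasure \<mu> (uminus ` C) * \<dots> < \<infinity>"
    using fin emeasure_uminus_finite[OF assms(2,3)] rel_compact_finite[OF assms(2,3)]
    by (simp add: ennreal_mult_less_top)
  finally show ?thesis .
qed

text \<open>A single point \<open>h\<close> suffices. The average at \<open>h\<close> over the
  inverses of \<open>C\<close> is the measure of \<open>h + C\<close> with density \<open>f1\<close>
  or \<open>f2\<close>; translating by \<open>- h\<close> makes \<open>B\<close> itself the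
  generating pi-system.\<close>

lemma conv_eq_imp_AE_eq:
  fixes f1 f2 :: "'a \<Rightarrow> ennreal"
  assumes [measurable]: "f1 \<in> borel_measurable borel" "f2 \<in> borel_measurable borel"
    and fin: "(\<integral>\<^sup>+t. (f1 t)\<^sup>2 \<partial>\<mu>) < \<infinity>"
    and B: "countable B" "topological_basis B" "Int_stable B" "\<And>U. U \<in> B \<Longrightarrow> \<exists>K. compact K \<and> U \<subseteq> K"
    and eq: "\<And>C. C \<in> B \<Longrightarrow> conv f1 (uminus ` C) h = conv f2 (uminus ` C) h"
  shows "AE t in \<mu>. f1 t = f2 t"
proof -
  define N where "N f = distr (density \<mu> f) borel (\<lambda>t. - h + t)" for f
  have opB: "open C" if "C \<in> B" for C
    using topological_basis_open[OF B(2) that] .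
  have N: "emeasure (N f) C = conv f (uminus ` C) h"
    if [measurable]: "f \<in> borel_measurable borel" and C: "C \<in> B" for f C
  proof -
    have [measurable]: "C \<in> sets borel" using opB[OF C] by simp
    have "emeasure (N f) C = (\<integral>\<^sup>+t. f t * indicator ((\<lambda>t. - h + t) -` C) t \<partial>\<mu>)"
      unfolding N_def
      by (subst emeasure_distr, simp, simp, subst emeasure_density)
        (auto intro: measurable_sets_borel[where M=borel and f="\<lambda>t. - h + t"])
    also have "\<dots> = conv f (uminus ` C) h"
      unfolding conv_def by (intro nn_integral_cong) (simp add: indicator_uminus[of C, symmetric] indicator_vimage)
    finally show ?thesis .
  qed
  have sets: "sets (N f) = sigma_sets UNIV B" for f
    unfolding N_def by (simp add: borel_eq_countable_basis[OF B(1,2)] sigma_algebra.sets_measure_of_eq)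
  have "N f1 = N f2"
  proof (rule measure_eqI_generator_eq_countable[OF B(3) _ _ sets sets, where A=B])
    show "emeasure (N f1) C = emeasure (N f2) C" if "C \<in> B" for C
      using that by (simp add: N eq)
    show "\<Union>B = UNIV"
      by (rule UNIV_eq_I[symmetric]) (rule topological_basisE[OF B(2) open_UNIV UNIV_I], auto)
    show "emeasure (N f1) C \<noteq> \<infinity>" if C: "C \<in> B" for C
    proof -
      obtain K where K: "compact K" "C \<subseteq> K" using B(4)[OF C] by blast
      have "conv f1 (uminus ` C) h < \<infinity>"
      proof (rule conv_finite[OF open_uminus_image[OF opB[OF C]] _ _ _ fin])
        show "compact (uminus ` K)"
          by (intro compact_continuous_image continuous_intros K)
      qed (use K in auto)
      then show ?thesis using C by (simp add: N)
    qed
  qed (use B(1) in auto)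
  moreover have "distr (N f) borel (\<lambda>t. h + t) = density \<mu> f" for f
  proof -
    have "distr (N f) borel (\<lambda>t. h + t) = distr (density \<mu> f) borel (\<lambda>t. h + (- h + t))"
      unfolding N_def by (subst distr_distr) (simp_all add: comp_def)
    also have "\<dots> = distr (density \<mu> f) borel (\<lambda>t. t)"
      by (simp add: add.assoc[symmetric])
    also have "\<dots> = density \<mu> f"
      by (rule distr_id2) simp
    finally show ?thesis .
  qed
  ultimately have "density \<mu> f1 = density \<mu> f2"
    by (metis (no_types))
  then show ?thesis
    by (subst (asm) density_unique_iff) auto
qed

end

section \<open>Functions that descend along the relation\<close>

text \<open>Such a pair amounts to one function on the common quotient of \<open>Domain R\<close> by
  \<open>ker_rel R\<close> and of \<open>Range R\<close> by \<open>indef_rel R\<close>. Equality is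
  demanded at every point of \<open>R\<close>, which keeps null sets out of the definition;
  finiteness at every point makes the later passage to real values lossless.\<close>

definition compatible ::
    "'g measure \<Rightarrow> 'h measure \<Rightarrow> ('g::topological_space \<times> 'h::topological_space) set \<Rightarrow>
     ('g \<Rightarrow> ennreal) \<Rightarrow> ('h \<Rightarrow> ennreal) \<Rightarrow> bool" where
  "compatible \<gamma> \<eta> R \<phi> w \<longleftrightarrow>
     \<phi> \<in> borel_measurable borel \<and> w \<in> borel_measurable borel \<and>
     (\<forall>g. \<phi> g < \<infinity>) \<and> (\<forall>h. w h < \<infinity>) \<and>
     (\<forall>g. g \<notin> Domain R \<longrightarrow> \<phi> g = 0) \<and> (\<forall>h. h \<notin> Range R \<longrightarrow> w h = 0) \<and>
     (\<forall>(g, h) \<in> R. \<phi> g = w h) \<and>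
     (\<integral>\<^sup>+g. (\<phi> g)\<^sup>2 \<partial>\<gamma>) < \<infinity> \<and> (\<integral>\<^sup>+h. (w h)\<^sup>2 \<partial>\<eta>) < \<infinity>"

locale polyhom_marginals = polyhom \<gamma> \<eta> R \<nu>
  for \<gamma> :: "'g::{topological_group_add, t2_space, second_countable_topology} measure"
    and \<eta> :: "'h::{topological_group_add, t2_space, second_countable_topology} measure"
    and R \<nu> +
  fixes a b :: real
  assumes a_pos: "0 < a" and b_pos: "0 < b"
    and fst_marg: "distr \<nu> borel fst = density \<gamma> (\<lambda>g. ennreal a * indicator (Domain R) g)"
    and snd_marg: "distr \<nu> borel snd = density \<eta> (\<lambda>h. ennreal b * indicator (Range R) h)"
begin

lemma swap_measurable [measurable]: "prod.swap \<in> \<nu> \<rightarrow>\<^sub>M borel"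
  by (simp add: measurable_cong_sets[OF sets_nu refl] borel_measurable_continuous_onI continuous_on_swap)

lemma measurable_fst_borel [measurable]: "fst \<in> (borel :: ('g \<times> 'h) measure) \<rightarrow>\<^sub>M borel"
  and measurable_snd_borel [measurable]: "snd \<in> (borel :: ('g \<times> 'h) measure) \<rightarrow>\<^sub>M borel"
  and measurable_fst_borel' [measurable]: "fst \<in> (borel :: ('h \<times> 'g) measure) \<rightarrow>\<^sub>M borel"
  and measurable_snd_borel' [measurable]: "snd \<in> (borel :: ('h \<times> 'g) measure) \<rightarrow>\<^sub>M borel"
  by (simp_all add: borel_measurable_continuous_onI continuous_on_fst continuous_on_snd continuous_on_id)

lemma swap_marginals: "polyhom_marginals \<eta> \<gamma> (R\<inverse>) (distr \<nu> borel prod.swap) b a"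
proof (intro polyhom_marginals.intro swap polyhom_marginals_axioms.intro b_pos a_pos)
  show "distr (distr \<nu> borel prod.swap) borel fst
      = density \<eta> (\<lambda>g. ennreal b * indicator (Domain (R\<inverse>)) g)"
    using snd_marg by (subst distr_distr) (simp_all add: comp_def)
  show "distr (distr \<nu> borel prod.swap) borel snd
      = density \<gamma> (\<lambda>g. ennreal a * indicator (Range (R\<inverse>)) g)"
    using fst_marg by (subst distr_distr) (simp_all add: comp_def)
qed

lemma Range_borel [measurable]: "Range R \<in> sets borel"
  using polyhom.Domain_borel[OF swap] by simp

lemma nn_integral_snd_le:
  assumes "F \<in> borel_measurable borel"
  shows "(\<integral>\<^sup>+p. F (snd p) \<partial>\<nu>) \<le> (\<integral>\<^sup>+h. F h \<partial>\<eta>)"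
  using polyhom.nn_integral_fst_le[OF swap assms] assms by (simp add: nn_integral_distr)

lemma nn_integral_fst_nu:
  assumes [measurable]: "F \<in> borel_measurable borel"
  shows "(\<integral>\<^sup>+p. F (fst p) \<partial>\<nu>) = ennreal a * (\<integral>\<^sup>+g. indicator (Domain R) g * F g \<partial>\<gamma>)"
proof -
  have "(\<integral>\<^sup>+p. F (fst p) \<partial>\<nu>) = (\<integral>\<^sup>+g. F g \<partial>(distr \<nu> borel fst))"
    by (simp add: nn_integral_distr)
  also have "\<dots> = (\<integral>\<^sup>+g. ennreal a * (indicator (Domain R) g * F g) \<partial>\<gamma>)"
    unfolding fst_marg by (subst nn_integral_density) (simp_all add: mult.assoc)
  also have "\<dots> = ennreal a * (\<integral>\<^sup>+g. indicator (Domain R) g * F g \<partial>\<gamma>)"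
    by (rule nn_integral_cmult) measurable
  finally show ?thesis .
qed

lemma integral_fst_nu:
  fixes F :: "'g \<Rightarrow> complex"
  assumes [measurable]: "F \<in> borel_measurable borel" and "\<And>g. g \<notin> Domain R \<Longrightarrow> F g = 0"
  shows "(LINT p|\<nu>. F (fst p)) = complex_of_real a * (LINT g|\<gamma>. F g)"
proof -
  have *: "(\<lambda>g. ennreal a * indicator (Domain R) g) = (\<lambda>g. ennreal (a * indicator (Domain R) g))"
    using a_pos by (auto simp: indicator_def)
  have "(LINT p|\<nu>. F (fst p)) = (LINT g|distr \<nu> borel fst. F g)"
    by (simp add: integral_distr)
  also have "\<dots> = (LINT g|\<gamma>. (a * indicator (Domain R) g) *\<^sub>R F g)"
    unfolding fst_marg * using a_pos by (subst integral_density) simp_all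
  also have "\<dots> = (LINT g|\<gamma>. complex_of_real a * F g)"
    using assms(2) by (intro Bochner_Integration.integral_cong) (auto simp: indicator_def scaleR_conv_of_real)
  finally show ?thesis by simp
qed

lemma integral_snd_nu:
  fixes F :: "'h \<Rightarrow> complex"
  assumes [measurable]: "F \<in> borel_measurable borel" and "\<And>h. h \<notin> Range R \<Longrightarrow> F h = 0"
  shows "(LINT p|\<nu>. F (snd p)) = complex_of_real b * (LINT h|\<eta>. F h)"
  using polyhom_marginals.integral_fst_nu[OF swap_marginals assms(1)] assms(2)
  by (simp add: integral_distr)

lemma Range_add_iff:
  "x \<in> Range R \<Longrightarrow> x + y \<in> Range R \<longleftrightarrow> y \<in> Range R"
  using polyhom.Domain_add_iff(1)[OF swap, of x y] by simp

lemma indef_Range: "d \<in> indef_rel R \<Longrightarrow> d \<in> Range R"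
  by (auto simp: indef_rel_def)

lemma Range_nonnull: "\<not> (AE h in \<eta>. h \<notin> Range R)"
proof
  assume "AE h in \<eta>. h \<notin> Range R"
  then have "(\<integral>\<^sup>+h. indicator (Range R) h \<partial>\<eta>) = 0"
    by (subst nn_integral_0_iff_AE) (auto simp: indicator_def elim: eventually_mono)
  then have "(\<integral>\<^sup>+p. indicator (Range R) (snd p) \<partial>\<nu>) = 0"
    using nn_integral_snd_le[of "indicator (Range R)"] by simp
  then have "AE p in \<nu>. snd p \<notin> Range R"
    by (subst (asm) nn_integral_0_iff_AE) (auto simp: indicator_def split: if_splits)
  then have "AE p in \<nu>. False"
    using AE_R by eventually_elim force
  then show False
    using nu_nz by (auto simp: AE_iff_measurable[OF _ refl])
qed

text \<open>Two partners of the same \<open>g\<close> differ by a left translation from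
  \<open>indef_rel R\<close>. The average is exactly invariant under it, so its value at any partner
  depends on \<open>g\<close> alone.\<close>

lemma compatible_conv:
  assumes C: "open C" "compact K" "C \<subseteq> K" and p [measurable]: "p \<in> borel_measurable borel"
    and inv: "\<And>d. d \<in> indef_rel R \<Longrightarrow> AE h in \<eta>. p (d + h) = p h"
    and fin: "(\<integral>\<^sup>+h. (p h)\<^sup>2 \<partial>\<eta>) < \<infinity>"
  obtains \<phi> where "compatible \<gamma> \<eta> R \<phi> (\<lambda>t. indicator (Range R) t * H.conv p C t)"
proof -
  define c where "c = H.conv p C"
  have c_meas [measurable]: "c \<in> borel_measurable borel"
    unfolding c_def by (rule H.conv_measurable[OF C(1) p])
  have c_fin: "c t < \<infinity>" for t
    unfolding c_def by (rule H.conv_finite[OF C p fin])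
  have c_eq: "c h' = c h" if "(g, h) \<in> R" "(g, h') \<in> R" for g h h'
  proof -
    have "h' + - h \<in> indef_rel R"
      using add_R[OF that(2) uminus_R[OF that(1)]] by (simp add: indef_rel_def)
    then have "c ((h' + - h) + h) = c h"
      unfolding c_def by (intro H.conv_invariant C p inv)
    then show ?thesis by (simp add: add.assoc)
  qed
  define \<phi> where "\<phi> g = (if g \<in> Domain R then c (SOME h. (g, h) \<in> R) else 0)" for g
  have \<phi>_eq: "\<phi> g = c h" if "(g, h) \<in> R" for g h
  proof -
    have "c (SOME h. (g, h) \<in> R) = c h"
      by (rule c_eq[OF that]) (rule someI[of "\<lambda>h. (g, h) \<in> R", OF that])
    then show ?thesis
      using that by (simp add: \<phi>_def DomainI)
  qed
  text \<open>The level sets of \<open>c\<close> are open, so their images in \<open>G\<close> are countable unions of compact sets.\<close>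
  have "{g. y < \<phi> g} = fst ` (R \<inter> UNIV \<times> {h. y < c h})" for y
  proof
    show "{g. y < \<phi> g} \<subseteq> fst ` (R \<inter> UNIV \<times> {h. y < c h})"
    proof
      fix g assume g: "g \<in> {g. y < \<phi> g}"
      then have "g \<in> Domain R" by (auto simp: \<phi>_def split: if_splits)
      then obtain h where h: "(g, h) \<in> R" by blast
      then show "g \<in> fst ` (R \<inter> UNIV \<times> {h. y < c h})"
        using g \<phi>_eq[OF h] by (auto intro!: rev_image_eqI[of "(g, h)"])
    qed
  qed (auto simp: \<phi>_eq)
  then have "{g. y < \<phi> g} \<in> sets borel" for y
    using fst_image_borel[OF G.lc H.lc closed_R H.open_conv_greater[OF C(1) p]] by (simp add: c_def)
  then have \<phi>_meas [measurable]: "\<phi> \<in> borel_measurable borel"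
    by (intro borel_measurableI_greater) simp
  have c2: "(\<integral>\<^sup>+h. (c h)\<^sup>2 \<partial>\<eta>) < \<infinity>"
    unfolding c_def by (rule H.conv_square_finite[OF C p fin])
  \<comment> \<open>Both functions agree on \<open>R\<close>, so the square integral over
    \<open>G\<close> is compared through \<open>\<nu>\<close> with the one over
    \<open>H\<close>.\<close>
  have "ennreal a * (\<integral>\<^sup>+g. (\<phi> g)\<^sup>2 \<partial>\<gamma>) = ennreal a * (\<integral>\<^sup>+g. indicator (Domain R) g * (\<phi> g)\<^sup>2 \<partial>\<gamma>)"
    by (intro arg_cong[where f="\<lambda>x. ennreal a * x"] nn_integral_cong) (simp add: indicator_def \<phi>_def)
  also have "\<dots> = (\<integral>\<^sup>+p. (\<phi> (fst p))\<^sup>2 \<partial>\<nu>)"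
    by (rule nn_integral_fst_nu[symmetric]) measurable
  also have "\<dots> = (\<integral>\<^sup>+p. (c (snd p))\<^sup>2 \<partial>\<nu>)"
    by (rule nn_integral_cong_AE) (use AE_R in eventually_elim, auto simp: \<phi>_eq)
  also have "\<dots> \<le> (\<integral>\<^sup>+h. (c h)\<^sup>2 \<partial>\<eta>)"
    by (rule nn_integral_snd_le) measurable
  finally have "ennreal a * (\<integral>\<^sup>+g. (\<phi> g)\<^sup>2 \<partial>\<gamma>) < \<infinity>"
    using c2 by (rule order.strict_trans1)
  then have \<phi>2: "(\<integral>\<^sup>+g. (\<phi> g)\<^sup>2 \<partial>\<gamma>) < \<infinity>"
    using a_pos by (auto simp: ennreal_mult_less_top)
  have "(\<integral>\<^sup>+h. (indicator (Range R) h * c h)\<^sup>2 \<partial>\<eta>) \<le> (\<integral>\<^sup>+h. (c h)\<^sup>2 \<partial>\<eta>)"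
    by (intro nn_integral_mono) (simp add: indicator_def)
  then have w2: "(\<integral>\<^sup>+h. (indicator (Range R) h * c h)\<^sup>2 \<partial>\<eta>) < \<infinity>"
    using c2 by (rule order.strict_trans1)
  have "compatible \<gamma> \<eta> R \<phi> (\<lambda>t. indicator (Range R) t * c t)"
    unfolding compatible_def
  proof (intro conjI allI impI)
    show "\<forall>(g, h)\<in>R. \<phi> g = indicator (Range R) h * c h"
      using \<phi>_eq by (auto simp: indicator_def)
    show "(\<lambda>t. indicator (Range R) t * c t) \<in> borel_measurable borel" by measurable
  qed (use \<phi>2 w2 c_fin \<phi>_meas in \<open>auto simp: \<phi>_def indicator_def\<close>)
  then show ?thesis using that by (simp add: c_def)
qed

text \<open>
  The test function is \<open>conv p C\<close>, where \<open>p\<close> is the positive part of the difference of the two averages;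
  moving the convolution to the other side gives \<open>\<integral> p\<^sup>2 = 0\<close>.
\<close>

lemma compatible_conv_le:
  assumes [measurable]: "f1 \<in> borel_measurable borel" "f2 \<in> borel_measurable borel"
    and fin: "(\<integral>\<^sup>+t. (f1 t)\<^sup>2 \<partial>\<eta>) < \<infinity>" "(\<integral>\<^sup>+t. (f2 t)\<^sup>2 \<partial>\<eta>) < \<infinity>"
    and inv: "\<And>d. d \<in> indef_rel R \<Longrightarrow> AE t in \<eta>. f1 (d + t) = f1 t"
      "\<And>d. d \<in> indef_rel R \<Longrightarrow> AE t in \<eta>. f2 (d + t) = f2 t"
    and supp: "AE t in \<eta>. t \<notin> Range R \<longrightarrow> f1 t = 0" "AE t in \<eta>. t \<notin> Range R \<longrightarrow> f2 t = 0"
    and eq: "\<And>\<phi> w. compatible \<gamma> \<eta> R \<phi> w \<Longrightarrow> (\<integral>\<^sup>+t. f1 t * w t \<partial>\<eta>) = (\<integral>\<^sup>+t. f2 t * w t \<partial>\<eta>)"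
    and C: "open C" "compact K" "C \<subseteq> K"
  shows "AE h in \<eta>. h \<in> Range R \<longrightarrow> H.conv f1 (uminus ` C) h \<le> H.conv f2 (uminus ` C) h"
proof -
  define A1 A2 where "A1 = H.conv f1 (uminus ` C)" and "A2 = H.conv f2 (uminus ` C)"
  define p where "p h = indicator (Range R) h * (A1 h - A2 h)" for h
  have C': "open (uminus ` C)" "compact (uminus ` K)" "uminus ` C \<subseteq> uminus ` K"
    using C by (auto intro!: H.open_uminus_image compact_continuous_image continuous_intros)
  have [measurable]: "A1 \<in> borel_measurable borel" "A2 \<in> borel_measurable borel"
    unfolding A1_def A2_def using H.conv_measurable[OF C'(1)] assms(1,2) by auto
  have p [measurable]: "p \<in> borel_measurable borel"
    unfolding p_def by measurable
  have A_fin: "(\<integral>\<^sup>+t. (A1 t)\<^sup>2 \<partial>\<eta>) < \<infinity>" "(\<integral>\<^sup>+t. (A2 t)\<^sup>2 \<partial>\<eta>) < \<infinity>"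
    unfolding A1_def A2_def using H.conv_square_finite[OF C'] assms(1,2) fin by auto
  have p_le: "p h \<le> A1 h" for h
    by (simp add: p_def indicator_def diff_le_self_ennreal)
  have "(\<integral>\<^sup>+h. (p h)\<^sup>2 \<partial>\<eta>) \<le> (\<integral>\<^sup>+h. (A1 h)\<^sup>2 \<partial>\<eta>)"
    by (intro nn_integral_mono power_mono p_le) simp
  then have p_fin: "(\<integral>\<^sup>+h. (p h)\<^sup>2 \<partial>\<eta>) < \<infinity>"
    using A_fin(1) by (rule order.strict_trans1)
  have p_inv: "p (d + h) = p h" if "d \<in> indef_rel R" for d h
    using H.conv_invariant[OF C'(1) assms(1) inv(1)[OF that]]
      H.conv_invariant[OF C'(1) assms(2) inv(2)[OF that]] Range_add_iff[OF indef_Range[OF that]]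
    by (simp add: p_def A1_def A2_def indicator_def)
  obtain \<phi> where comp: "compatible \<gamma> \<eta> R \<phi> (\<lambda>t. indicator (Range R) t * H.conv p C t)"
    using compatible_conv[OF C p _ p_fin] p_inv by auto
  \<comment> \<open>Cutting the test function to \<open>Range R\<close> does not change the
    integral, since \<open>f\<close> vanishes almost everywhere outside.\<close>
  have adj: "(\<integral>\<^sup>+t. f t * (indicator (Range R) t * H.conv p C t) \<partial>\<eta>) = (\<integral>\<^sup>+h. p h * H.conv f (uminus ` C) h \<partial>\<eta>)"
    if [measurable]: "f \<in> borel_measurable borel" and "AE t in \<eta>. t \<notin> Range R \<longrightarrow> f t = 0" for f
  proof -
    have "(\<integral>\<^sup>+t. f t * (indicator (Range R) t * H.conv p C t) \<partial>\<eta>) = (\<integral>\<^sup>+t. f t * H.conv p C t \<partial>\<eta>)"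
      by (rule nn_integral_cong_AE) (use that(2) in eventually_elim, auto simp: indicator_def)
    then show ?thesis
      using H.conv_adjoint[OF C(1) p that(1)] by simp
  qed
  \<comment> \<open>Subtraction in \<open>ennreal\<close> is truncated, so on \<open>Range R\<close>
    the function \<open>p\<close> is the positive part of \<open>A1 - A2\<close>, and
    \<open>p\<close> times this difference is the square of \<open>p\<close>. The term with
    \<open>A2\<close> stays on the left to avoid a second subtraction.\<close>
  have "(\<integral>\<^sup>+h. p h * A2 h + (p h)\<^sup>2 \<partial>\<eta>) = (\<integral>\<^sup>+h. p h * A1 h \<partial>\<eta>)"
  proof (rule nn_integral_cong)
    fix h
    show "p h * A2 h + (p h)\<^sup>2 = p h * A1 h"
    proof (cases "h \<in> Range R \<and> A2 h \<le> A1 h")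
      case True
      then have "A1 h = A2 h + p h"
        by (simp add: p_def add_diff_self_ennreal)
      then show ?thesis by (simp add: power2_eq_square distrib_left)
    next
      case False
      then have "A1 h - A2 h = 0" if "h \<in> Range R"
        using that by (intro diff_eq_0_ennreal) (auto simp: not_le intro: less_le_trans[OF _ top_greatest])
      then have "p h = 0"
        by (simp add: p_def indicator_def)
      then show ?thesis by simp
    qed
  qed
  also have "\<dots> = (\<integral>\<^sup>+h. p h * A2 h \<partial>\<eta>)"
    using eq[OF comp] adj[OF assms(1) supp(1)] adj[OF assms(2) supp(2)] by (simp add: A1_def A2_def)
  finally have sum: "(\<integral>\<^sup>+h. p h * A2 h \<partial>\<eta>) + (\<integral>\<^sup>+h. (p h)\<^sup>2 \<partial>\<eta>) = (\<integral>\<^sup>+h. p h * A2 h \<partial>\<eta>) + 0"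
    by (subst (asm) nn_integral_add) auto
  \<comment> \<open>The common summand can be cancelled because it is finite.\<close>
  have "(\<integral>\<^sup>+h. p h * A2 h \<partial>\<eta>)\<^sup>2 \<le> (\<integral>\<^sup>+h. (p h)\<^sup>2 \<partial>\<eta>) * (\<integral>\<^sup>+h. (A2 h)\<^sup>2 \<partial>\<eta>)"
    by (rule Cauchy_Schwarz_nn_integral) measurable
  also have "\<dots> < \<infinity>"
    using p_fin A_fin by (simp add: ennreal_mult_less_top)
  finally have "(\<integral>\<^sup>+h. p h * A2 h \<partial>\<eta>) \<noteq> top"
    by (simp add: power_less_top_ennreal less_top)
  then have "(\<integral>\<^sup>+h. (p h)\<^sup>2 \<partial>\<eta>) = 0"
    using sum by (subst (asm) ennreal_add_left_cancel) simp
  then have "AE h in \<eta>. (p h)\<^sup>2 = 0"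
    by (subst (asm) nn_integral_0_iff_AE) auto
  then show ?thesis
    unfolding A1_def[symmetric] A2_def[symmetric]
    by eventually_elim (auto simp: p_def indicator_def intro: ennreal_minus_eq_0 split: if_splits)
qed

text \<open>The null sets belonging to the countably many \<open>C\<close> in the basis cannot cover
  \<open>Range R\<close>. Hence all averages agree at a common point, and one point is enough by
  \<open>conv_eq_imp_AE_eq\<close>.\<close>

lemma compatible_separating:
  assumes meas: "f1 \<in> borel_measurable borel" "f2 \<in> borel_measurable borel"
    and fin: "(\<integral>\<^sup>+t. (f1 t)\<^sup>2 \<partial>\<eta>) < \<infinity>" "(\<integral>\<^sup>+t. (f2 t)\<^sup>2 \<partial>\<eta>) < \<infinity>"
    and inv: "\<And>d. d \<in> indef_rel R \<Longrightarrow> AE t in \<eta>. f1 (d + t) = f1 t"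
      "\<And>d. d \<in> indef_rel R \<Longrightarrow> AE t in \<eta>. f2 (d + t) = f2 t"
    and supp: "AE t in \<eta>. t \<notin> Range R \<longrightarrow> f1 t = 0" "AE t in \<eta>. t \<notin> Range R \<longrightarrow> f2 t = 0"
    and eq: "\<And>\<phi> w. compatible \<gamma> \<eta> R \<phi> w \<Longrightarrow> (\<integral>\<^sup>+t. f1 t * w t \<partial>\<eta>) = (\<integral>\<^sup>+t. f2 t * w t \<partial>\<eta>)"
  shows "AE t in \<eta>. f1 t = f2 t"
proof -
  obtain B :: "'h set set" where B: "countable B" "topological_basis B" "Int_stable B"
    "\<And>U. U \<in> B \<Longrightarrow> \<exists>K. compact K \<and> U \<subseteq> K"
    using lc_countable_basis[OF H.lc] by metis
  have "AE h in \<eta>. h \<in> Range R \<longrightarrow> H.conv f1 (uminus ` C) h = H.conv f2 (uminus ` C) h"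
    if C: "C \<in> B" for C
  proof -
    obtain K where K: "compact K" "C \<subseteq> K" using B(4)[OF C] by blast
    have op: "open C" by (rule topological_basis_open[OF B(2) C])
    have "AE h in \<eta>. h \<in> Range R \<longrightarrow> H.conv f1 (uminus ` C) h \<le> H.conv f2 (uminus ` C) h"
      by (rule compatible_conv_le[OF meas fin _ _ supp _ op K]) (erule inv | erule eq)+
    moreover have "AE h in \<eta>. h \<in> Range R \<longrightarrow> H.conv f2 (uminus ` C) h \<le> H.conv f1 (uminus ` C) h"
      by (rule compatible_conv_le[OF meas(2,1) fin(2,1) _ _ supp(2,1) _ op K])
        (erule inv | erule eq[symmetric])+
    ultimately show ?thesis by eventually_elim auto
  qed
  then have "AE h in \<eta>. \<forall>C\<in>B. h \<in> Range R \<longrightarrow> H.conv f1 (uminus ` C) h = H.conv f2 (uminus ` C) h"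
    by (subst AE_ball_countable[OF B(1)]) blast
  moreover have "\<exists>\<^sub>F h in ae_filter \<eta>. h \<in> Range R"
    using Range_nonnull by (simp add: frequently_def)
  ultimately have "\<exists>\<^sub>F h in ae_filter \<eta>. \<forall>C\<in>B. H.conv f1 (uminus ` C) h = H.conv f2 (uminus ` C) h"
    by (elim frequently_rev_mp) (auto elim: eventually_mono)
  then have "\<exists>h. \<forall>C\<in>B. H.conv f1 (uminus ` C) h = H.conv f2 (uminus ` C) h"
    by (rule frequently_ex)
  then obtain h where h: "\<And>C. C \<in> B \<Longrightarrow> H.conv f1 (uminus ` C) h = H.conv f2 (uminus ` C) h"
    by blast
  show ?thesis
    by (rule H.conv_eq_imp_AE_eq[OF meas fin(1) B(1-3)]) (erule B(4), erule h)
qed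

end

section \<open>The operator of a polyhomomorphism\<close>

text \<open>Translates of null sets are null, so a check on one representative passes to the whole
  class.\<close>

lemma (in unimodular_haar) L2_supp_invI:
  assumes f: "f \<in> square_integrable \<mu>" and supp: "AE x in \<mu>. x \<notin> \<Phi> \<longrightarrow> f x = 0"
    and inv: "\<And>d. d \<in> \<Delta> \<Longrightarrow> AE x in \<mu>. f (d + x) = f x"
  shows "l2_class \<mu> f \<in> L2_supp_inv \<mu> \<Phi> \<Delta>"
  unfolding L2_supp_inv_def
proof (intro CollectI conjI ballI)
  show "l2_class \<mu> f \<in> hcarrier (L2 \<mu>)"
    using f by (simp add: hcarrier_L2)
  fix f' assume "f' \<in> l2_class \<mu> f"
  then have eq: "AE x in \<mu>. f' x = f x" by (simp add: l2_class_def)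
  show "AE x in \<mu>. x \<notin> \<Phi> \<longrightarrow> f' x = 0"
    using eq supp by eventually_elim simp
  show "AE x in \<mu>. f' (d + x) = f' x" if "d \<in> \<Delta>" for d
    using eq inv[OF that] AE_left[OF eq, of d] by eventually_elim simp
qed

lemma L2_supp_invD:
  assumes "l2_class \<mu> f \<in> L2_supp_inv \<mu> \<Phi> \<Delta>" "f \<in> square_integrable \<mu>"
  shows "AE x in \<mu>. x \<notin> \<Phi> \<longrightarrow> f x = 0" "\<And>d. d \<in> \<Delta> \<Longrightarrow> AE x in \<mu>. f (d + x) = f x"
proof -
  have "f \<in> l2_class \<mu> f" using assms(2) by (simp add: l2_class_def)
  then show "AE x in \<mu>. x \<notin> \<Phi> \<longrightarrow> f x = 0" "\<And>d. d \<in> \<Delta> \<Longrightarrow> AE x in \<mu>. f (d + x) = f x"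
    using assms(1) by (auto simp: L2_supp_inv_def)
qed

section \<open>The weak equation of the operator and its solvability\<close>

context polyhom_marginals
begin

lemma measurable_gamma: "borel_measurable \<gamma> = borel_measurable borel"
  and measurable_eta: "borel_measurable \<eta> = borel_measurable borel"
  and measurable_nu: "borel_measurable \<nu> = borel_measurable borel"
  by (rule measurable_cong_sets; simp)+

lemma square_integrable_fst:
  assumes "\<phi> \<in> square_integrable \<gamma>"
  shows "(\<lambda>p. \<phi> (fst p)) \<in> square_integrable \<nu>"
proof -
  have [measurable]: "\<phi> \<in> borel_measurable borel"
    using square_integrable_measurable[OF assms] by (simp add: measurable_gamma)
  have "(\<integral>\<^sup>+p. ennreal ((cmod (\<phi> (fst p)))\<^sup>2) \<partial>\<nu>) \<le> (\<integral>\<^sup>+g. ennreal ((cmod (\<phi> g))\<^sup>2) \<partial>\<gamma>)"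
    by (rule nn_integral_fst_le) measurable
  also have "\<dots> < \<infinity>"
    using assms by (subst (asm) square_integrable_iff) auto
  finally show ?thesis
    by (subst square_integrable_iff) auto
qed

lemma square_integrable_snd:
  assumes "\<psi> \<in> square_integrable \<eta>"
  shows "(\<lambda>p. \<psi> (snd p)) \<in> square_integrable \<nu>"
proof -
  have [measurable]: "\<psi> \<in> borel_measurable borel"
    using square_integrable_measurable[OF assms] by (simp add: measurable_eta)
  have "(\<integral>\<^sup>+p. ennreal ((cmod (\<psi> (snd p)))\<^sup>2) \<partial>\<nu>) \<le> (\<integral>\<^sup>+h. ennreal ((cmod (\<psi> h))\<^sup>2) \<partial>\<eta>)"
    by (rule nn_integral_snd_le) measurable
  also have "\<dots> < \<infinity>"
    using assms by (subst (asm) square_integrable_iff) auto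
  finally show ?thesis
    by (subst square_integrable_iff) auto
qed

lemma integrable_fst_snd:
  assumes "\<phi> \<in> square_integrable \<gamma>" "\<psi> \<in> square_integrable \<eta>"
  shows "integrable \<nu> (\<lambda>p. \<phi> (fst p) * cnj (\<psi> (snd p)))"
  using square_integrable_mult[OF square_integrable_fst square_integrable_snd, OF assms(1)
      square_integrable_cnj[OF assms(2)]] .

lemma AE_fst_nu: "AE g in \<gamma>. P g \<Longrightarrow> AE p in \<nu>. P (fst p)"
proof -
  assume "AE g in \<gamma>. P g"
  then obtain N where N: "{g. \<not> P g} \<subseteq> N" "emeasure \<gamma> N = 0" "N \<in> sets borel"
    by (auto elim!: AE_E)
  have "N \<times> UNIV \<in> sets (borel :: ('g \<times> 'h) measure)"
    using N by (simp add: borel_prod[symmetric])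
  then show ?thesis
    using N nu_fst_le[OF N(3)] by (intro AE_I[of _ _ "N \<times> UNIV"]) auto
qed

lemma AE_snd_nu: "AE h in \<eta>. P h \<Longrightarrow> AE p in \<nu>. P (snd p)"
proof -
  assume "AE h in \<eta>. P h"
  then obtain N where N: "{h. \<not> P h} \<subseteq> N" "emeasure \<eta> N = 0" "N \<in> sets borel"
    by (auto elim!: AE_E)
  have "UNIV \<times> N \<in> sets (borel :: ('g \<times> 'h) measure)"
    using N by (simp add: borel_prod[symmetric])
  then show ?thesis
    using N nu_snd_le[OF N(3)] by (intro AE_I[of _ _ "UNIV \<times> N"]) auto
qed

text \<open>\<open>u\<close> represents the image of \<open>\<psi>\<close>. As a relation it can be
  shown to be linear before existence is known, so that nonnegative, real and complex functions are
  treated in turn.\<close>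

definition is_Pi :: "('h \<Rightarrow> complex) \<Rightarrow> ('g \<Rightarrow> complex) \<Rightarrow> bool" where
  "is_Pi \<psi> u \<longleftrightarrow> \<psi> \<in> square_integrable \<eta> \<and> u \<in> square_integrable \<gamma> \<and>
     (\<forall>\<phi>\<in>square_integrable \<gamma>.
        (LINT g|\<gamma>. \<phi> g * cnj (u g)) = (LINT p|\<nu>. \<phi> (fst p) * cnj (\<psi> (snd p))))"

lemma is_Pi_unique:
  assumes "is_Pi \<psi> u" "is_Pi \<psi>' u'" "AE h in \<eta>. \<psi> h = \<psi>' h"
  shows "AE g in \<gamma>. u g = u' g"
proof (rule square_integrable_AE_eq)
  fix \<phi> assume \<phi>: "\<phi> \<in> square_integrable \<gamma>"
  have i: "integrable \<nu> (\<lambda>p. \<phi> (fst p) * cnj (\<psi> (snd p)))"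
    "integrable \<nu> (\<lambda>p. \<phi> (fst p) * cnj (\<psi>' (snd p)))"
    using \<phi> assms integrable_fst_snd by (auto simp: is_Pi_def)
  have "(LINT p|\<nu>. \<phi> (fst p) * cnj (\<psi> (snd p))) = (LINT p|\<nu>. \<phi> (fst p) * cnj (\<psi>' (snd p)))"
    by (rule integral_cong_AE)
      (use i AE_snd_nu[OF assms(3)] in \<open>auto elim: eventually_mono\<close>)
  then show "(LINT g|\<gamma>. \<phi> g * cnj (u g)) = (LINT g|\<gamma>. \<phi> g * cnj (u' g))"
    using assms(1,2) \<phi> by (simp add: is_Pi_def)
qed (use assms in \<open>auto simp: is_Pi_def\<close>)

lemma is_Pi_add:
  assumes "is_Pi \<psi> u" "is_Pi \<psi>' u'"
  shows "is_Pi (\<lambda>h. \<psi> h + \<psi>' h) (\<lambda>g. u g + u' g)"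
  unfolding is_Pi_def
proof (intro conjI ballI)
  fix \<phi> assume \<phi>: "\<phi> \<in> square_integrable \<gamma>"
  have sq: "\<psi> \<in> square_integrable \<eta>" "\<psi>' \<in> square_integrable \<eta>"
    "u \<in> square_integrable \<gamma>" "u' \<in> square_integrable \<gamma>"
    using assms by (auto simp: is_Pi_def)
  have "(LINT g|\<gamma>. \<phi> g * cnj (u g + u' g)) = (LINT g|\<gamma>. \<phi> g * cnj (u g)) + (LINT g|\<gamma>. \<phi> g * cnj (u' g))"
    using \<phi> sq square_integrable_mult[OF \<phi> square_integrable_cnj] by (simp add: distrib_left)
  also have "\<dots> = (LINT p|\<nu>. \<phi> (fst p) * cnj (\<psi> (snd p))) + (LINT p|\<nu>. \<phi> (fst p) * cnj (\<psi>' (snd p)))"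
    using assms \<phi> by (simp add: is_Pi_def)
  also have "\<dots> = (LINT p|\<nu>. \<phi> (fst p) * cnj (\<psi> (snd p) + \<psi>' (snd p)))"
    using integrable_fst_snd[OF \<phi>] sq by (simp add: distrib_left)
  finally show "(LINT g|\<gamma>. \<phi> g * cnj (u g + u' g))
      = (LINT p|\<nu>. \<phi> (fst p) * cnj (\<psi> (snd p) + \<psi>' (snd p)))" .
qed (use assms in \<open>auto simp: is_Pi_def square_integrable_add\<close>)

lemma is_Pi_scale:
  assumes "is_Pi \<psi> u"
  shows "is_Pi (\<lambda>h. c * \<psi> h) (\<lambda>g. c * u g)"
  using assms by (auto simp: is_Pi_def square_integrable_scale mult.left_commute[of _ "cnj c"])

text \<open>Radon-Nikodym turns the image in \<open>G\<close> of the measure with density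
  \<open>f (snd p)\<close> into a density \<open>v\<close>. For its square integrability
  \<open>v\<close> is tested against its own truncations: if \<open>X\<close> is the square integral
  of \<open>w n\<close>, Cauchy-Schwarz on \<open>R\<close> and the two marginal bounds give
  \<open>X^2 <= S X\<close>, hence \<open>X <= S\<close>. Monotone convergence carries the bound
  over to \<open>v\<close>.\<close>

lemma is_Pi_real:
  fixes f :: "'h \<Rightarrow> real"
  assumes f [measurable]: "f \<in> borel_measurable borel" and nonneg: "\<And>h. 0 \<le> f h"
    and fin: "(\<integral>\<^sup>+h. (ennreal (f h))\<^sup>2 \<partial>\<eta>) < \<infinity>"
  obtains u where "is_Pi (\<lambda>h. complex_of_real (f h)) u"
proof -
  define S where "S = (\<integral>\<^sup>+h. (ennreal (f h))\<^sup>2 \<partial>\<eta>)"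
  define M where "M = distr (density \<nu> (\<lambda>p. ennreal (f (snd p)))) borel fst"
  have "absolutely_continuous \<gamma> M"
    unfolding absolutely_continuous_def
  proof
    fix A assume "A \<in> null_sets \<gamma>"
    then have A [measurable]: "A \<in> sets borel" and "emeasure \<gamma> A = 0"
      by (auto simp: null_sets_def)
    then have "AE g in \<gamma>. g \<notin> A"
      by (subst AE_iff_measurable[of A]) auto
    then have "AE p in \<nu>. fst p \<notin> A" by (rule AE_fst_nu)
    then have "AE p in density \<nu> (\<lambda>p. ennreal (f (snd p))). fst p \<notin> A"
      by (subst AE_density) auto
    then have "AE g in M. g \<notin> A"
      unfolding M_def by (subst AE_distr_iff) auto
    then show "A \<in> null_sets M"
      by (subst (asm) AE_iff_measurable[of A]) (auto simp: M_def null_sets_def)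
  qed
  then obtain v where v [measurable]: "v \<in> borel_measurable borel" and vM: "density \<gamma> v = M"
    using G.Radon_Nikodym[of M] by (auto simp: measurable_gamma M_def)
  have key: "(\<integral>\<^sup>+g. v g * \<phi> g \<partial>\<gamma>) = (\<integral>\<^sup>+p. ennreal (f (snd p)) * \<phi> (fst p) \<partial>\<nu>)"
    if [measurable]: "\<phi> \<in> borel_measurable borel" for \<phi>
  proof -
    have "(\<integral>\<^sup>+g. v g * \<phi> g \<partial>\<gamma>) = (\<integral>\<^sup>+g. \<phi> g \<partial>M)"
      unfolding vM[symmetric] by (subst nn_integral_density) auto
    also have "\<dots> = (\<integral>\<^sup>+p. ennreal (f (snd p)) * \<phi> (fst p) \<partial>\<nu>)"
      unfolding M_def by (simp add: nn_integral_distr nn_integral_density)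
    finally show ?thesis .
  qed
  obtain F :: "nat \<Rightarrow> 'g set" where F: "range F \<subseteq> sets \<gamma>" "(\<Union>i. F i) = space \<gamma>"
    "\<And>i. emeasure \<gamma> (F i) \<noteq> \<infinity>" "incseq F"
    using G.sigma_finite_incseq by blast
  have F_meas [measurable]: "F n \<in> sets borel" for n
    using F(1) by auto
  text \<open>The truncations make \<open>\<integral> w\<^sup>2\<close> finite, so that it can be cancelled in \<open>(\<integral> w\<^sup>2)\<^sup>2 \<le> S \<integral> w\<^sup>2\<close>.\<close>
  define w where "w n g = min (v g) (of_nat n) * indicator (F n) g" for n g
  have w_meas [measurable]: "w n \<in> borel_measurable borel" for n
    unfolding w_def by measurable
  have w_bound: "(\<integral>\<^sup>+g. (w n g)\<^sup>2 \<partial>\<gamma>) \<le> S" for n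
  proof -
    define X where "X = (\<integral>\<^sup>+g. (w n g)\<^sup>2 \<partial>\<gamma>)"
    have "X \<le> (\<integral>\<^sup>+g. (of_nat n)\<^sup>2 * indicator (F n) g \<partial>\<gamma>)"
      unfolding X_def by (intro nn_integral_mono) (auto simp: w_def indicator_def intro!: power_mono)
    also have "\<dots> = (of_nat n)\<^sup>2 * emeasure \<gamma> (F n)"
      by (simp add: nn_integral_cmult_indicator)
    also have "\<dots> < \<infinity>"
      using F(3)[of n] by (simp add: ennreal_mult_less_top less_top power_less_top_ennreal of_nat_less_top)
    finally have X: "X < \<infinity>" .
    have "X \<le> (\<integral>\<^sup>+g. v g * w n g \<partial>\<gamma>)"
      unfolding X_def power2_eq_square
      by (intro nn_integral_mono mult_right_mono) (auto simp: w_def indicator_def)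
    also have "\<dots> = (\<integral>\<^sup>+p. ennreal (f (snd p)) * w n (fst p) \<partial>\<nu>)"
      by (rule key) measurable
    finally have "X\<^sup>2 \<le> (\<integral>\<^sup>+p. ennreal (f (snd p)) * w n (fst p) \<partial>\<nu>)\<^sup>2"
      by (rule power_mono) simp
    also have "\<dots> \<le> (\<integral>\<^sup>+p. (ennreal (f (snd p)))\<^sup>2 \<partial>\<nu>) * (\<integral>\<^sup>+p. (w n (fst p))\<^sup>2 \<partial>\<nu>)"
      by (rule Cauchy_Schwarz_nn_integral) measurable
    also have "\<dots> \<le> S * X"
      unfolding S_def X_def by (intro mult_mono nn_integral_snd_le nn_integral_fst_le) auto
    finally have "X * X \<le> X * S"
      by (simp add: power2_eq_square mult.commute)
    then have "X \<le> S"
      using X by (cases "X = 0") (auto simp: ennreal_mult_le_mult_iff)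
    then show ?thesis by (simp add: X_def)
  qed
  have w_inc: "incseq (\<lambda>n g. (w n g)\<^sup>2)"
  proof (intro incseq_SucI le_funI power_mono)
    fix n g
    have "F n \<subseteq> F (Suc n)" using F(4) by (rule incseq_SucD)
    then have "indicator (F n) g \<le> (indicator (F (Suc n)) g :: ennreal)"
      by (auto simp: indicator_def)
    then show "w n g \<le> w (Suc n) g"
      unfolding w_def by (intro mult_mono min.mono) (auto intro: of_nat_mono)
  qed simp
  \<comment> \<open>Once \<open>g\<close> lies in \<open>F n\<close>, the truncations at
    \<open>g\<close> equal \<open>n\<close> if \<open>v g\<close> is infinite, and otherwise equal
    \<open>v g\<close> from some \<open>n\<close> on.\<close>
  have v_le: "(v g)\<^sup>2 \<le> (SUP n. (w n g)\<^sup>2)" for g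
  proof -
    have "g \<in> (\<Union>i. F i)" using F(2) by simp
    then obtain m where m: "g \<in> F m" by blast
    have Fn: "g \<in> F n" if "m \<le> n" for n
      using F(4) m that by (auto simp: incseq_def)
    show ?thesis
    proof (cases "v g")
      case top
      have "(SUP n. (w n g)\<^sup>2) = top"
      proof (rule ennreal_SUP_eq_top)
        fix n :: nat
        have "(of_nat n :: ennreal) \<le> of_nat ((max m (max 1 n))\<^sup>2)"
          unfolding power2_eq_square by (intro of_nat_mono order.trans[OF _ le_square]) simp
        also have "\<dots> = (w (max m (max 1 n)) g)\<^sup>2"
          using Fn[of "max m (max 1 n)"] by (simp add: w_def top)
        finally show "\<exists>i\<in>UNIV. of_nat n \<le> (w i g)\<^sup>2" by blast
      qed
      then show ?thesis by (simp only: top_greatest)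
    next
      case (real r)
      obtain n :: nat where "r \<le> real n" using real_arch_simple by blast
      then have "v g \<le> of_nat (max m n)"
        using real by (simp add: ennreal_of_nat_eq_real_of_nat ennreal_leI)
      then have "w (max m n) g = v g"
        using Fn[of "max m n"] by (simp add: w_def min_def)
      then show ?thesis
        by (metis SUP_upper UNIV_I)
    qed
  qed
  have "(\<integral>\<^sup>+g. (v g)\<^sup>2 \<partial>\<gamma>) \<le> (\<integral>\<^sup>+g. (SUP n. (w n g)\<^sup>2) \<partial>\<gamma>)"
    by (intro nn_integral_mono v_le)
  also have "\<dots> = (SUP n. (\<integral>\<^sup>+g. (w n g)\<^sup>2 \<partial>\<gamma>))"
    by (rule nn_integral_monotone_convergence_SUP[OF w_inc]) measurable
  also have "\<dots> \<le> S"
    by (intro SUP_least w_bound)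
  finally have v_fin: "(\<integral>\<^sup>+g. (v g)\<^sup>2 \<partial>\<gamma>) < \<infinity>"
    using fin by (simp add: S_def order.strict_trans1)
  then have "AE g in \<gamma>. (v g)\<^sup>2 \<noteq> \<infinity>"
    by (intro nn_integral_PInf_AE) auto
  then have v_real: "AE g in \<gamma>. v g = ennreal (enn2real (v g))"
    by eventually_elim (auto simp: less_top power_less_top_ennreal)
  define u where "u g = enn2real (v g)" for g
  have u_meas [measurable]: "u \<in> borel_measurable borel" and u_nonneg: "0 \<le> u g" for g
    unfolding u_def by auto
  have uM: "density \<gamma> (\<lambda>g. ennreal (u g)) = M"
    unfolding vM[symmetric] by (rule density_cong) (use v_real in \<open>auto simp: u_def elim: eventually_mono\<close>)
  have "(\<integral>\<^sup>+g. ennreal ((cmod (complex_of_real (u g)))\<^sup>2) \<partial>\<gamma>) = (\<integral>\<^sup>+g. (v g)\<^sup>2 \<partial>\<gamma>)"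
    by (rule nn_integral_cong_AE)
      (use v_real in eventually_elim, metis u_def u_nonneg abs_of_nonneg ennreal_power norm_of_real)
  then have u_sq: "(\<lambda>g. complex_of_real (u g)) \<in> square_integrable \<gamma>"
    using v_fin by (subst square_integrable_iff) auto
  have f_sq: "(\<lambda>h. complex_of_real (f h)) \<in> square_integrable \<eta>"
    using fin by (subst square_integrable_iff) (auto simp: ennreal_power nonneg)
  have "(LINT g|\<gamma>. \<phi> g * cnj (complex_of_real (u g)))
      = (LINT p|\<nu>. \<phi> (fst p) * cnj (complex_of_real (f (snd p))))" if "\<phi> \<in> square_integrable \<gamma>" for \<phi>
  proof -
    have [measurable]: "\<phi> \<in> borel_measurable borel"
      using square_integrable_measurable[OF that] by (simp add: measurable_gamma)
    have "(LINT g|\<gamma>. \<phi> g * cnj (complex_of_real (u g))) = (LINT g|\<gamma>. u g *\<^sub>R \<phi> g)"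
      by (simp add: scaleR_conv_of_real mult.commute)
    also have "\<dots> = (LINT g|density \<gamma> (\<lambda>g. ennreal (u g)). \<phi> g)"
      using u_nonneg by (subst integral_density) auto
    also have "\<dots> = (LINT p|density \<nu> (\<lambda>p. ennreal (f (snd p))). \<phi> (fst p))"
      unfolding uM M_def by (subst integral_distr) auto
    also have "\<dots> = (LINT p|\<nu>. f (snd p) *\<^sub>R \<phi> (fst p))"
      using nonneg by (subst integral_density) auto
    finally show ?thesis
      by (simp add: scaleR_conv_of_real mult.commute)
  qed
  then show ?thesis
    using that[of "\<lambda>g. complex_of_real (u g)"] u_sq f_sq by (auto simp: is_Pi_def)
qed

lemma is_Pi_real_signed:
  fixes f :: "'h \<Rightarrow> real"
  assumes [measurable]: "f \<in> borel_measurable borel"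
    and fin: "(\<integral>\<^sup>+h. ennreal ((f h)\<^sup>2) \<partial>\<eta>) < \<infinity>"
  obtains u where "is_Pi (\<lambda>h. complex_of_real (f h)) u"
proof -
  have "(\<integral>\<^sup>+h. (ennreal (max 0 (c * f h)))\<^sup>2 \<partial>\<eta>) < \<infinity>" if "c = 1 \<or> c = -1" for c
  proof -
    have "(max 0 (c * x))\<^sup>2 \<le> x\<^sup>2" for x :: real
      using that by (auto simp: max_def)
    then have "(\<integral>\<^sup>+h. (ennreal (max 0 (c * f h)))\<^sup>2 \<partial>\<eta>) \<le> (\<integral>\<^sup>+h. ennreal ((f h)\<^sup>2) \<partial>\<eta>)"
      by (intro nn_integral_mono) (simp add: ennreal_power ennreal_leI)
    then show ?thesis using fin by (rule order.strict_trans1)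
  qed
  note fin' = this
  obtain u1 where u1: "is_Pi (\<lambda>h. complex_of_real (max 0 (1 * f h))) u1"
    by (rule is_Pi_real[of "\<lambda>h. max 0 (1 * f h)"]) (use fin'[of 1] in auto)
  obtain u2 where u2: "is_Pi (\<lambda>h. complex_of_real (max 0 (-1 * f h))) u2"
    by (rule is_Pi_real[of "\<lambda>h. max 0 (-1 * f h)"]) (use fin'[of "-1"] in auto)
  from u1 u2 have "is_Pi (\<lambda>h. complex_of_real (max 0 (1 * f h)) + (- 1) * complex_of_real (max 0 (-1 * f h)))
      (\<lambda>g. u1 g + (-1) * u2 g)"
    by (intro is_Pi_add is_Pi_scale)
  moreover have "complex_of_real (max 0 (1 * f h)) + (- 1) * complex_of_real (max 0 (-1 * f h))
      = complex_of_real (f h)" for h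
    by (auto simp: max_def)
  ultimately show ?thesis using that by simp
qed

lemma is_Pi_exists:
  assumes \<psi>: "\<psi> \<in> square_integrable \<eta>"
  obtains u where "is_Pi \<psi> u"
proof -
  have [measurable]: "\<psi> \<in> borel_measurable borel"
    using square_integrable_measurable[OF \<psi>] by (simp add: measurable_eta)
  have fin: "(\<integral>\<^sup>+h. ennreal ((cmod (\<psi> h))\<^sup>2) \<partial>\<eta>) < \<infinity>"
    using \<psi> by (subst (asm) square_integrable_iff) auto
  have "(\<integral>\<^sup>+h. ennreal ((Re (\<psi> h))\<^sup>2) \<partial>\<eta>) < \<infinity>" "(\<integral>\<^sup>+h. ennreal ((Im (\<psi> h))\<^sup>2) \<partial>\<eta>) < \<infinity>"
    by (rule order.strict_trans1[OF _ fin], intro nn_integral_mono ennreal_leI, simp add: cmod_power2)+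
  note fin' = this
  obtain u1 where u1: "is_Pi (\<lambda>h. complex_of_real (Re (\<psi> h))) u1"
    by (rule is_Pi_real_signed[of "\<lambda>h. Re (\<psi> h)"]) (use fin' in auto)
  obtain u2 where u2: "is_Pi (\<lambda>h. complex_of_real (Im (\<psi> h))) u2"
    by (rule is_Pi_real_signed[of "\<lambda>h. Im (\<psi> h)"]) (use fin' in auto)
  from u1 u2 have "is_Pi (\<lambda>h. complex_of_real (Re (\<psi> h)) + \<i> * complex_of_real (Im (\<psi> h)))
      (\<lambda>g. u1 g + \<i> * u2 g)"
    by (intro is_Pi_add is_Pi_scale)
  then show ?thesis
    using that by (simp add: complex_eq[symmetric])
qed

end

text \<open>\<open>ennreal\<close> sends negative numbers to 0, so the two sides are the positive
  and the negative part of \<open>x\<close>, at most one of which is nonzero.\<close>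

lemma ennreal_eq_uminus: "ennreal x = ennreal (- x) \<Longrightarrow> x = 0"
  by (cases "0 \<le> x") (auto simp: ennreal_neg ennreal_eq_0_iff)

context unimodular_haar
begin

lemma integral_left:
  fixes f :: "'a \<Rightarrow> complex"
  assumes "f \<in> borel_measurable borel"
  shows "(LINT y|\<mu>. f (x + y)) = (LINT y|\<mu>. f y)"
  using integral_distr[of "\<lambda>y. x + y" \<mu> borel f] assms by (simp add: distr_left)

lemma square_integrable_left:
  assumes "f \<in> square_integrable \<mu>"
  shows "(\<lambda>y. f (x + y)) \<in> square_integrable \<mu>"
proof -
  have meas: "borel_measurable \<mu> = borel_measurable borel"
    by (rule measurable_cong_sets) simp_all
  have [measurable]: "f \<in> borel_measurable borel"
    using square_integrable_measurable[OF assms] by (simp add: meas)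
  have "(\<integral>\<^sup>+y. ennreal ((cmod (f (x + y)))\<^sup>2) \<partial>\<mu>) = (\<integral>\<^sup>+y. ennreal ((cmod (f y))\<^sup>2) \<partial>\<mu>)"
    by (rule nn_integral_left[of "\<lambda>y. ennreal ((cmod (f y))\<^sup>2)"]) measurable
  then show ?thesis
    using assms by (simp add: square_integrable_iff meas)
qed

end

section \<open>Support and invariance of the image, and composition with the adjoint\<close>

context polyhom_marginals
begin

lemma square_integrable_borel_fst: "\<phi> \<in> square_integrable \<gamma> \<Longrightarrow> \<phi> \<in> borel_measurable borel"
  using square_integrable_measurable[of \<phi> \<gamma>] by (simp add: measurable_gamma)

lemma square_integrable_borel_snd: "\<psi> \<in> square_integrable \<eta> \<Longrightarrow> \<psi> \<in> borel_measurable borel"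
  using square_integrable_measurable[of \<psi> \<eta>] by (simp add: measurable_eta)

lemmas square_integrable_borel = square_integrable_borel_fst square_integrable_borel_snd

text \<open>Test functions supported off \<open>Domain R\<close> pull back to zero on
  \<open>R\<close>, so they pair to zero with \<open>u\<close>.\<close>

lemma is_Pi_support:
  assumes "is_Pi \<psi> u"
  shows "AE g in \<gamma>. g \<notin> Domain R \<longrightarrow> u g = 0"
proof -
  have u: "u \<in> square_integrable \<gamma>" and [measurable]: "u \<in> borel_measurable borel"
    using assms square_integrable_borel by (auto simp: is_Pi_def)
  have cut: "(\<lambda>g. indicator (- Domain R) g * \<theta> g) \<in> square_integrable \<gamma>"
    if \<theta>: "\<theta> \<in> square_integrable \<gamma>" for \<theta>
  proof -
    have [measurable]: "\<theta> \<in> borel_measurable borel" by (rule square_integrable_borel_fst[OF \<theta>])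
    have "(\<integral>\<^sup>+g. ennreal ((cmod (indicator (- Domain R) g * \<theta> g))\<^sup>2) \<partial>\<gamma>)
        \<le> (\<integral>\<^sup>+g. ennreal ((cmod (\<theta> g))\<^sup>2) \<partial>\<gamma>)"
      by (intro nn_integral_mono) (simp add: indicator_def)
    then show ?thesis
      using \<theta> by (simp add: square_integrable_iff measurable_gamma order.strict_trans1)
  qed
  have "AE g in \<gamma>. indicator (- Domain R) g * u g = 0"
  proof (rule square_integrable_AE_eq[OF cut[OF u] zero_square_integrable])
    fix \<theta> assume \<theta>: "\<theta> \<in> square_integrable \<gamma>"
    have "(LINT g|\<gamma>. \<theta> g * cnj (indicator (- Domain R) g * u g))
        = (LINT g|\<gamma>. indicator (- Domain R) g * \<theta> g * cnj (u g))"
      by (intro Bochner_Integration.integral_cong) (auto simp: indicator_def)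
    also have "\<dots> = (LINT p|\<nu>. indicator (- Domain R) (fst p) * \<theta> (fst p) * cnj (\<psi> (snd p)))"
      using assms cut[OF \<theta>] by (simp add: is_Pi_def)
    also have "\<dots> = 0"
      by (rule integral_eq_zero_AE) (use AE_R in \<open>eventually_elim, force simp: indicator_def\<close>)
    finally show "(LINT g|\<gamma>. \<theta> g * cnj (indicator (- Domain R) g * u g)) = (LINT g|\<gamma>. \<theta> g * cnj 0)"
      by simp
  qed
  then show ?thesis
    by eventually_elim (auto simp: indicator_def split: if_splits)
qed

text \<open>The pair \<open>(k, 0)\<close> lies in \<open>R\<close>, and translating
  \<open>\<nu>\<close> by it moves the argument of the test function but not that of
  \<open>\<psi>\<close>.\<close>

lemma is_Pi_invariant:
  assumes "is_Pi \<psi> u" and k: "k \<in> ker_rel R"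
  shows "AE g in \<gamma>. u (k + g) = u g"
proof (rule square_integrable_AE_eq)
  show u: "u \<in> square_integrable \<gamma>"
    using assms by (simp add: is_Pi_def)
  then show "(\<lambda>g. u (k + g)) \<in> square_integrable \<gamma>"
    by (rule G.square_integrable_left)
  fix \<theta> assume \<theta>: "\<theta> \<in> square_integrable \<gamma>"
  have [measurable]: "u \<in> borel_measurable borel" "\<theta> \<in> borel_measurable borel" "\<psi> \<in> borel_measurable borel"
    using assms \<theta> square_integrable_borel by (auto simp: is_Pi_def)
  have R: "(k, 0) \<in> R" using k by (simp add: ker_rel_def)
  have shift [measurable]: "(\<lambda>p. (k + fst p, 0 + snd p)) \<in> \<nu> \<rightarrow>\<^sub>M borel"
    unfolding measurable_nu by (intro borel_measurable_continuous_onI continuous_intros)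
  have "(LINT g|\<gamma>. \<theta> g * cnj (u (k + g))) = (LINT g|\<gamma>. \<theta> (- k + (k + g)) * cnj (u (k + g)))"
    by (simp add: add.assoc[symmetric])
  also have "\<dots> = (LINT g|\<gamma>. \<theta> (- k + g) * cnj (u g))"
    by (rule G.integral_left) measurable
  also have "\<dots> = (LINT p|\<nu>. \<theta> (- k + fst p) * cnj (\<psi> (snd p)))"
    using assms(1) G.square_integrable_left[OF \<theta>] by (simp add: is_Pi_def)
  also have "\<dots> = (LINT p|distr \<nu> borel (\<lambda>p. (k + fst p, 0 + snd p)). \<theta> (- k + fst p) * cnj (\<psi> (snd p)))"
    using nu_left[OF R] by simp
  also have "\<dots> = (LINT p|\<nu>. \<theta> (fst p) * cnj (\<psi> (snd p)))"
    by (subst integral_distr[OF shift]) (simp_all add: add.assoc[symmetric])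
  also have "\<dots> = (LINT g|\<gamma>. \<theta> g * cnj (u g))"
    using assms(1) \<theta> by (simp add: is_Pi_def)
  finally show "(LINT g|\<gamma>. \<theta> g * cnj (u (k + g))) = (LINT g|\<gamma>. \<theta> g * cnj (u g))" .
qed

text \<open>For a real function \<open>r\<close>, orthogonality to \<open>w\<close> means that the
  positive and the negative part of \<open>r\<close> have equal integrals against \<open>w\<close>,
  as \<open>compatible_separating\<close> requires. The factors \<open>c = 1\<close> and
  \<open>c = \<i>\<close> reduce the complex case to two real ones.\<close>

lemma L2_supp_inv_separating:
  assumes f: "f \<in> square_integrable \<eta>" and supp: "AE h in \<eta>. h \<notin> Range R \<longrightarrow> f h = 0"
    and inv: "\<And>d. d \<in> indef_rel R \<Longrightarrow> AE h in \<eta>. f (d + h) = f h"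
    and orth: "\<And>\<phi> w. compatible \<gamma> \<eta> R \<phi> w \<Longrightarrow>
      (LINT h|\<eta>. complex_of_real (enn2real (w h)) * cnj (f h)) = 0"
  shows "AE h in \<eta>. f h = 0"
proof -
  have [measurable]: "f \<in> borel_measurable borel"
    by (rule square_integrable_borel_snd[OF f])
  have real_part: "AE h in \<eta>. Re (c * f h) = 0" if c: "c = 1 \<or> c = \<i>" for c
  proof -
    define r where "r h = Re (c * f h)" for h
    have [measurable]: "r \<in> borel_measurable borel" unfolding r_def by measurable
    have bound: "(s * r h)\<^sup>2 \<le> (cmod (f h))\<^sup>2" if "s = 1 \<or> s = -1" for s h
      using c that by (auto simp: r_def cmod_power2)
    have fin: "(\<integral>\<^sup>+h. (ennreal (s * r h))\<^sup>2 \<partial>\<eta>) < \<infinity>" if s: "s = 1 \<or> s = -1" for s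
    proof -
      have "(ennreal (s * r h))\<^sup>2 \<le> ennreal ((cmod (f h))\<^sup>2)" for h
      proof (cases "0 \<le> s * r h")
        case True
        then show ?thesis using bound[OF s, of h] by (simp add: ennreal_power ennreal_leI)
      next
        case False
        then show ?thesis by (simp add: ennreal_neg)
      qed
      then have "(\<integral>\<^sup>+h. (ennreal (s * r h))\<^sup>2 \<partial>\<eta>) \<le> (\<integral>\<^sup>+h. ennreal ((cmod (f h))\<^sup>2) \<partial>\<eta>)"
        by (intro nn_integral_mono)
      also have "\<dots> < \<infinity>"
        using f by (subst (asm) square_integrable_iff) (auto simp: measurable_eta)
      finally show ?thesis .
    qed
    have "AE h in \<eta>. ennreal (1 * r h) = ennreal (-1 * r h)"
    proof (rule compatible_separating)
      show "(\<integral>\<^sup>+h. (ennreal (1 * r h))\<^sup>2 \<partial>\<eta>) < \<infinity>" "(\<integral>\<^sup>+h. (ennreal (-1 * r h))\<^sup>2 \<partial>\<eta>) < \<infinity>"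
        using fin[of 1] fin[of "-1"] by auto
      show "AE h in \<eta>. ennreal (1 * r (d + h)) = ennreal (1 * r h)"
        "AE h in \<eta>. ennreal (-1 * r (d + h)) = ennreal (-1 * r h)" if "d \<in> indef_rel R" for d
        using inv[OF that] by (eventually_elim, simp add: r_def)+
      show "AE h in \<eta>. h \<notin> Range R \<longrightarrow> ennreal (1 * r h) = 0"
        "AE h in \<eta>. h \<notin> Range R \<longrightarrow> ennreal (-1 * r h) = 0"
        using supp by (eventually_elim, simp add: r_def)+
      fix \<phi> w assume comp: "compatible \<gamma> \<eta> R \<phi> w"
      define W where "W h = enn2real (w h)" for h
      have W_nonneg: "0 \<le> W h" for h by (simp add: W_def)
      have w: "w h = ennreal (W h)" for h
        using comp by (simp add: compatible_def W_def)
      have [measurable]: "w \<in> borel_measurable borel" "W \<in> borel_measurable borel"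
        unfolding W_def using comp by (auto simp: compatible_def)
      have "(\<integral>\<^sup>+h. ennreal ((W h)\<^sup>2) \<partial>\<eta>) < \<infinity>"
        using comp by (simp add: compatible_def w ennreal_power W_nonneg)
      then have W_sq: "(\<lambda>h. complex_of_real (W h)) \<in> square_integrable \<eta>"
        by (subst square_integrable_iff) auto
      have int: "integrable \<eta> (\<lambda>h. complex_of_real (W h) * cnj (f h))"
        by (rule square_integrable_mult[OF W_sq square_integrable_cnj[OF f]])
      \<comment> \<open>With the factor \<open>cnj c\<close> the integrand has real part
        \<open>r h * W h\<close>, as conjugation does not change the real part of
        \<open>c * f h\<close>.\<close>
      have "(LINT h|\<eta>. cnj c * (complex_of_real (W h) * cnj (f h))) = 0"
        using orth[OF comp] by (simp add: W_def)
      then have "Re (LINT h|\<eta>. cnj c * (complex_of_real (W h) * cnj (f h))) = 0"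
        by (simp only: zero_complex.sel)
      moreover have int': "integrable \<eta> (\<lambda>h. cnj c * (complex_of_real (W h) * cnj (f h)))"
        using int by (rule integrable_mult_right)
      moreover have Re_eq: "Re (cnj c * (complex_of_real (W h) * cnj (f h))) = r h * W h" for h
        by (simp add: r_def algebra_simps)
      ultimately have zero: "(LINT h|\<eta>. r h * W h) = 0"
        using integral_Re[OF int'] by simp
      have int_r: "integrable \<eta> (\<lambda>h. r h * W h)"
        using integrable_Re[OF int'] by (simp only: Re_eq)
      \<comment> \<open>The real integral is the difference of these two values. Both are finite, so
        their equality lifts to \<open>ennreal\<close>.\<close>
      have "enn2real (\<integral>\<^sup>+h. ennreal (r h * W h) \<partial>\<eta>) = enn2real (\<integral>\<^sup>+h. ennreal (- (r h * W h)) \<partial>\<eta>)"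
        using zero real_lebesgue_integral_def[OF int_r] by simp
      moreover have "(\<integral>\<^sup>+h. ennreal (r h * W h) \<partial>\<eta>) < top" "(\<integral>\<^sup>+h. ennreal (- (r h * W h)) \<partial>\<eta>) < top"
        using int_r by (simp_all add: real_integrable_def less_top)
      ultimately have "(\<integral>\<^sup>+h. ennreal (r h * W h) \<partial>\<eta>) = (\<integral>\<^sup>+h. ennreal (- (r h * W h)) \<partial>\<eta>)"
        by (metis ennreal_enn2real)
      moreover have "ennreal (r h) * w h = ennreal (r h * W h)"
        "ennreal (- r h) * w h = ennreal (- (r h * W h))" for h
        unfolding w by (simp_all add: ennreal_mult''[symmetric] W_nonneg)
      ultimately show "(\<integral>\<^sup>+h. ennreal (1 * r h) * w h \<partial>\<eta>) = (\<integral>\<^sup>+h. ennreal (-1 * r h) * w h \<partial>\<eta>)"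
        by simp
    qed (auto simp: r_def)
    then show ?thesis
      unfolding r_def[symmetric] by eventually_elim (use ennreal_eq_uminus in simp)
  qed
  have "AE h in \<eta>. Re (1 * f h) = 0" "AE h in \<eta>. Re (\<i> * f h) = 0"
    using real_part by blast+
  then show ?thesis
    by eventually_elim (auto simp: complex_eq_iff)
qed

lemma integral_swap:
  fixes F :: "'h \<times> 'g \<Rightarrow> complex"
  assumes "F \<in> borel_measurable borel"
  shows "(LINT p|distr \<nu> borel prod.swap. F p) = (LINT p|\<nu>. F (snd p, fst p))"
  using assms by (subst integral_distr) (simp_all add: prod.swap_def)

text \<open>\<open>v\<close> represents Pi* Pi applied to \<open>\<psi>\<close>. Both
  \<open>v\<close> and \<open>\<psi>\<close> have the support and invariance of the initial
  subspace, so their combination \<open>f\<close> is zero as soon as it is orthogonal to all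
  compatible functions.\<close>

lemma adjoint_Pi_Pi:
  assumes u: "is_Pi \<psi> u" and v: "polyhom_marginals.is_Pi \<eta> \<gamma> (distr \<nu> borel prod.swap) u v"
    and supp: "AE h in \<eta>. h \<notin> Range R \<longrightarrow> \<psi> h = 0"
    and inv: "\<And>d. d \<in> indef_rel R \<Longrightarrow> AE h in \<eta>. \<psi> (d + h) = \<psi> h"
  shows "AE h in \<eta>. v h = complex_of_real (a * b) * \<psi> h"
proof -
  interpret S: polyhom_marginals \<eta> \<gamma> "R\<inverse>" "distr \<nu> borel prod.swap" b a
    by (rule swap_marginals)
  have sq: "\<psi> \<in> square_integrable \<eta>" "u \<in> square_integrable \<gamma>" "v \<in> square_integrable \<eta>"
    using u v by (auto simp: is_Pi_def S.is_Pi_def)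
  have [measurable]: "\<psi> \<in> borel_measurable borel" "u \<in> borel_measurable borel"
    using sq square_integrable_borel by auto
  define f where "f h = v h - complex_of_real (a * b) * \<psi> h" for h
  have "AE h in \<eta>. f h = 0"
  proof (rule L2_supp_inv_separating)
    show "f \<in> square_integrable \<eta>"
      unfolding f_def by (intro square_integrable_diff square_integrable_scale sq)
    have "AE h in \<eta>. h \<notin> Range R \<longrightarrow> v h = 0"
      using S.is_Pi_support[OF v] by simp
    with supp show "AE h in \<eta>. h \<notin> Range R \<longrightarrow> f h = 0"
      by eventually_elim (simp add: f_def)
    show "AE h in \<eta>. f (d + h) = f h" if d: "d \<in> indef_rel R" for d
    proof -
      have "d \<in> ker_rel (R\<inverse>)" using d by (simp add: ker_rel_def indef_rel_def)
      from S.is_Pi_invariant[OF v this] inv[OF d] show ?thesis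
        by eventually_elim (simp add: f_def)
    qed
    fix \<phi> w assume comp: "compatible \<gamma> \<eta> R \<phi> w"
    define \<Phi> where "\<Phi> g = complex_of_real (enn2real (\<phi> g))" for g
    define W where "W h = complex_of_real (enn2real (w h))" for h
    have [measurable]: "\<Phi> \<in> borel_measurable borel" "W \<in> borel_measurable borel"
      unfolding \<Phi>_def W_def using comp by (auto simp: compatible_def)
    have "ennreal ((cmod (\<Phi> g))\<^sup>2) = (\<phi> g)\<^sup>2" "ennreal ((cmod (W h))\<^sup>2) = (w h)\<^sup>2" for g h
      using comp by (simp_all add: compatible_def \<Phi>_def W_def ennreal_power[symmetric])
    then have \<Phi>W: "\<Phi> \<in> square_integrable \<gamma>" "W \<in> square_integrable \<eta>"
      using comp by (auto simp: square_integrable_iff measurable_gamma measurable_eta compatible_def)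
    have \<Phi>0: "\<Phi> g = 0" if "g \<notin> Domain R" for g
      using comp that unfolding compatible_def \<Phi>_def by simp
    have W0: "W h = 0" if "h \<notin> Range R" for h
      using comp that unfolding compatible_def W_def by simp
    have \<Phi>W_eq: "AE p in \<nu>. \<Phi> (fst p) = W (snd p)"
      using AE_R by eventually_elim (use comp in \<open>auto simp: compatible_def \<Phi>_def W_def\<close>)
    \<comment> \<open>\<open>W\<close> and \<open>\<Phi>\<close> agree on \<open>R\<close>. Each
      exchange of one for the other turns a mixed integral over \<open>R\<close> into an integral
      over one factor: the first yields the constant \<open>a\<close>, the second
      \<open>b\<close>.\<close>
    have "(LINT h|\<eta>. W h * cnj (v h)) = (LINT p|distr \<nu> borel prod.swap. W (fst p) * cnj (u (snd p)))"
      using v \<Phi>W by (simp add: S.is_Pi_def)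
    also have "\<dots> = (LINT p|\<nu>. W (snd p) * cnj (u (fst p)))"
      by (subst integral_swap) simp_all
    also have "\<dots> = (LINT p|\<nu>. \<Phi> (fst p) * cnj (u (fst p)))"
      by (rule integral_cong_AE) (use \<Phi>W_eq in \<open>auto elim: eventually_mono\<close>)
    also have "\<dots> = complex_of_real a * (LINT g|\<gamma>. \<Phi> g * cnj (u g))"
      by (rule integral_fst_nu) (simp_all add: \<Phi>0)
    also have "(LINT g|\<gamma>. \<Phi> g * cnj (u g)) = (LINT p|\<nu>. \<Phi> (fst p) * cnj (\<psi> (snd p)))"
      using u \<Phi>W by (simp add: is_Pi_def)
    also have "\<dots> = (LINT p|\<nu>. W (snd p) * cnj (\<psi> (snd p)))"
      by (rule integral_cong_AE) (use \<Phi>W_eq in \<open>auto elim: eventually_mono\<close>)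
    also have "\<dots> = complex_of_real b * (LINT h|\<eta>. W h * cnj (\<psi> h))"
      by (rule integral_snd_nu) (simp_all add: W0)
    finally have Wv: "(LINT h|\<eta>. W h * cnj (v h)) = complex_of_real (a * b) * (LINT h|\<eta>. W h * cnj (\<psi> h))"
      by simp
    have i: "integrable \<eta> (\<lambda>h. W h * cnj (v h))" "integrable \<eta> (\<lambda>h. W h * cnj (\<psi> h))"
      using square_integrable_mult \<Phi>W sq square_integrable_cnj by blast+
    have "(LINT h|\<eta>. W h * cnj (f h))
        = (LINT h|\<eta>. W h * cnj (v h) - complex_of_real (a * b) * (W h * cnj (\<psi> h)))"
      by (simp add: f_def algebra_simps)
    also have "\<dots> = 0"
      using i Wv by simp
    finally show "(LINT h|\<eta>. complex_of_real (enn2real (w h)) * cnj (f h)) = 0"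
      by (simp add: W_def)
  qed
  then show ?thesis
    by eventually_elim (simp add: f_def)
qed

definition Pi_class :: "('h \<Rightarrow> complex) set \<Rightarrow> ('g \<Rightarrow> complex) set" where
  "Pi_class = (\<lambda>X\<in>hcarrier (L2 \<eta>). l2_class \<gamma> (SOME u. is_Pi (l2_rep X) u))"

text \<open>Neither the representative nor the chosen \<open>u\<close> affects the class, by
  \<open>is_Pi_unique\<close>.\<close>

lemma Pi_class_eq:
  assumes "is_Pi \<psi> u"
  shows "Pi_class (l2_class \<eta> \<psi>) = l2_class \<gamma> u"
proof -
  have \<psi>: "\<psi> \<in> square_integrable \<eta>"
    using assms by (simp add: is_Pi_def)
  have "is_Pi (l2_rep (l2_class \<eta> \<psi>)) (SOME u. is_Pi (l2_rep (l2_class \<eta> \<psi>)) u)"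
    using is_Pi_exists[OF l2_rep_class(1)[OF \<psi>]] by (metis someI)
  then have "AE g in \<gamma>. (SOME u. is_Pi (l2_rep (l2_class \<eta> \<psi>)) u) g = u g"
    using assms l2_rep_class(2)[OF \<psi>] by (rule is_Pi_unique)
  then show ?thesis
    using \<psi> by (simp add: Pi_class_def hcarrier_L2 l2_class_cong)
qed

text \<open>The adjoint is the operator of the reversed relation, for which \<open>a\<close> and
  \<open>b\<close> and the two subspaces are exchanged.\<close>

lemma scaled_partial_isometry_Pi_class:
  "scaled_partial_isometry (L2 \<eta>) (L2 \<gamma>) Pi_class
     (polyhom_marginals.Pi_class \<eta> \<gamma> (distr \<nu> borel prod.swap))
     (L2_supp_inv \<eta> (Range R) (indef_rel R)) (L2_supp_inv \<gamma> (Domain R) (ker_rel R)) (a * b)"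
proof -
  interpret S: polyhom_marginals \<eta> \<gamma> "R\<inverse>" "distr \<nu> borel prod.swap" b a
    by (rule swap_marginals)
  have ker: "ker_rel (R\<inverse>) = indef_rel R" "indef_rel (R\<inverse>) = ker_rel R"
    by (auto simp: ker_rel_def indef_rel_def)
  \<comment> \<open>Reversing twice restores \<open>\<nu>\<close>, which lets
    \<open>S.adjoint_Pi_Pi\<close> serve for the product in the other order.\<close>
  have SS: "distr (distr \<nu> borel prod.swap) borel prod.swap = \<nu>"
    by (subst distr_distr) (auto simp: comp_def intro: distr_id2)
  have carrier: "\<exists>f\<in>square_integrable \<mu>. X = l2_class \<mu> f" if "X \<in> hcarrier (L2 \<mu>)"
    for X and \<mu> :: "'b measure"
    using that by (auto simp: hcarrier_L2)
  have Pi_obtain: "\<exists>\<psi> u. X = l2_class \<eta> \<psi> \<and> is_Pi \<psi> u \<and> Pi_class X = l2_class \<gamma> u"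
    if "X \<in> hcarrier (L2 \<eta>)" for X
    using carrier[OF that] is_Pi_exists Pi_class_eq by metis
  have SPi_obtain: "\<exists>\<phi> v. Y = l2_class \<gamma> \<phi> \<and> S.is_Pi \<phi> v \<and> S.Pi_class Y = l2_class \<eta> v"
    if "Y \<in> hcarrier (L2 \<gamma>)" for Y
    using carrier[OF that] S.is_Pi_exists S.Pi_class_eq by metis
  have T_M: "Pi_class X \<in> L2_supp_inv \<gamma> (Domain R) (ker_rel R)" if X: "X \<in> hcarrier (L2 \<eta>)" for X
  proof -
    obtain \<psi> u where *: "is_Pi \<psi> u" "Pi_class X = l2_class \<gamma> u" using Pi_obtain[OF X] by blast
    have "u \<in> square_integrable \<gamma>" using *(1) by (simp add: is_Pi_def)
    then show ?thesis
      unfolding *(2) by (rule G.L2_supp_invI[OF _ is_Pi_support[OF *(1)] is_Pi_invariant[OF *(1)]])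
  qed
  have T'_L: "S.Pi_class Y \<in> L2_supp_inv \<eta> (Range R) (indef_rel R)" if Y: "Y \<in> hcarrier (L2 \<gamma>)" for Y
  proof -
    obtain \<phi> v where *: "S.is_Pi \<phi> v" "S.Pi_class Y = l2_class \<eta> v" using SPi_obtain[OF Y] by blast
    have "v \<in> square_integrable \<eta>" using *(1) by (simp add: S.is_Pi_def)
    then show ?thesis
      unfolding *(2) using S.is_Pi_support[OF *(1)] S.is_Pi_invariant[OF *(1), unfolded ker]
      by (intro H.L2_supp_invI) simp_all
  qed
  show ?thesis
  proof (intro scaled_partial_isometry.intro adjoint_pair.intro inner_space_L2
      adjoint_pair_axioms.intro scaled_partial_isometry_axioms.intro T_M T'_L)
    show "L2_supp_inv \<eta> (Range R) (indef_rel R) \<subseteq> hcarrier (L2 \<eta>)"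
      and "L2_supp_inv \<gamma> (Domain R) (ker_rel R) \<subseteq> hcarrier (L2 \<gamma>)"
      by (auto simp: L2_supp_inv_def)
    then show "Pi_class X \<in> hcarrier (L2 \<gamma>)" if "X \<in> hcarrier (L2 \<eta>)" for X
      using T_M[OF that] by blast
    show "S.Pi_class Y \<in> hcarrier (L2 \<eta>)" if "Y \<in> hcarrier (L2 \<gamma>)" for Y
      using T'_L[OF that] \<open>L2_supp_inv \<eta> (Range R) (indef_rel R) \<subseteq> hcarrier (L2 \<eta>)\<close> by blast
    show "0 < a * b" using a_pos b_pos by simp
    show "hinner (L2 \<gamma>) Y (Pi_class X) = hinner (L2 \<eta>) (S.Pi_class Y) X"
      if X: "X \<in> hcarrier (L2 \<eta>)" and Y: "Y \<in> hcarrier (L2 \<gamma>)" for X Y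
    proof -
      obtain \<psi> u where u: "X = l2_class \<eta> \<psi>" "is_Pi \<psi> u" "Pi_class X = l2_class \<gamma> u"
        using Pi_obtain[OF X] by blast
      obtain \<phi> v where v: "Y = l2_class \<gamma> \<phi>" "S.is_Pi \<phi> v" "S.Pi_class Y = l2_class \<eta> v"
        using SPi_obtain[OF Y] by blast
      have sq: "\<psi> \<in> square_integrable \<eta>" "u \<in> square_integrable \<gamma>"
        "\<phi> \<in> square_integrable \<gamma>" "v \<in> square_integrable \<eta>"
        using u v by (auto simp: is_Pi_def S.is_Pi_def)
      have [measurable]: "\<phi> \<in> borel_measurable borel" "\<psi> \<in> borel_measurable borel"
        using sq square_integrable_borel by auto
      have "(LINT h|\<eta>. v h * cnj (\<psi> h)) = (LINT h|\<eta>. cnj (\<psi> h * cnj (v h)))"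
        by (simp add: mult.commute)
      also have "\<dots> = cnj (LINT h|\<eta>. \<psi> h * cnj (v h))"
        by (rule Bochner_Integration.integral_cnj)
      also have "(LINT h|\<eta>. \<psi> h * cnj (v h)) = (LINT p|\<nu>. \<psi> (snd p) * cnj (\<phi> (fst p)))"
        using v sq integral_swap[of "\<lambda>p. \<psi> (fst p) * cnj (\<phi> (snd p))"] by (simp add: S.is_Pi_def)
      also have "cnj \<dots> = (LINT p|\<nu>. cnj (\<psi> (snd p) * cnj (\<phi> (fst p))))"
        by (rule Bochner_Integration.integral_cnj[symmetric])
      also have "\<dots> = (LINT p|\<nu>. \<phi> (fst p) * cnj (\<psi> (snd p)))"
        by (simp add: mult.commute)
      also have "\<dots> = (LINT g|\<gamma>. \<phi> g * cnj (u g))"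
        using u sq by (simp add: is_Pi_def)
      finally show ?thesis
        using sq unfolding u(3) v(3) unfolding u(1) v(1) by (simp add: hinner_L2_class)
    qed
    show "S.Pi_class (Pi_class X) = hscale (L2 \<eta>) (complex_of_real (a * b)) X"
      if X: "X \<in> L2_supp_inv \<eta> (Range R) (indef_rel R)" for X
    proof -
      have "X \<in> hcarrier (L2 \<eta>)" using X by (simp add: L2_supp_inv_def)
      then obtain \<psi> u where u: "X = l2_class \<eta> \<psi>" "is_Pi \<psi> u" "Pi_class X = l2_class \<gamma> u"
        using Pi_obtain by blast
      then have sq: "\<psi> \<in> square_integrable \<eta>" "u \<in> square_integrable \<gamma>"
        by (auto simp: is_Pi_def)
      obtain v where v: "S.is_Pi u v" using S.is_Pi_exists[OF sq(2)] .
      have "AE h in \<eta>. v h = complex_of_real (a * b) * \<psi> h"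
        using adjoint_Pi_Pi[OF u(2) v] L2_supp_invD[OF X[unfolded u(1)] sq(1)] by blast
      then show ?thesis
        unfolding u(3) S.Pi_class_eq[OF v] unfolding u(1) using sq
        by (simp add: hscale_L2_class l2_class_cong)
    qed
    show "Pi_class (S.Pi_class Y) = hscale (L2 \<gamma>) (complex_of_real (a * b)) Y"
      if Y: "Y \<in> L2_supp_inv \<gamma> (Domain R) (ker_rel R)" for Y
    proof -
      have "Y \<in> hcarrier (L2 \<gamma>)" using Y by (simp add: L2_supp_inv_def)
      then obtain \<phi> v where v: "Y = l2_class \<gamma> \<phi>" "S.is_Pi \<phi> v" "S.Pi_class Y = l2_class \<eta> v"
        using SPi_obtain by blast
      then have sq: "\<phi> \<in> square_integrable \<gamma>" "v \<in> square_integrable \<eta>"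
        by (auto simp: S.is_Pi_def)
      obtain u where u: "is_Pi v u" using is_Pi_exists[OF sq(2)] .
      have "AE g in \<gamma>. u g = complex_of_real (b * a) * \<phi> g"
        using S.adjoint_Pi_Pi[OF v(2), unfolded SS, OF u] L2_supp_invD[OF Y[unfolded v(1)] sq(1)]
        by (simp add: ker)
      then show ?thesis
        unfolding v(3) Pi_class_eq[OF u] unfolding v(1) using sq
        by (simp add: hscale_L2_class l2_class_cong mult.commute)
    qed
  qed
qed

end

section \<open>Passage from \<open>R\<close> to the product group, and identification of the
  constants and the operator\<close>

lemma polyhom_of_nonzero_polyhom:
  assumes "unimodular_lc_group \<gamma>" "unimodular_lc_group \<eta>" and R: "nonzero_polyhom \<gamma> \<eta> R \<rho>"
  shows "polyhom \<gamma> \<eta> R (distr \<rho> borel (\<lambda>p. p))"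
    and "\<And>S. S \<in> sets borel \<Longrightarrow> emeasure (distr \<rho> borel (\<lambda>p. p)) S = emeasure \<rho> (R \<inter> S)"
    and "(\<lambda>p. p) \<in> \<rho> \<rightarrow>\<^sub>M borel"
proof -
  have haar: "space \<rho> = R" "sets \<rho> = sets (restrict_space borel R)" "emeasure \<rho> R \<noteq> 0"
    and inv: "\<And>x A. x \<in> R \<Longrightarrow> A \<in> sets \<rho> \<Longrightarrow> emeasure \<rho> ((\<lambda>y. x + y) ` A) = emeasure \<rho> A"
    and sub: "add_subgroup R" and cl: "closed R"
    and le_fst: "\<And>A. A \<in> sets borel \<Longrightarrow> emeasure \<rho> (R \<inter> (A \<times> UNIV)) \<le> emeasure \<gamma> A"
    and le_snd: "\<And>B. B \<in> sets borel \<Longrightarrow> emeasure \<rho> (R \<inter> (UNIV \<times> B)) \<le> emeasure \<eta> B"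
    using R by (auto simp: nonzero_polyhom_def haar_measure_on_def)
  have R_borel [measurable]: "R \<in> sets borel" using cl by simp
  show id [measurable]: "(\<lambda>p. p) \<in> \<rho> \<rightarrow>\<^sub>M borel"
    using measurable_restrict_space1[OF measurable_ident, of borel R]
    by (simp add: measurable_cong_sets[OF haar(2) refl] id_def)
  show em: "emeasure (distr \<rho> borel (\<lambda>p. p)) S = emeasure \<rho> (R \<inter> S)" if "S \<in> sets borel" for S
    using that by (simp add: emeasure_distr haar(1) Int_commute)
  show "polyhom \<gamma> \<eta> R (distr \<rho> borel (\<lambda>p. p))"
  proof (intro polyhom.intro unimodular_haar.intro assms(1,2) polyhom_axioms.intro sub cl)
    show "AE p in distr \<rho> borel (\<lambda>p. p). p \<in> R"
      using AE_space[of \<rho>] by (subst AE_distr_iff) (simp_all add: haar(1))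
    show "emeasure (distr \<rho> borel (\<lambda>p. p)) UNIV \<noteq> 0"
      using haar by (simp add: em)
    show "emeasure (distr \<rho> borel (\<lambda>p. p)) (A \<times> UNIV) \<le> emeasure \<gamma> A" if "A \<in> sets borel" for A
      using le_fst[OF that] that by (subst em) (auto simp: borel_prod[symmetric])
    show "emeasure (distr \<rho> borel (\<lambda>p. p)) (UNIV \<times> B) \<le> emeasure \<eta> B" if "B \<in> sets borel" for B
      using le_snd[OF that] that by (subst em) (auto simp: borel_prod[symmetric])
    show "distr (distr \<rho> borel (\<lambda>p. p)) borel (\<lambda>p. (fst x + fst p, snd x + snd p))
        = distr \<rho> borel (\<lambda>p. p)" if x: "x \<in> R" for x
    proof (rule measure_eqI)
      have shift [measurable]: "(\<lambda>p. (fst x + fst p, snd x + snd p)) \<in> borel \<rightarrow>\<^sub>M borel"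
        by (intro borel_measurable_continuous_onI continuous_intros)
      fix S assume "S \<in> sets (distr (distr \<rho> borel (\<lambda>p. p)) borel (\<lambda>p. (fst x + fst p, snd x + snd p)))"
      then have S [measurable]: "S \<in> sets borel" by simp
      have mx: "- x \<in> R" using sub x by (simp add: add_subgroup_def)
      \<comment> \<open>Invariance is given for forward images within \<open>R\<close>, whereas
        \<open>distr\<close> works with preimages; the preimage under translation by
        \<open>x\<close> is the image under translation by \<open>- x\<close>.\<close>
      have "R \<inter> (\<lambda>p. (fst x + fst p, snd x + snd p)) -` S = (\<lambda>y. - x + y) ` (R \<inter> S)"
      proof (intro equalityI subsetI)
        fix p assume p: "p \<in> R \<inter> (\<lambda>p. (fst x + fst p, snd x + snd p)) -` S"
        then have "x + p \<in> R \<inter> S"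
          using sub x by (auto simp: add_subgroup_def plus_prod_def)
        moreover have "p = - x + (x + p)" by (simp add: add.assoc[symmetric])
        ultimately show "p \<in> (\<lambda>y. - x + y) ` (R \<inter> S)" by (rule rev_image_eqI)
      next
        fix p assume "p \<in> (\<lambda>y. - x + y) ` (R \<inter> S)"
        then obtain y where y: "y \<in> R" "y \<in> S" "p = - x + y" by blast
        then have "x + p = y" by (simp add: add.assoc[symmetric])
        then have "(fst x + fst p, snd x + snd p) \<in> S"
          using y by (simp add: plus_prod_def)
        moreover have "p \<in> R"
          using y sub mx by (simp add: add_subgroup_def)
        ultimately show "p \<in> R \<inter> (\<lambda>p. (fst x + fst p, snd x + snd p)) -` S" by simp
      qed
      moreover have "R \<inter> S \<in> sets \<rho>"
        by (simp add: haar(2) sets_restrict_space)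
      moreover have "(\<lambda>p. (fst x + fst p, snd x + snd p)) -` S \<in> sets borel"
        using measurable_sets[OF shift S] by simp
      ultimately show "emeasure (distr (distr \<rho> borel (\<lambda>p. p)) borel (\<lambda>p. (fst x + fst p, snd x + snd p))) S
          = emeasure (distr \<rho> borel (\<lambda>p. p)) S"
        using inv[OF mx, of "R \<inter> S"] by (simp add: emeasure_distr haar(1) Int_commute)
    qed simp
  qed simp
qed

text \<open>This is the uniqueness behind the definite descriptions \<open>alpha_const\<close> and
  \<open>beta_const\<close>.\<close>

lemma marginal_constant_unique:
  fixes a a' :: real
  assumes "unimodular_lc_group \<mu>" and D: "D \<in> sets borel" "emeasure \<mu> D \<noteq> 0" and "0 < a" "0 < a'"
    and "\<And>A. A \<in> sets borel \<Longrightarrow> ennreal a * emeasure \<mu> (A \<inter> D) = ennreal a' * emeasure \<mu> (A \<inter> D)"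
  shows "a = a'"
proof -
  interpret unimodular_haar \<mu> by standard (rule assms(1))
  obtain A where A: "A \<in> sets borel" "A \<subseteq> D" "emeasure \<mu> A \<noteq> 0" "emeasure \<mu> A < \<infinity>"
    using exists_finite_pos[OF D] by blast
  then have "emeasure \<mu> A * ennreal a = emeasure \<mu> A * ennreal a'"
    using assms(6)[OF A(1)] by (simp add: Int_absorb2 mult.commute)
  then have "ennreal a = ennreal a'"
    using A by (auto simp: ennreal_mult_cancel_left)
  then show ?thesis using assms(4,5) by simp
qed

theorem proposition1p6:
  fixes \<gamma> :: "'g::{topological_group_add, t2_space, second_countable_topology} measure"
    and \<eta> :: "'h::{topological_group_add, t2_space, second_countable_topology} measure"
    and R :: "('g \<times> 'h) set"
    and \<rho> :: "('g \<times> 'h) measure"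
  assumes "unimodular_lc_group \<gamma>"
    and "unimodular_lc_group \<eta>"
    and "nonzero_polyhom \<gamma> \<eta> R \<rho>"
  shows "partial_isometry (L2 \<eta>) (L2 \<gamma>)
           (L2_supp_inv \<eta> (Range R) (indef_rel R))
           (L2_supp_inv \<gamma> (Domain R) (ker_rel R))
           (Pi_tilde \<gamma> \<eta> R \<rho>)"
proof -
  define \<nu> where "\<nu> = distr \<rho> borel (\<lambda>p. p)"
  note nu = polyhom_of_nonzero_polyhom[OF assms, folded \<nu>_def]
  interpret P: polyhom \<gamma> \<eta> R \<nu> by (rule nu(1))
  obtain a where a: "0 < a" "distr \<nu> borel fst = density \<gamma> (\<lambda>g. ennreal a * indicator (Domain R) g)"
    using P.fst_marginal by metis
  \<comment> \<open>The second marginal is the first marginal of the reversed relation.\<close>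
  obtain b where b: "0 < b" "distr \<nu> borel snd = density \<eta> (\<lambda>h. ennreal b * indicator (Range R) h)"
  proof -
    have [measurable]: "prod.swap \<in> \<nu> \<rightarrow>\<^sub>M borel" "fst \<in> (borel :: ('h \<times> 'g) measure) \<rightarrow>\<^sub>M borel"
      by (simp_all add: measurable_cong_sets[OF P.sets_nu refl] borel_measurable_continuous_onI
          continuous_on_swap continuous_on_fst continuous_on_id)
    have "distr (distr \<nu> borel prod.swap) borel fst = distr \<nu> borel snd"
      by (subst distr_distr) (simp_all add: comp_def)
    then show ?thesis
      using that polyhom.fst_marginal[OF P.swap] by (metis Domain_converse)
  qed
  interpret polyhom_marginals \<gamma> \<eta> R \<nu> a b
    by standard (use a b in auto)
  interpret S: polyhom_marginals \<eta> \<gamma> "R\<inverse>" "distr \<nu> borel prod.swap" b a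
    by (rule swap_marginals)
  interpret I: scaled_partial_isometry "L2 \<eta>" "L2 \<gamma>" Pi_class S.Pi_class
    "L2_supp_inv \<eta> (Range R) (indef_rel R)" "L2_supp_inv \<gamma> (Domain R) (ker_rel R)" "a * b"
    by (rule scaled_partial_isometry_Pi_class)
  have fst_eq: "emeasure \<rho> (R \<inter> (A \<times> UNIV)) = ennreal a * emeasure \<gamma> (A \<inter> Domain R)"
    if [measurable]: "A \<in> sets borel" for A
  proof -
    have "emeasure \<rho> (R \<inter> (A \<times> UNIV)) = emeasure (distr \<nu> borel fst) A"
      using that nu(2)[of "A \<times> UNIV"] by (simp add: P.emeasure_fst borel_prod[symmetric])
    also have "\<dots> = (\<integral>\<^sup>+g. ennreal a * indicator (A \<inter> Domain R) g \<partial>\<gamma>)"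
      unfolding a(2) by (subst emeasure_density) (auto intro!: nn_integral_cong simp: indicator_def)
    also have "\<dots> = ennreal a * emeasure \<gamma> (A \<inter> Domain R)"
      by (simp add: nn_integral_cmult_indicator)
    finally show ?thesis .
  qed
  have snd_eq: "emeasure \<rho> (R \<inter> (UNIV \<times> B)) = ennreal b * emeasure \<eta> (B \<inter> Range R)"
    if [measurable]: "B \<in> sets borel" for B
  proof -
    have "emeasure \<rho> (R \<inter> (UNIV \<times> B)) = emeasure (distr \<nu> borel snd) B"
      using that nu(2)[of "UNIV \<times> B"] by (simp add: emeasure_distr borel_prod[symmetric] vimage_snd)
    also have "\<dots> = (\<integral>\<^sup>+h. ennreal b * indicator (B \<inter> Range R) h \<partial>\<eta>)"
      unfolding b(2) by (subst emeasure_density) (auto intro!: nn_integral_cong simp: indicator_def)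
    also have "\<dots> = ennreal b * emeasure \<eta> (B \<inter> Range R)"
      by (simp add: nn_integral_cmult_indicator)
    finally show ?thesis .
  qed
  have nz: "emeasure \<gamma> (Domain R) \<noteq> 0" "emeasure \<eta> (Range R) \<noteq> 0"
    using Range_nonnull S.Range_nonnull by (auto simp: AE_iff_measurable[OF _ refl])
  have "alpha_const \<gamma> R \<rho> = a"
    unfolding alpha_const_def
    by (rule the_equality)
      (use a(1) fst_eq marginal_constant_unique[OF assms(1) _ nz(1)] in auto)
  moreover have "beta_const \<eta> R \<rho> = b"
    unfolding beta_const_def
    by (rule the_equality)
      (use b(1) snd_eq marginal_constant_unique[OF assms(2) _ nz(2)] in auto)
  moreover have "Pi_op \<gamma> \<eta> \<rho> = Pi_class"
    unfolding Pi_op_def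
  proof (rule the_equality)
    have bounded: "bounded_operator (L2 \<eta>) (L2 \<gamma>) Pi_class"
      by (rule I.bounded_operator_T) (simp add: Pi_class_def)
    have inner: "hinner (L2 \<gamma>) (l2_class \<gamma> \<phi>) (Pi_class (l2_class \<eta> \<psi>))
        = (LINT p|\<rho>. \<phi> (fst p) * cnj (\<psi> (snd p)))"
      if \<phi>: "\<phi> \<in> square_integrable \<gamma>" and \<psi>: "\<psi> \<in> square_integrable \<eta>" for \<phi> \<psi>
    proof -
      obtain u where u: "is_Pi \<psi> u" using is_Pi_exists[OF \<psi>] .
      have [measurable]: "\<phi> \<in> borel_measurable borel" "\<psi> \<in> borel_measurable borel"
        using \<phi> \<psi> square_integrable_borel by auto
      have "hinner (L2 \<gamma>) (l2_class \<gamma> \<phi>) (Pi_class (l2_class \<eta> \<psi>))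
          = (LINT p|\<nu>. \<phi> (fst p) * cnj (\<psi> (snd p)))"
        using u \<phi> by (simp add: Pi_class_eq[OF u] hinner_L2_class is_Pi_def)
      then show ?thesis
        unfolding \<nu>_def by (subst (asm) integral_distr[OF nu(3)]) simp_all
    qed
    show *: "bounded_operator (L2 \<eta>) (L2 \<gamma>) Pi_class \<and>
      (\<forall>\<phi>\<in>square_integrable \<gamma>. \<forall>\<psi>\<in>square_integrable \<eta>.
        hinner (L2 \<gamma>) (l2_class \<gamma> \<phi>) (Pi_class (l2_class \<eta> \<psi>))
          = (LINT p|\<rho>. \<phi> (fst p) * cnj (\<psi> (snd p))))"
      using bounded inner by blast
    fix T assume T: "bounded_operator (L2 \<eta>) (L2 \<gamma>) T \<and>
      (\<forall>\<phi>\<in>square_integrable \<gamma>. \<forall>\<psi>\<in>square_integrable \<eta>.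
        hinner (L2 \<gamma>) (l2_class \<gamma> \<phi>) (T (l2_class \<eta> \<psi>))
          = (LINT p|\<rho>. \<phi> (fst p) * cnj (\<psi> (snd p))))"
    \<comment> \<open>The integral formula fixes the pairing of \<open>T x\<close> with every
      vector, and operators are extensional.\<close>
    show "T = Pi_class"
      by (rule I.W.bounded_operator_eqI[OF _ bounded]) (use T inner in \<open>auto simp: hcarrier_L2\<close>)
  qed
  ultimately have "Pi_tilde \<gamma> \<eta> R \<rho>
      = scale_operator (L2 \<eta>) (L2 \<gamma>) (complex_of_real ((a * b) powr (-1/2))) Pi_class"
    by (simp add: Pi_tilde_def)
  then show ?thesis
    using I.partial_isometry_scaled by simp
qed

end
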